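(* Let $f:(\mathbb{C}^2,0)\rightarrow(\mathbb{C}^3,0)$ be a quasihomogeneous and finitely determined map germ of corank $1$. Let $F(x,y,t)=(f_t(x,y),t)$ be a topologically trivial $1$-parameter unfolding of $f$, with $f_t(0)=0$ for all $t$. If $F$ is an unfolding of non-decreasing weights, then the family $F(\mathbb{C}^2\times\mathbb{C})$ is equimultiple.
   Context: All map germs are holomorphic. Corank. $f$ has corank $1$ if its differential at $0$ has rank $1$. Quasihomogeneous. A polynomial map germ $f=(f_1,f_2,f_3):(\mathbb{C}^2,0)\to(\mathbb{C}^3,0)$ is quasihomogeneous of type $(d_1,d_2,d_3;w_1,w_2)$, where $w_1,w_2$ are positive integers with no common factor, if $f_i(k^{w_1}x,k^{w_2}y)=k^{d_i}f_i(x,y)$ for $i=1,2,3$. Finite determinacy. Two germs $f,g:(\mathbb{C}^2,0)\to(\mathbb{C}^3,0)$ are $\mathcal{A}$-equivalent if $g=\xi\circ f\circ\eta$ for germs of diffeomorphisms (biholomorphisms) $\eta$ of $(\mathbb{C}^2,0)$ and $\xi$ of $(\mathbb{C}^3,0)$. The germ $f$ is finitely determined if there is a positive integer $k$ such that every $g$ with the same $k$-jet at $0$ as $f$ is $\mathcal{A}$-equivalent to $f$. Unfolding. $F:(\mathbb{C}^2\times\mathbb{C},0)\to(\mathbb{C}^3\times\mathbb{C},0)$, $F(x,y,t)=(f_t(x,y),t)$, is a holomorphic germ with $f_0=f$; the origin is preserved, i.e. $f_t(0)=0$ for all $t$. Non-decreasing weights. For $f$ quasihomogeneous of type $(d_1,d_2,d_3;w_1,w_2)$,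 the unfolding $F$ is of non-decreasing weights if, for each $i=1,2,3$, every monomial $x^{a}y^{c}$ that appears with a nonzero coefficient in $\mathbb{C}\{t\}$ in the $i$-th coordinate function of $f_t-f$ (expanded as a power series in $x,y$ with coefficients in $\mathbb{C}\{t\}$) satisfies $w_1a+w_2c\geq d_i$. Topological triviality. $F$ is topologically trivial if there are germs of homeomorphisms $\Phi:(\mathbb{C}^2\times\mathbb{C},0)\to(\mathbb{C}^2\times\mathbb{C},0)$, $\Phi(z,t)=(\phi_t(z),t)$, $\phi_0(z)=z$, $\phi_t(0)=0$, and $\Psi:(\mathbb{C}^3\times\mathbb{C},0)\to(\mathbb{C}^3\times\mathbb{C},0)$, $\Psi(z,t)=(\psi_t(z),t)$, $\psi_0(z)=z$, $\psi_t(0)=0$, such that $\Psi^{-1}\circ F\circ\Phi=I$, where $I(z,t)=(f(z),t)$ is the trivial unfolding. Equimultiplicity. For a hypersurface germ $(X,0)\subset(\mathbb{C}^3,0)$ (with reduced structure), the multiplicity $m(X)$ at $0$ is the number of points of intersection, near $0$, of $X$ with a generic line passing close to the origin but not through it. The family $F(\mathbb{C}^2\times\mathbb{C})$ is equimultiple if $m(f_t(\mathbb{C}^2))=m(f(\mathbb{C}^2))$ for all $t$ near $0$, where $m(f_t(\mathbb{C}^2))$ is the multiplicity at $0$ of the image of $f_t$. *)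

theory Defs
  imports "HOL-Analysis.Analysis"
begin

text \<open>
  Germs at the origin are given by representatives: total functions of which only the
  behaviour near 0 (\<open>eventually \<dots> (nhds 0)\<close>) is used.
\<close>

text \<open>Differentiable near 0 with complex linear differentials, i.e. given by complex matrices.\<close>

definition holomorphic_germ :: "(complex^'n \<Rightarrow> complex^'m) \<Rightarrow> bool" where
  "holomorphic_germ f \<longleftrightarrow>
     (\<forall>\<^sub>F z in nhds 0. \<exists>A. (f has_derivative (\<lambda>v. A *v v)) (at z))"

definition biholomorphic_germ :: "(complex^'n \<Rightarrow> complex^'n) \<Rightarrow> bool" where
  "biholomorphic_germ h \<longleftrightarrow> holomorphic_germ h \<and> h 0 = 0 \<and>
     (\<exists>h'. holomorphic_germ h' \<and> h' 0 = 0 \<and>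
        (\<forall>\<^sub>F z in nhds 0. h' (h z) = z) \<and> (\<forall>\<^sub>F z in nhds 0. h (h' z) = z))"

definition corank_one :: "(complex^2 \<Rightarrow> complex^3) \<Rightarrow> bool" where
  "corank_one f \<longleftrightarrow> (\<exists>A. (f has_derivative (\<lambda>v. A *v v)) (at 0) \<and> rank A = 1)"

definition polynomial_map :: "(complex^2 \<Rightarrow> complex^3) \<Rightarrow> bool" where
  "polynomial_map f \<longleftrightarrow> (\<exists>N (c :: 3 \<Rightarrow> nat \<Rightarrow> nat \<Rightarrow> complex).
     \<forall>z i. f z $ i = (\<Sum>a\<le>N. \<Sum>b\<le>N. c i a b * (z $ 1) ^ a * (z $ 2) ^ b))"

definition quasihomogeneous ::
    "(complex^2 \<Rightarrow> complex^3) \<Rightarrow> (3 \<Rightarrow> nat) \<Rightarrow> nat \<Rightarrow> nat \<Rightarrow> bool" where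
  "quasihomogeneous f d w1 w2 \<longleftrightarrow>
     polynomial_map f \<and> f 0 = 0 \<and> w1 > 0 \<and> w2 > 0 \<and> coprime w1 w2 \<and>
     (\<forall>k x y i. f (vector [k ^ w1 * x, k ^ w2 * y]) $ i = k ^ d i * f (vector [x, y]) $ i)"

text \<open>The coefficient of \<open>x ^ a * y ^ b\<close> in the power series of \<open>h\<close> at 0.\<close>

definition taylor_coeff :: "(complex^2 \<Rightarrow> complex) \<Rightarrow> nat \<Rightarrow> nat \<Rightarrow> complex" where
  "taylor_coeff h a b =
     (deriv ^^ a) (\<lambda>x. (deriv ^^ b) (\<lambda>y. h (vector [x, y])) 0) 0 / (fact a * fact b)"

definition same_jet ::
    "nat \<Rightarrow> (complex^2 \<Rightarrow> complex^3) \<Rightarrow> (complex^2 \<Rightarrow> complex^3) \<Rightarrow> bool" where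
  "same_jet k f g \<longleftrightarrow> (\<forall>i a b. a + b \<le> k \<longrightarrow>
     taylor_coeff (\<lambda>z. f z $ i) a b = taylor_coeff (\<lambda>z. g z $ i) a b)"

definition A_equivalent ::
    "(complex^2 \<Rightarrow> complex^3) \<Rightarrow> (complex^2 \<Rightarrow> complex^3) \<Rightarrow> bool" where
  "A_equivalent f g \<longleftrightarrow> (\<exists>\<eta> \<xi>. biholomorphic_germ \<eta> \<and> biholomorphic_germ \<xi> \<and>
     (\<forall>\<^sub>F z in nhds 0. g z = \<xi> (f (\<eta> z))))"

definition finitely_determined :: "(complex^2 \<Rightarrow> complex^3) \<Rightarrow> bool" where
  "finitely_determined f \<longleftrightarrow> (\<exists>k>0. \<forall>g. holomorphic_germ g \<and> g 0 = 0 \<and> same_jet k f g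
     \<longrightarrow> A_equivalent f g)"

definition level_map :: "(complex \<Rightarrow> 'a \<Rightarrow> 'b) \<Rightarrow> 'a \<times> complex \<Rightarrow> 'b \<times> complex" where
  "level_map h = (\<lambda>(z, t). (h t z, t))"

text \<open>
  The unfolding is \<open>F = level_map ft\<close>. Its joint holomorphy in \<open>(z, t)\<close> is expressed through the
  complex linear maps from \<open>\<complex>\<^sup>2 \<times> \<complex>\<close> to \<open>\<complex>\<^sup>3\<close>, which are the maps \<open>(v, s) \<mapsto> A v + s b\<close>.
\<close>

definition unfolding_of ::
    "(complex^2 \<Rightarrow> complex^3) \<Rightarrow> (complex \<Rightarrow> complex^2 \<Rightarrow> complex^3) \<Rightarrow> bool" where
  "unfolding_of f ft \<longleftrightarrow>
     (\<forall>\<^sub>F p in nhds 0. \<exists>A b.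
        ((\<lambda>(z, t). ft t z) has_derivative (\<lambda>(v, s). A *v v + s *s b)) (at p)) \<and>
     (\<forall>\<^sub>F z in nhds 0. ft 0 z = f z) \<and>
     (\<forall>\<^sub>F t in nhds 0. ft t 0 = 0)"

text \<open>
  The coefficient of \<open>x ^ a * y ^ b\<close> in \<open>ft t - f\<close> is a germ in \<open>t\<close>, which is nonzero
  in the ring of convergent power series iff it does not vanish identically near 0.
\<close>

definition non_decreasing_weights ::
    "(complex^2 \<Rightarrow> complex^3) \<Rightarrow> (3 \<Rightarrow> nat) \<Rightarrow> nat \<Rightarrow> nat \<Rightarrow>
     (complex \<Rightarrow> complex^2 \<Rightarrow> complex^3) \<Rightarrow> bool" where
  "non_decreasing_weights f d w1 w2 ft \<longleftrightarrow> (\<forall>i a b.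
     \<not> (\<forall>\<^sub>F t in nhds 0. taylor_coeff (\<lambda>z. (ft t z - f z) $ i) a b = 0)
       \<longrightarrow> w1 * a + w2 * b \<ge> d i)"

text \<open>\<open>\<Phi>\<close> represents a germ of homeomorphism and \<open>\<Phi>'\<close> its inverse germ.\<close>

definition homeomorphism_germ ::
    "('a::{topological_space,zero} \<Rightarrow> 'a) \<Rightarrow> ('a \<Rightarrow> 'a) \<Rightarrow> bool" where
  "homeomorphism_germ \<Phi> \<Phi>' \<longleftrightarrow> \<Phi> 0 = 0 \<and>
     (\<exists>U V. open U \<and> 0 \<in> U \<and> open V \<and> 0 \<in> V \<and> homeomorphism U V \<Phi> \<Phi>')"

definition topologically_trivial ::
    "(complex^2 \<Rightarrow> complex^3) \<Rightarrow> (complex \<Rightarrow> complex^2 \<Rightarrow> complex^3) \<Rightarrow> bool" where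
  "topologically_trivial f ft \<longleftrightarrow> (\<exists>\<phi> \<psi> \<Phi>' \<Psi>'.
     homeomorphism_germ (level_map \<phi>) \<Phi>' \<and>
     (\<forall>\<^sub>F z in nhds 0. \<phi> 0 z = z) \<and> (\<forall>\<^sub>F t in nhds 0. \<phi> t 0 = 0) \<and>
     homeomorphism_germ (level_map \<psi>) \<Psi>' \<and>
     (\<forall>\<^sub>F z in nhds 0. \<psi> 0 z = z) \<and> (\<forall>\<^sub>F t in nhds 0. \<psi> t 0 = 0) \<and>
     (\<forall>\<^sub>F p in nhds 0. \<Psi>' (level_map ft (level_map \<phi> p)) = level_map (\<lambda>t. f) p))"

definition cline :: "complex^3 \<Rightarrow> complex^3 \<Rightarrow> (complex^3) set" where
  "cline p v = range (\<lambda>s. p + s *s v)"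

text \<open>
  Multiplicity at 0 of the germ of a set \<open>X\<close>: the number of points of \<open>X\<close> near 0 (in \<open>ball 0 \<epsilon>\<close>)
  on a generic line near 0 (through a point of \<open>ball 0 \<delta>\<close>, with \<open>\<delta>\<close> depending on \<open>\<epsilon>\<close>) that
  misses 0. Generic means that the direction \<open>v\<close> lies in a dense open set and, given \<open>v\<close>,
  so does the base point \<open>p\<close>. As two dense open sets meet, at most one \<open>m\<close> qualifies. Counting
  points of the set \<open>X\<close> amounts to the reduced structure.
\<close>

definition has_multiplicity :: "(complex^3) set \<Rightarrow> nat \<Rightarrow> bool" where
  "has_multiplicity X m \<longleftrightarrow>
     (\<exists>V. open V \<and> closure V = UNIV \<and> 0 \<notin> V \<and>
       (\<forall>v\<in>V. \<forall>\<^sub>F \<epsilon> in at_right 0. \<exists>\<delta>>0. \<exists>W. open W \<and> ball 0 \<delta> \<subseteq> closure W \<and>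
         (\<forall>p \<in> W \<inter> ball 0 \<delta>. 0 \<notin> cline p v \<longrightarrow>
            finite (X \<inter> cline p v \<inter> ball 0 \<epsilon>) \<and> card (X \<inter> cline p v \<inter> ball 0 \<epsilon>) = m)))"

text \<open>The image of the germ \<open>f\<close> is the germ at 0 of \<open>f ` ball 0 r\<close> for small \<open>r\<close>.\<close>

definition image_has_multiplicity :: "(complex^2 \<Rightarrow> complex^3) \<Rightarrow> nat \<Rightarrow> bool" where
  "image_has_multiplicity f m \<longleftrightarrow> (\<forall>\<^sub>F r in at_right 0. has_multiplicity (f ` ball 0 r) m)"

definition equimultiple ::
    "(complex^2 \<Rightarrow> complex^3) \<Rightarrow> (complex \<Rightarrow> complex^2 \<Rightarrow> complex^3) \<Rightarrow> bool" where
  "equimultiple f ft \<longleftrightarrow> (\<exists>m. image_has_multiplicity f m \<and>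
     (\<forall>\<^sub>F t in nhds 0. image_has_multiplicity (ft t) m))"

end

theory Submission
  imports Defs "HOL-Complex_Analysis.Complex_Analysis"
begin

text \<open>
  Let \<open>u\<close> be a component of \<open>f\<close> with nonzero linear part; corank one provides it, and after a choice
  of source coordinates \<open>(u, y)\<close> is a coordinate system. Counting the points of the image on a generic
  line near 0 means solving two equations in \<open>(u, y)\<close>, and for a generically injective germ distinct
  solutions give distinct points of the image. The first equation is solved for \<open>u\<close>, so the
  multiplicity is the least order \<open>n\<close> in \<open>y\<close> of the other two components on the curve \<open>u = 0\<close>
  (\<open>holo2_image_multiplicity\<close>). This number has to be the same for \<open>f\<close> and for the members \<open>f\<^sub>t\<close>.

  By quasihomogeneity the component \<open>i\<close> of \<open>f\<close> restricted to \<open>u = 0\<close> is a constant times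
  \<open>y ^ (d i / w2)\<close> (\<open>axis_power\<close>), and finite determinacy excludes that both constants vanish
  (\<open>axis_nonzero\<close>). Choose \<open>i2\<close> with nonzero constant and least degree, so that \<open>d i2 = n * w2\<close>. Since
  the weights do not decrease, \<open>f\<^sub>t - f\<close> is bounded by a small multiple of the monomials of weight at
  least \<open>d i\<close> (\<open>non_decreasing_weights_estimate\<close>). Such a perturbation preserves the order \<open>n\<close> of the
  component \<open>i2\<close>, and it keeps the order of the component \<open>i3\<close> at least \<open>n\<close> provided that
  \<open>d i2 \<le> d i3\<close> (\<open>perturbation_estimates\<close>).

  In the remaining case the component \<open>i3\<close> of \<open>f\<close> vanishes on \<open>u = 0\<close>, and its degree \<open>d i3\<close> is too
  small to control \<open>f\<^sub>t\<close>. Then \<open>f\<close> is \<open>n\<close> to one on the curve \<open>u = 0\<close>, which finite determinacy permits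
  only for \<open>n < 3\<close> (\<open>no_multiple_axis\<close>). For \<open>n = 1\<close> nothing has to be controlled. For \<open>n = 2\<close> the germ
  \<open>f\<close> is not injective near 0; by topological triviality neither is \<open>f\<^sub>t\<close>, so \<open>f\<^sub>t\<close> is not an immersion,
  and its component \<open>i3\<close> has order at least 2 on the smooth curve where its first component vanishes
  (\<open>second_order_bound\<close>).

  Finite determinacy enters through explicit perturbations of high order: they are equivalent to \<open>f\<close>,
  hence have fibres of the same kind as \<open>f\<close>, and comparing a family of them rules out bad fibres. This
  also shows that \<open>f\<close> is generically injective (\<open>generically_injective\<close>), a property that topological
  triviality passes on to \<open>f\<^sub>t\<close>.
\<close>

section \<open>Weighted Taylor estimates in two variables\<close>

definition power_coeff :: "(complex \<Rightarrow> complex) \<Rightarrow> nat \<Rightarrow> complex" where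
  "power_coeff \<phi> b = (deriv ^^ b) \<phi> 0 / fact b"

lemma power_coeff_bound:
  assumes hol: "\<phi> holomorphic_on ball 0 R" and M: "\<And>y. norm y < R \<Longrightarrow> norm (\<phi> y) \<le> M" and R: "R > 0"
  shows "norm (power_coeff \<phi> b) \<le> M * (2/R)^b"
proof -
  have "norm ((deriv ^^ b) \<phi> 0) \<le> fact b * M / (R/2)^b"
  proof (rule Cauchy_inequality)
    show "\<phi> holomorphic_on ball 0 (R/2)"
      by (rule holomorphic_on_subset[OF hol]) (use R in auto)
    show "continuous_on (cball 0 (R/2)) \<phi>"
      by (rule continuous_on_subset[OF holomorphic_on_imp_continuous_on[OF hol]]) (use R in auto)
    show "norm (\<phi> x) \<le> M" if "norm (0 - x) = R/2" for x
      using M[of x] that R by auto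
  qed (use R in auto)
  then have "norm ((deriv ^^ b) \<phi> 0) / fact b \<le> (fact b * M / (R/2)^b) / fact b"
    by (rule divide_right_mono) simp
  also have "\<dots> = M * (2/R)^b"
    by (simp add: power_divide)
  finally show ?thesis by (simp add: power_coeff_def norm_divide)
qed

text \<open>
  By Cauchy's estimate the tail of the power series is dominated by a geometric series, of ratio at
  most 1/2 in a quarter of the disc. The constant depends on \<open>\<phi>\<close> only through the bound \<open>M\<close>, which makes
  the estimate uniform in families.
\<close>

lemma taylor_remainder:
  assumes hol: "\<phi> holomorphic_on ball 0 R" and M: "\<And>y. norm y < R \<Longrightarrow> norm (\<phi> y) \<le> M" and R: "R > 0"
    and y: "norm y \<le> R/4"
  shows "norm (\<phi> y - (\<Sum>b<K. power_coeff \<phi> b * y^b)) \<le> 2 * M * (2/R)^K * norm y^K"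
proof -
  have M0: "0 \<le> M" using M[of 0] R norm_ge_zero[of "\<phi> 0"] by (metis norm_zero order_trans)
  have "(\<lambda>n. (deriv ^^ n) \<phi> 0 / (fact n) * (y-0)^n) sums \<phi> y"
    by (rule holomorphic_power_series[OF hol]) (use y R in auto)
  then have "(\<lambda>n. power_coeff \<phi> n * y^n) sums \<phi> y" by (simp add: power_coeff_def)
  then have s: "(\<lambda>n. power_coeff \<phi> (n+K) * y^(n+K)) sums (\<phi> y - (\<Sum>b<K. power_coeff \<phi> b * y^b))"
    by (rule sums_split_initial_segment)
  have b: "norm (power_coeff \<phi> (n+K) * y^(n+K)) \<le> (M * (2/R)^K * norm y^K) * (1/2)^n" for n
  proof -
    have "norm (power_coeff \<phi> (n+K) * y^(n+K)) \<le> (M * (2/R)^(n+K)) * norm y^(n+K)"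
      unfolding norm_mult norm_power
      by (rule mult_right_mono[OF power_coeff_bound[OF hol M R]]) auto
    also have "\<dots> = (M * (2/R)^K * norm y^K) * (2 * norm y/R)^n"
      by (simp add: power_add power_mult_distrib power_divide field_simps)
    also have "\<dots> \<le> (M * (2/R)^K * norm y^K) * (1/2)^n"
      by (intro mult_left_mono power_mono) (use y R M0 in \<open>auto simp: field_simps\<close>)
    finally show ?thesis .
  qed
  have g: "(\<lambda>n. (M * (2/R)^K * norm y^K) * (1/2)^n) sums ((M * (2/R)^K * norm y^K) * (1/(1-1/2)))"
    by (intro sums_mult geometric_sums) auto
  have "norm (\<Sum>n. power_coeff \<phi> (n+K) * y^(n+K)) \<le> (\<Sum>n. (M * (2/R)^K * norm y^K) * (1/2)^n)"
    by (rule norm_suminf_le[OF b]) (use g sums_summable in blast)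
  then show ?thesis using sums_unique[OF s] sums_unique[OF g] by (simp add: algebra_simps)
qed

text \<open>
  What is needed to expand in one variable with constants that are uniform in the other.
\<close>

definition sep_holo :: "(complex \<times> complex \<Rightarrow> complex) \<Rightarrow> real \<Rightarrow> real \<Rightarrow> bool" where
  "sep_holo h R M \<longleftrightarrow>
     (\<forall>y. norm y < R \<longrightarrow> (\<lambda>x. h (x, y)) holomorphic_on ball 0 R) \<and>
     (\<forall>x. norm x < R \<longrightarrow> (\<lambda>y. h (x, y)) holomorphic_on ball 0 R) \<and>
     (\<forall>x y. norm x < R \<longrightarrow> norm y < R \<longrightarrow> norm (h (x, y)) \<le> M)"

text \<open>
  The coefficient is the uniform limit, for \<open>s\<close> tending to 0, of \<open>h (x, s)\<close> minus its expansion of order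
  less than \<open>b\<close>, divided by \<open>s ^ b\<close>; these quotients are holomorphic in \<open>x\<close> by induction.
\<close>

lemma power_coeff_snd_holomorphic:
  assumes h: "sep_holo h R M" and R: "R > 0"
  shows "(\<lambda>x. power_coeff (\<lambda>y. h (x, y)) b) holomorphic_on ball 0 R"
proof (induction b rule: less_induct)
  case (less b)
  define s where "s = (\<lambda>j::nat. complex_of_real (R/(4*(real j+1))))"
  have sn: "norm (s j) = R/(4*(real j+1))" for j
    unfolding s_def norm_of_real using R by (intro abs_of_nonneg) simp
  have s0: "s j \<noteq> 0" for j
  proof -
    have "norm (s j) > 0" unfolding sn using R by (intro divide_pos_pos) auto
    then show ?thesis by auto
  qed
  have s4: "norm (s j) \<le> R/4" for j unfolding sn using R by (auto simp: field_simps)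
  have sR: "norm (s j) < R" for j using s4[of j] R by linarith
  define f where "f = (\<lambda>j x. (h (x, s j) - (\<Sum>k<b. power_coeff (\<lambda>y. h (x, y)) k * s j^k)) / s j^b)"
  have est: "norm (f j x - power_coeff (\<lambda>y. h (x, y)) b) \<le> 2*M*(2/R)^(Suc b) * norm (s j)" if x: "norm x < R" for j x
  proof -
    have *: "norm (h (x, s j) - (\<Sum>k<Suc b. power_coeff (\<lambda>y. h (x, y)) k * s j^k)) \<le> 2*M*(2/R)^(Suc b) * norm (s j)^(Suc b)"
      by (rule taylor_remainder[where \<phi>="\<lambda>y. h (x, y)"]) (use h R x s4 in \<open>auto simp: sep_holo_def\<close>)
    have "f j x - power_coeff (\<lambda>y. h (x, y)) b = (h (x, s j) - (\<Sum>k<Suc b. power_coeff (\<lambda>y. h (x, y)) k * s j^k)) / s j^b"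
      using s0[of j] by (simp add: f_def field_simps)
    then have "norm (f j x - power_coeff (\<lambda>y. h (x, y)) b) \<le> (2*M*(2/R)^(Suc b) * norm (s j)^(Suc b)) / norm (s j)^b"
      by (simp only: norm_divide norm_power) (rule divide_right_mono[OF *], simp)
    also have "\<dots> = 2*M*(2/R)^(Suc b) * norm (s j)"
      using s0[of j] by simp
    finally show ?thesis .
  qed
  have lim0: "(\<lambda>j. 2*M*(2/R)^(Suc b) * norm (s j)) \<longlonglongrightarrow> 0"
  proof -
    have "(\<lambda>j. R/(4*(real j+1))) \<longlonglongrightarrow> 0" by real_asymp
    then show ?thesis unfolding sn by (rule tendsto_mult_right_zero)
  qed
  show ?case
  proof (rule holomorphic_uniform_sequence[where f=f])
    show "f n holomorphic_on ball 0 R" for n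
      unfolding f_def using h sR s0 less
      by (intro holomorphic_intros) (auto simp: sep_holo_def)
    fix x :: complex assume x: "x \<in> ball 0 R"
    then obtain d where d: "d > 0" "cball x d \<subseteq> ball 0 R"
      using open_contains_cball[of "ball (0::complex) R"] open_ball by meson
    have "uniform_limit (cball x d) f (\<lambda>x. power_coeff (\<lambda>y. h (x, y)) b) sequentially"
      unfolding uniform_limit_iff
    proof (intro allI impI)
      fix e :: real assume e: "e > 0"
      have "\<forall>\<^sub>F j in sequentially. 2*M*(2/R)^(Suc b) * norm (s j) < e"
        using order_tendstoD(2)[OF lim0 e] .
      then show "\<forall>\<^sub>F n in sequentially. \<forall>x\<in>cball x d. dist (f n x) (power_coeff (\<lambda>y. h (x, y)) b) < e"
      proof (eventually_elim, intro ballI)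
        fix n z assume "2*M*(2/R)^(Suc b) * norm (s n) < e" "z \<in> cball x d"
        then show "dist (f n z) (power_coeff (\<lambda>y. h (z, y)) b) < e"
          using est[of z n] d(2) by (force simp: dist_norm)
      qed
    qed
    then show "\<exists>d>0. cball x d \<subseteq> ball 0 R \<and> uniform_limit (cball x d) f (\<lambda>x. power_coeff (\<lambda>y. h (x, y)) b) sequentially"
      using d by blast
  qed simp
qed

text \<open>
  The monomials of weight at least \<open>d\<close> measure the size of a power series without terms of lower weight.
  For \<open>d \<le> K\<close> the finitely many exponents up to \<open>K\<close> suffice: near 0 every other monomial is dominated by
  \<open>x ^ K\<close> or \<open>y ^ K\<close>, and both have weight at least \<open>d\<close>.
\<close>

definition weighted_sum :: "nat \<Rightarrow> nat \<Rightarrow> nat \<Rightarrow> nat \<Rightarrow> complex \<Rightarrow> complex \<Rightarrow> real" where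
  "weighted_sum w1 w2 d K x y =
     (\<Sum>b\<le>K. \<Sum>a\<le>K. if d \<le> w1 * a + w2 * b then norm x ^ a * norm y ^ b else 0)"

text \<open>
  Expand in \<open>y\<close> and then each coefficient in \<open>x\<close>, both up to order \<open>K\<close>. The remainders are of the size of
  \<open>x ^ K * y ^ b\<close> and \<open>y ^ K\<close>, whose weight is large enough because \<open>d \<le> K\<close>. The bound is linear in \<open>M\<close>.
\<close>

lemma weighted_bound:
  assumes h: "sep_holo h R M" and R: "R > 0"
    and c: "\<And>a b. power_coeff (\<lambda>x. power_coeff (\<lambda>y. h (x, y)) b) a \<noteq> 0 \<Longrightarrow> d \<le> w1 * a + w2 * b"
    and w: "w1 > 0" "w2 > 0" and K: "d \<le> K" and x: "norm x \<le> R/4" and y: "norm y \<le> R/4"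
  shows "norm (h (x, y)) \<le> 2 * (1 + 2/R)^(2*K) * M * weighted_sum w1 w2 d K x y"
proof -
  define c where "c = (\<lambda>a b. power_coeff (\<lambda>x. power_coeff (\<lambda>y. h (x, y)) b) a)"
  define hb where "hb = (\<lambda>b x. power_coeff (\<lambda>y. h (x, y)) b)"
  define q where "q = 2/R"
  define D where "D = 2 * (1 + q)^(2*K) * M"
  define g where "g = (\<lambda>a b. if d \<le> w1 * a + w2 * b then norm x ^ a * norm y ^ b else 0)"
  have q: "q > 0" using R by (simp add: q_def)
  have M0: "0 \<le> M" using h R norm_ge_zero[of "h (0,0)"] unfolding sep_holo_def
    by (metis norm_zero order_trans)
  have qq: "2 * M * q^i * q^j \<le> D" if "i \<le> K" "j \<le> K" for i j
  proof -
    have "q^i * q^j = q^(i+j)" by (simp add: power_add)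
    also have "\<dots> \<le> (1+q)^(i+j)" using q by (intro power_mono) auto
    also have "\<dots> \<le> (1+q)^(2*K)" using q that by (intro power_increasing) auto
    finally have "(2*M) * (q^i * q^j) \<le> (2*M) * (1+q)^(2*K)" using M0 by (intro mult_left_mono) auto
    then show ?thesis by (simp add: D_def mult_ac)
  qed
  have D0: "D \<ge> 0" using q M0 by (simp add: D_def)
  have g0: "g a b \<ge> 0" for a b by (simp add: g_def)
  have hbb: "norm (hb b z) \<le> M * q^b" if "norm z < R" for b z
    unfolding hb_def q_def using power_coeff_bound[of "\<lambda>y. h (z, y)" R M b] h R that by (simp add: sep_holo_def)
  have hbh: "hb b holomorphic_on ball 0 R" for b
    unfolding hb_def by (rule power_coeff_snd_holomorphic[OF h R])
  have cb: "norm (c a b) \<le> M * q^b * q^a" for a b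
    using power_coeff_bound[OF hbh hbb R, of b a] by (simp add: c_def hb_def q_def)
  have cg: "norm (c a b) * norm x ^ a * norm y ^ b \<le> D * g a b" if "a \<le> K" "b \<le> K" for a b
  proof (cases "c a b = 0")
    case True then show ?thesis using D0 g0 by simp
  next
    case False
    then have "g a b = norm x ^ a * norm y ^ b" using assms(3) by (simp add: g_def c_def)
    moreover have "norm (c a b) \<le> D"
      using cb[of a b] qq[OF that(2,1)] M0 norm_ge_zero[of "c a b"] by linarith
    ultimately show ?thesis by (simp add: mult.assoc mult_right_mono)
  qed
  have r: "norm (h (x, y) - (\<Sum>b<K. hb b x * y^b)) \<le> D * g 0 K"
  proof -
    have "norm (h (x, y) - (\<Sum>b<K. hb b x * y^b)) \<le> 2 * M * q^K * norm y^K"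
      unfolding hb_def q_def
      by (rule taylor_remainder[where \<phi>="\<lambda>y. h (x, y)"]) (use h x y R in \<open>auto simp: sep_holo_def\<close>)
    also have "\<dots> \<le> D * norm y^K" using qq[of K 0] by (intro mult_right_mono) auto
    also have "norm y ^ K = g 0 K"
      using K w(2) by (simp add: g_def) (metis le_trans mult_le_mono1 nat_mult_1 Suc_leI One_nat_def)
    finally show ?thesis .
  qed
  have rb: "norm (hb b x - (\<Sum>a<K. c a b * x^a)) * norm y ^ b \<le> D * g K b" if "b < K" for b
  proof -
    have "norm (hb b x - (\<Sum>a<K. c a b * x^a)) \<le> 2 * (M * q^b) * q^K * norm x^K"
      unfolding c_def q_def hb_def[symmetric]
      using taylor_remainder[OF hbh hbb R x, of b K] by (simp add: q_def hb_def)
    also have "\<dots> \<le> D * norm x^K" using qq[of b K] that by (intro mult_right_mono) (auto simp: mult.assoc)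
    finally have "norm (hb b x - (\<Sum>a<K. c a b * x^a)) * norm y ^ b \<le> D * norm x^K * norm y ^ b"
      by (rule mult_right_mono) simp
    moreover have "d \<le> w1 * K + w2 * b"
      using K w(1) by (metis le_trans mult_le_mono1 nat_mult_1 Suc_leI One_nat_def le_add1)
    ultimately show ?thesis by (simp add: g_def)
  qed
  have "h (x, y) = (h (x, y) - (\<Sum>b<K. hb b x * y^b)) + (\<Sum>b<K. hb b x * y^b)" by simp
  then have "norm (h (x, y)) \<le> D * g 0 K + norm (\<Sum>b<K. hb b x * y^b)"
    using r norm_triangle_ineq by (smt (verit))
  also have "norm (\<Sum>b<K. hb b x * y^b) \<le> (\<Sum>b<K. D * g K b + (\<Sum>a<K. D * g a b))"
  proof (rule sum_norm_le)
    fix b assume "b \<in> {..<K}" then have b: "b < K" by simp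
    have "norm (hb b x * y^b) = norm (hb b x) * norm y ^ b" by (simp add: norm_mult norm_power)
    also have "hb b x = (hb b x - (\<Sum>a<K. c a b * x^a)) + (\<Sum>a<K. c a b * x^a)" by simp
    also have "norm \<dots> \<le> norm (hb b x - (\<Sum>a<K. c a b * x^a)) + (\<Sum>a<K. norm (c a b) * norm x ^ a)"
      by (rule norm_triangle_le, rule add_left_mono)
         (rule sum_norm_le, simp add: norm_mult norm_power)
    finally have "norm (hb b x * y^b) \<le> norm (hb b x - (\<Sum>a<K. c a b * x^a)) * norm y ^ b
        + (\<Sum>a<K. norm (c a b) * norm x ^ a * norm y ^ b)"
      by (simp add: mult_right_mono distrib_right sum_distrib_right)
    also have "\<dots> \<le> D * g K b + (\<Sum>a<K. D * g a b)"
      by (intro add_mono rb b sum_mono cg) (use b in auto)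
    finally show "norm (hb b x * y^b) \<le> D * g K b + (\<Sum>a<K. D * g a b)" .
  qed
  also have "D * g 0 K + \<dots> = D * (g 0 K + (\<Sum>b<K. g K b + (\<Sum>a<K. g a b)))"
    by (simp add: distrib_left sum_distrib_left)
  also have "\<dots> \<le> D * (\<Sum>b\<le>K. \<Sum>a\<le>K. g a b)"
  proof (rule mult_left_mono[OF _ D0])
    have "(\<Sum>a\<le>K. g a b) = g K b + (\<Sum>a<K. g a b)" for b
      by (simp add: lessThan_Suc_atMost[symmetric])
    moreover have "g 0 K \<le> (\<Sum>a\<le>K. g a K)" using g0 by (intro member_le_sum) auto
    moreover have "(\<Sum>b\<le>K. \<Sum>a\<le>K. g a b) = (\<Sum>a\<le>K. g a K) + (\<Sum>b<K. \<Sum>a\<le>K. g a b)"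
      by (simp add: lessThan_Suc_atMost[symmetric])
    ultimately show "g 0 K + (\<Sum>b<K. g K b + (\<Sum>a<K. g a b)) \<le> (\<Sum>b\<le>K. \<Sum>a\<le>K. g a b)"
      by simp
  qed
  finally show ?thesis by (simp add: D_def q_def g_def weighted_sum_def)
qed

section \<open>Strict differentiability and implicit functions\<close>

text \<open>
  Pairs replace \<open>complex^2\<close> because the two coordinates play different roles throughout: the first one is
  eliminated, the second one is the parameter on the remaining curves.
\<close>

definition holo2_at :: "(complex \<times> complex \<Rightarrow> complex) \<Rightarrow> complex \<times> complex \<Rightarrow> bool" where
  "holo2_at h z \<longleftrightarrow> (\<exists>a b. (h has_derivative (\<lambda>v. a * fst v + b * snd v)) (at z))"

lemma holo2_at_fst: "holo2_at fst z"
  unfolding holo2_at_def by (rule exI[of _ 1], rule exI[of _ 0]) (auto intro!: derivative_eq_intros)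

lemma holo2_at_snd: "holo2_at snd z"
  unfolding holo2_at_def by (rule exI[of _ 0], rule exI[of _ 1]) (auto intro!: derivative_eq_intros)

lemma holo2_at_const: "holo2_at (\<lambda>_. c) z"
  unfolding holo2_at_def by (rule exI[of _ 0], rule exI[of _ 0]) (auto intro!: derivative_eq_intros)

lemma holo2_at_add:
  assumes "holo2_at f z" "holo2_at g z" shows "holo2_at (\<lambda>z. f z + g z) z"
proof -
  obtain a b a' b' where "(f has_derivative (\<lambda>v. a * fst v + b * snd v)) (at z)"
    "(g has_derivative (\<lambda>v. a' * fst v + b' * snd v)) (at z)" using assms unfolding holo2_at_def by blast
  from has_derivative_add[OF this] show ?thesis unfolding holo2_at_def
    by (intro exI[of _ "a+a'"] exI[of _ "b+b'"]) (simp add: algebra_simps)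
qed

lemma holo2_at_mult:
  assumes "holo2_at f z" "holo2_at g z" shows "holo2_at (\<lambda>z. f z * g z) z"
proof -
  obtain a b a' b' where "(f has_derivative (\<lambda>v. a * fst v + b * snd v)) (at z)"
    "(g has_derivative (\<lambda>v. a' * fst v + b' * snd v)) (at z)" using assms unfolding holo2_at_def by blast
  from has_derivative_mult[OF this] show ?thesis unfolding holo2_at_def
    by (intro exI[of _ "f z * a'+a * g z"] exI[of _ "f z * b'+b * g z"]) (simp add: algebra_simps)
qed

lemma holo2_at_diff:
  assumes "holo2_at f z" "holo2_at g z" shows "holo2_at (\<lambda>z. f z - g z) z"
  using holo2_at_add[OF assms(1) holo2_at_mult[OF holo2_at_const[of "-1"] assms(2)]] by simp

lemma holo2_at_power: "holo2_at f z \<Longrightarrow> holo2_at (\<lambda>z. f z ^ n) z"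
  by (induction n) (auto intro: holo2_at_const holo2_at_mult)

lemma holo2_at_sum: "(\<And>i. i \<in> I \<Longrightarrow> holo2_at (f i) z) \<Longrightarrow> holo2_at (\<lambda>z. \<Sum>i\<in>I. f i z) z"
  by (induction I rule: infinite_finite_induct) (auto intro: holo2_at_const holo2_at_add)

lemmas holo2_at_intros = holo2_at_fst holo2_at_snd holo2_at_const holo2_at_add holo2_at_mult
  holo2_at_diff holo2_at_power holo2_at_sum

lemma holo2_at_cong:
  assumes "holo2_at f z" "\<forall>\<^sub>F w in nhds z. f w = g w" shows "holo2_at g z"
proof -
  have e: "f z = g z" using assms(2) by (rule eventually_nhds_x_imp_x)
  have "\<forall>\<^sub>F w in at z. f w = g w" using assms(2) by (simp add: eventually_at_filter eventually_mono)
  from has_derivative_transform_eventually[OF _ this e] show ?thesis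
    using assms(1) unfolding holo2_at_def by blast
qed

lemma holo2_at_isCont: "holo2_at h z \<Longrightarrow> isCont h z"
  unfolding holo2_at_def using has_derivative_continuous by blast

lemma slice_fst:
  assumes "(h has_derivative (\<lambda>v. a * fst v + b * snd v)) (at (x, y))"
  shows "((\<lambda>x. h (x, y)) has_field_derivative a) (at x)"
proof -
  have "((\<lambda>x. (x, y)) has_derivative (\<lambda>v. (v, 0))) (at x)"
    by (auto intro!: derivative_eq_intros)
  from has_derivative_compose[OF this assms] show ?thesis
    by (simp add: has_field_derivative_def)
qed

lemma slice_snd:
  assumes "(h has_derivative (\<lambda>v. a * fst v + b * snd v)) (at (x, y))"
  shows "((\<lambda>y. h (x, y)) has_field_derivative b) (at y)"
proof -
  have "((\<lambda>y. (x, y)) has_derivative (\<lambda>v. (0, v))) (at y)"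
    by (auto intro!: derivative_eq_intros)
  from has_derivative_compose[OF this assms] show ?thesis
    by (simp add: has_field_derivative_def)
qed

lemma holo2_along_graph:
  assumes "\<xi> holomorphic_on ball 0 R" and "\<And>y. norm y < R \<Longrightarrow> holo2_at g (\<xi> y, y)"
  shows "(\<lambda>y. g (\<xi> y, y)) holomorphic_on ball 0 R"
  unfolding holomorphic_on_open[OF open_ball]
proof
  fix y :: complex assume "y \<in> ball 0 R"
  then have y: "norm y < R" by simp
  obtain l where "(\<xi> has_field_derivative l) (at y)"
    using assms(1) y unfolding holomorphic_on_open[OF open_ball] by (metis mem_ball_0)
  then have 1: "((\<lambda>y. (\<xi> y, y)) has_derivative (\<lambda>v. (l * v, v))) (at y)"
    unfolding has_field_derivative_def by (intro has_derivative_Pair) auto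
  obtain a b where 2: "(g has_derivative (\<lambda>v. a * fst v + b * snd v)) (at (\<xi> y, y))"
    using assms(2)[OF y] unfolding holo2_at_def by blast
  from has_derivative_compose[OF 1 2]
  have "((\<lambda>y. g (\<xi> y, y)) has_derivative (\<lambda>v. (a * l + b) * v)) (at y)" by (simp add: algebra_simps)
  then show "\<exists>f'. ((\<lambda>y. g (\<xi> y, y)) has_field_derivative f') (at y)"
    unfolding has_field_derivative_def by blast
qed

lemma holo2_slice:
  assumes "\<And>x y. norm x < R \<Longrightarrow> norm y < S \<Longrightarrow> holo2_at h (x, y)"
  shows "norm y < S \<Longrightarrow> (\<lambda>x. h (x, y)) holomorphic_on ball 0 R"
    and "norm x < R \<Longrightarrow> (\<lambda>y. h (x, y)) holomorphic_on ball 0 S"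
proof -
  assume y: "norm y < S"
  have "\<exists>f'. ((\<lambda>x. h (x, y)) has_field_derivative f') (at x)" if "x \<in> ball 0 R" for x
    using assms[of x y] that y unfolding holo2_at_def by (auto dest: slice_fst)
  then show "(\<lambda>x. h (x, y)) holomorphic_on ball 0 R" by (simp add: holomorphic_on_open)
next
  assume x: "norm x < R"
  have "\<exists>f'. ((\<lambda>y. h (x, y)) has_field_derivative f') (at y)" if "y \<in> ball 0 S" for y
    using assms[of x y] that x unfolding holo2_at_def by (auto dest: slice_snd)
  then show "(\<lambda>y. h (x, y)) holomorphic_on ball 0 S" by (simp add: holomorphic_on_open)
qed

lemma nhds0_box:
  fixes P :: "complex \<times> complex \<Rightarrow> bool"
  shows "(\<forall>\<^sub>F z in nhds 0. P z) \<longleftrightarrow> (\<exists>\<tau>>0. \<forall>x y. norm x < \<tau> \<longrightarrow> norm y < \<tau> \<longrightarrow> P (x, y))"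
proof
  assume "\<forall>\<^sub>F z in nhds 0. P z"
  then obtain d where d: "d > 0" "\<And>z. dist z 0 < d \<Longrightarrow> P z" unfolding eventually_nhds_metric by blast
  have "P (x, y)" if "norm x < d/2" "norm y < d/2" for x y
    using d(2)[of "(x, y)"] norm_Pair_le[of x y] that by (simp add: dist_norm)
  then show "\<exists>\<tau>>0. \<forall>x y. norm x < \<tau> \<longrightarrow> norm y < \<tau> \<longrightarrow> P (x, y)"
    using d(1) by (intro exI[of _ "d/2"]) auto
next
  assume "\<exists>\<tau>>0. \<forall>x y. norm x < \<tau> \<longrightarrow> norm y < \<tau> \<longrightarrow> P (x, y)"
  then obtain \<tau> where t: "\<tau> > 0" "\<And>x y. norm x < \<tau> \<Longrightarrow> norm y < \<tau> \<Longrightarrow> P (x, y)" by blast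
  show "\<forall>\<^sub>F z in nhds 0. P z" unfolding eventually_nhds_metric
  proof (intro exI[of _ \<tau>] conjI allI impI)
    fix z :: "complex \<times> complex" assume "dist z 0 < \<tau>"
    then have "norm (fst z) < \<tau>" "norm (snd z) < \<tau>"
      using norm_fst_le[of "fst z" "snd z"] norm_snd_le[of "snd z" "fst z"] by (simp_all add: dist_norm)
    then show "P z" using t(2)[of "fst z" "snd z"] by simp
  qed (rule t)
qed

lemma sep_holo_ev:
  assumes "\<forall>\<^sub>F z in nhds 0. holo2_at h z"
  shows "\<exists>R>0. \<exists>M. sep_holo h R M"
proof -
  have c: "isCont h 0" using assms holo2_at_isCont eventually_nhds_x_imp_x by blast
  then have "\<forall>\<^sub>F z in nhds 0. dist (h z) (h 0) < 1"
    unfolding isCont_def tendsto_at_iff_tendsto_nhds by (rule tendstoD) simp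
  with assms have "\<forall>\<^sub>F z in nhds 0. holo2_at h z \<and> dist (h z) (h 0) < 1" by (rule eventually_conj)
  then obtain R where R: "R > 0"
    "\<And>x y. norm x < R \<Longrightarrow> norm y < R \<Longrightarrow> holo2_at h (x, y) \<and> dist (h (x, y)) (h 0) < 1"
    unfolding nhds0_box by blast
  have "sep_holo h R (norm (h 0) + 1)"
    unfolding sep_holo_def
  proof (intro conjI allI impI)
    fix x y :: complex assume "norm x < R" "norm y < R"
    then have "dist (h (x, y)) (h 0) < 1" using R(2) by blast
    then show "norm (h (x, y)) \<le> norm (h 0) + 1"
      using norm_triangle_ineq2[of "h (x, y)" "h 0"] by (simp add: dist_norm)
  qed (use R(2) holo2_slice[of R R h] in auto)
  then show ?thesis using R(1) by blast
qed

text \<open>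
  The error of the linear approximation at 0 is \<open>o (norm z)\<close> on a bidisc, so Cauchy's estimate on circles
  of comparable radius makes its derivative in the first variable small.
\<close>

lemma strict_fst:
  assumes ev: "\<forall>\<^sub>F z in nhds 0. holo2_at h z"
    and der: "(h has_derivative (\<lambda>v. a * fst v + b * snd v)) (at 0)" and e: "e > 0"
  shows "\<exists>\<tau>>0. \<forall>x x' y. norm x < \<tau> \<longrightarrow> norm x' < \<tau> \<longrightarrow> norm y < \<tau> \<longrightarrow>
    norm (h (x, y) - h (x', y) - a * (x - x')) \<le> e * norm (x - x')"
proof -
  define k where "k = (\<lambda>z. h z - h 0 - (a * fst z + b * snd z))"
  have "\<forall>\<^sub>F z in nhds 0. norm (k z) \<le> e/4 * norm z"
  proof -
    obtain d where d: "d > 0" "\<And>z. norm (z - 0) < d \<Longrightarrow>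
        norm (h z - h 0 - (a * fst (z - 0) + b * snd (z - 0))) \<le> e/4 * norm (z - 0)"
      using der e unfolding has_derivative_at_alt by (metis divide_pos_pos zero_less_numeral)
    then show ?thesis unfolding eventually_nhds_metric k_def by (intro exI[of _ d]) (auto simp: dist_norm)
  qed
  with ev have "\<forall>\<^sub>F z in nhds 0. holo2_at h z \<and> norm (k z) \<le> e/4 * norm z" by (rule eventually_conj)
  then obtain R where R: "R > 0"
    "\<And>x y. norm x < R \<Longrightarrow> norm y < R \<Longrightarrow> holo2_at h (x, y) \<and> norm (k (x, y)) \<le> e/4 * norm (x, y)"
    unfolding nhds0_box by blast
  define \<tau> where "\<tau> = R/4"
  have t: "\<tau> > 0" using R(1) by (simp add: \<tau>_def)
  have kh: "(\<lambda>x. k (x, y)) holomorphic_on ball 0 R" if "norm y < R" for y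
  proof -
    have "(\<lambda>x. h (x, y)) holomorphic_on ball 0 R" by (rule holo2_slice(1)[of R R]) (use R that in auto)
    then show ?thesis unfolding k_def by (auto intro!: holomorphic_intros)
  qed
  have dk: "norm (deriv (\<lambda>x. k (x, y)) x) \<le> e" if x: "norm x < \<tau>" and y: "norm y < \<tau>" for x y
  proof -
    have sub: "cball x \<tau> \<subseteq> ball 0 R"
    proof
      fix z assume "z \<in> cball x \<tau>"
      then have "norm (x - z) \<le> \<tau>" by (simp add: dist_norm)
      then have "norm z < 2 * \<tau>" using x norm_triangle_ineq4[of x "x - z"] by simp
      then show "z \<in> ball 0 R" using t by (simp add: \<tau>_def)
    qed
    have yR: "norm y < R" using y t by (simp add: \<tau>_def)
    have "norm ((deriv ^^ 1) (\<lambda>x. k (x, y)) x) \<le> fact 1 * (e * \<tau>) / \<tau>^1"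
    proof (rule Cauchy_inequality)
      show "(\<lambda>x. k (x, y)) holomorphic_on ball x \<tau>"
        by (rule holomorphic_on_subset[OF kh[OF yR]]) (use sub ball_subset_cball in blast)
      show "continuous_on (cball x \<tau>) (\<lambda>x. k (x, y))"
        by (rule continuous_on_subset[OF holomorphic_on_imp_continuous_on[OF kh[OF yR]] sub])
      fix z assume z: "norm (x - z) = \<tau>"
      then have zR: "norm z < 2*\<tau>" using x norm_triangle_ineq4[of x "x - z"] by simp
      have "norm (k (z, y)) \<le> e/4 * norm (z, y)" using R(2)[of z y] zR yR t by (simp add: \<tau>_def)
      also have "\<dots> \<le> e/4 * (norm z + norm y)" using e by (intro mult_left_mono norm_Pair_le) auto
      also have "\<dots> \<le> e/4 * (4 * \<tau>)" using zR y e t by (intro mult_left_mono) auto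
      finally show "norm (k (z, y)) \<le> e * \<tau>" by simp
    qed (use t in auto)
    then show ?thesis using t by simp
  qed
  have "norm (h (x, y) - h (x', y) - a * (x - x')) \<le> e * norm (x - x')"
    if x: "norm x < \<tau>" "norm x' < \<tau>" and y: "norm y < \<tau>" for x x' y
  proof -
    have yR: "norm y < R" using y t by (simp add: \<tau>_def)
    have "norm (k (x, y) - k (x', y)) \<le> e * norm (x - x')"
    proof (rule field_differentiable_bound[where S="ball 0 \<tau>" and f'="deriv (\<lambda>x. k (x, y))" and f="\<lambda>x. k (x, y)"])
      show "((\<lambda>x. k (x, y)) has_field_derivative deriv (\<lambda>x. k (x, y)) z) (at z within ball 0 \<tau>)"
        if "z \<in> ball 0 \<tau>" for z
      proof -
        have "z \<in> ball 0 R" using that t by (simp add: \<tau>_def)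
        then show ?thesis using holomorphic_derivI[OF kh[OF yR] open_ball]
          by (meson has_field_derivative_at_within)
      qed
    qed (use dk y x in auto)
    moreover have "k (x, y) - k (x', y) = h (x, y) - h (x', y) - a * (x - x')"
      by (simp add: k_def algebra_simps)
    ultimately show ?thesis by simp
  qed
  then show ?thesis using t by blast
qed

lemma holo2_at_swap:
  assumes "holo2_at h (prod.swap z)" shows "holo2_at (\<lambda>z. h (prod.swap z)) z"
proof -
  obtain a b where "(h has_derivative (\<lambda>v. a * fst v + b * snd v)) (at (prod.swap z))"
    using assms unfolding holo2_at_def by blast
  note h = this
  have "((\<lambda>z::complex\<times>complex. prod.swap z) has_derivative (\<lambda>v. prod.swap v)) (at z)"
    unfolding prod.swap_def by (auto intro!: derivative_eq_intros)
  from has_derivative_compose[OF this h]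
  have "((\<lambda>z. h (prod.swap z)) has_derivative (\<lambda>v. a * snd v + b * fst v)) (at z)" by simp
  then show ?thesis unfolding holo2_at_def
    by (intro exI[of _ b] exI[of _ a]) (simp add: add.commute)
qed

lemma strict_derivative:
  assumes ev: "\<forall>\<^sub>F z in nhds 0. holo2_at h z"
    and der: "(h has_derivative (\<lambda>v. a * fst v + b * snd v)) (at 0)" and e: "e > 0"
  shows "\<exists>\<tau>>0. \<forall>x x' y y'. norm x < \<tau> \<longrightarrow> norm x' < \<tau> \<longrightarrow> norm y < \<tau> \<longrightarrow> norm y' < \<tau> \<longrightarrow>
    norm (h (x, y) - h (x', y') - a * (x - x') - b * (y - y')) \<le> e * (norm (x - x') + norm (y - y'))"
proof -
  obtain t1 where t1: "t1 > 0" "\<And>x x' y. norm x < t1 \<Longrightarrow> norm x' < t1 \<Longrightarrow> norm y < t1 \<Longrightarrow>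
      norm (h (x, y) - h (x', y) - a * (x - x')) \<le> e * norm (x - x')"
    using strict_fst[OF ev der e] by blast
  have ev': "\<forall>\<^sub>F z in nhds 0. holo2_at (\<lambda>z. h (prod.swap z)) z"
    using ev unfolding nhds0_box by (metis holo2_at_swap swap_simp)
  have "((\<lambda>z::complex\<times>complex. prod.swap z) has_derivative (\<lambda>v. prod.swap v)) (at 0)"
    unfolding prod.swap_def by (auto intro!: derivative_eq_intros)
  moreover have "(h has_derivative (\<lambda>v. a * fst v + b * snd v)) (at (prod.swap 0))"
    using der by (simp add: zero_prod_def)
  ultimately have "((\<lambda>z. h (prod.swap z)) has_derivative (\<lambda>v. a * fst (prod.swap v) + b * snd (prod.swap v))) (at 0)"
    by (rule has_derivative_compose)
  then have der': "((\<lambda>z. h (prod.swap z)) has_derivative (\<lambda>v. b * fst v + a * snd v)) (at 0)"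
    by (simp add: add.commute)
  obtain t2 where t2: "t2 > 0" "\<And>x x' y. norm x < t2 \<Longrightarrow> norm x' < t2 \<Longrightarrow> norm y < t2 \<Longrightarrow>
      norm (h (y, x) - h (y, x') - b * (x - x')) \<le> e * norm (x - x')"
    using strict_fst[OF ev' der' e] by auto
  have "norm (h (x, y) - h (x', y') - a * (x - x') - b * (y - y')) \<le> e * (norm (x - x') + norm (y - y'))"
    if "norm x < min t1 t2" "norm x' < min t1 t2" "norm y < min t1 t2" "norm y' < min t1 t2" for x x' y y'
  proof -
    have "h (x, y) - h (x', y') - a * (x - x') - b * (y - y')
      = (h (x, y) - h (x', y) - a * (x - x')) + (h (x', y) - h (x', y') - b * (y - y'))" by simp
    then show ?thesis using norm_triangle_mono[OF t1(2)[of x x' y] t2(2)[of y y' x']] that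
      unfolding distrib_left by (simp only: min_less_iff_conj)
  qed
  then show ?thesis using t1(1) t2(1) by (intro exI[of _ "min t1 t2"]) auto
qed

lemma fst_derivative_nonzero:
  assumes hu: "\<forall>\<^sub>F z in nhds 0. holo2_at u z" and u0: "u 0 = 0"
    and du: "(u has_derivative (\<lambda>v. a * fst v + b * snd v)) (at 0)"
    and k: "k > 0" and x1: "\<forall>\<^sub>F z in nhds 0. snd z = 0 \<longrightarrow> k * norm (fst z) \<le> norm (u z)"
  shows "a \<noteq> 0"
proof
  assume a: "a = 0"
  obtain t where t: "t > 0" "\<And>x. norm x < t \<Longrightarrow> k * norm x \<le> norm (u (x, 0))"
    using x1 unfolding nhds0_box by (metis fst_conv snd_conv norm_zero)
  obtain t' where t': "t' > 0" "\<And>x x' y. norm x < t' \<Longrightarrow> norm x' < t' \<Longrightarrow> norm y < t' \<Longrightarrow>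
    norm (u (x, y) - u (x', y) - a * (x - x')) \<le> k/2 * norm (x - x')"
    using strict_fst[OF hu du, of "k/2"] k by auto
  define x where "x = complex_of_real (min t t' / 2)"
  have x: "norm x < t" "norm x < t'" "norm x > 0" using t(1) t'(1) by (auto simp: x_def)
  have "k * norm x \<le> norm (u (x, 0))" using t(2) x by blast
  also have "\<dots> \<le> k/2 * norm x" using t'(2)[of x 0 0] x t'(1) u0 a by (simp add: zero_prod_def)
  finally show False using x k by simp
qed

text \<open>
  The map \<open>(c, y) \<mapsto> (X (c, y), y)\<close> inverts \<open>(x, y) \<mapsto> (A (x, y), y)\<close>: on the level curve \<open>A = c\<close> the
  coordinate \<open>y\<close> is a parameter.
\<close>

definition implicit_chart ::
    "(complex \<times> complex \<Rightarrow> complex) \<Rightarrow> (complex \<times> complex \<Rightarrow> complex) \<Rightarrow> real \<Rightarrow> real \<Rightarrow> bool" where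
  "implicit_chart A X \<tau> \<rho> \<longleftrightarrow> \<tau> > 0 \<and> \<rho> > 0 \<and>
     (\<forall>c y. norm c < \<rho> \<longrightarrow> norm y < \<rho> \<longrightarrow>
        norm (X (c, y)) < \<tau> \<and> A (X (c, y), y) = c \<and> holo2_at X (c, y)) \<and>
     (\<forall>x y. norm x < \<tau> \<longrightarrow> norm y < \<rho> \<longrightarrow> norm (A (x, y)) < \<rho> \<longrightarrow> x = X (A (x, y), y))"

text \<open>
  For fixed \<open>y\<close> the equation \<open>A (x, y) = c\<close> is a fixed point problem for \<open>x \<mapsto> x - (A (x, y) - c) / a\<close>, a
  contraction by strict differentiability. The lower Lipschitz bound gives uniqueness and continuity of
  the solution, and a continuous inverse of a differentiable map is differentiable where the derivative
  is invertible. The predicate \<open>P\<close> serves to shrink the chart into any given neighbourhood of 0.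
\<close>

lemma implicit_function:
  fixes A :: "complex \<times> complex \<Rightarrow> complex" and P :: "complex \<times> complex \<Rightarrow> bool"
  assumes ev: "\<forall>\<^sub>F z in nhds 0. holo2_at A z" and A0: "A 0 = 0"
    and der: "(A has_derivative (\<lambda>v. a * fst v + b * snd v)) (at 0)" and a: "a \<noteq> 0"
    and P: "\<forall>\<^sub>F z in nhds 0. P z"
  shows "\<exists>X \<tau> \<rho>. implicit_chart A X \<tau> \<rho> \<and>
     (\<forall>x y. norm x < \<tau> \<longrightarrow> norm y < \<rho> \<longrightarrow> P (x, y)) \<and>
     (\<forall>x x' y. norm x < \<tau> \<longrightarrow> norm x' < \<tau> \<longrightarrow> norm y < \<rho> \<longrightarrow>
        norm a / 2 * norm (x - x') \<le> norm (A (x, y) - A (x', y)))"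
proof -
  have na: "norm a > 0" using a by simp
  obtain t1 where t1: "t1 > 0" "\<And>x x' y. norm x < t1 \<Longrightarrow> norm x' < t1 \<Longrightarrow> norm y < t1 \<Longrightarrow>
      norm (A (x, y) - A (x', y) - a * (x - x')) \<le> norm a/2 * norm (x - x')"
    using strict_fst[OF ev der, of "norm a/2"] na by auto
  obtain t2 where t2: "t2 > 0" "\<And>x y. norm x < t2 \<Longrightarrow> norm y < t2 \<Longrightarrow> holo2_at A (x, y) \<and> P (x, y)"
    using eventually_conj[OF ev P] unfolding nhds0_box by blast
  define \<tau> where "\<tau> = min t1 t2"
  have tp: "\<tau> > 0" using t1 t2 by (simp add: \<tau>_def)
  have lip: "norm (A (x, y) - A (x', y) - a * (x - x')) \<le> norm a/2 * norm (x - x')"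
    if "norm x < \<tau>" "norm x' < \<tau>" "norm y < \<tau>" for x x' y using t1(2) that by (simp add: \<tau>_def)
  have hol: "holo2_at A (x, y)" and PP: "P (x, y)" if "norm x < \<tau>" "norm y < \<tau>" for x y
    using t2(2) that by (simp_all add: \<tau>_def)
  have low: "norm a / 2 * norm (x - x') \<le> norm (A (x, y) - A (x', y))"
    if "norm x < \<tau>" "norm x' < \<tau>" "norm y < \<tau>" for x x' y
  proof -
    have "norm (a * (x - x')) \<le> norm (A (x, y) - A (x', y)) + norm (A (x, y) - A (x', y) - a * (x - x'))"
      using norm_triangle_ineq4[of "A (x, y) - A (x', y)" "A (x, y) - A (x', y) - a * (x - x')"] by simp
    then show ?thesis using lip[OF that] by (simp add: norm_mult)
  qed
  have "\<forall>\<^sub>F z in nhds 0. dist (A z) (A 0) < norm a * \<tau> / 8"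
    using holo2_at_isCont[OF eventually_nhds_x_imp_x[OF ev]] na tp
    unfolding isCont_def tendsto_at_iff_tendsto_nhds by (intro tendstoD) auto
  then obtain t3 where t3: "t3 > 0" "\<And>x y. norm x < t3 \<Longrightarrow> norm y < t3 \<Longrightarrow> norm (A (x, y)) < norm a * \<tau> / 8"
    unfolding nhds0_box by (auto simp: A0)
  \<comment> \<open>the third bound keeps the iteration in the disc of radius \<open>\<tau> / 2\<close> for \<open>norm c < \<rho>\<close>\<close>
  define \<rho> where "\<rho> = min (min \<tau> t3) (norm a * \<tau> / 8)"
  have rp: "\<rho> > 0" "\<rho> \<le> \<tau>" using tp t3 na by (simp_all add: \<rho>_def)
  have "\<exists>x. norm x < \<tau> \<and> A (x, y) = c" if c: "norm c < \<rho>" and y: "norm y < \<rho>" for c y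
  proof -
    define T where "T = (\<lambda>x. x - (A (x, y) - c) / a)"
    have Td: "dist (T x) (T x') \<le> 1/2 * dist x x'" if "x \<in> cball 0 (\<tau>/2)" "x' \<in> cball 0 (\<tau>/2)" for x x'
    proof -
      have "T x - T x' = - ((A (x, y) - A (x', y) - a * (x - x')) / a)"
        using a by (simp add: T_def field_simps)
      then have "norm (T x - T x') = norm (A (x, y) - A (x', y) - a * (x - x')) / norm a"
        by (simp only: norm_minus_cancel norm_divide)
      also have "\<dots> \<le> (norm a/2 * norm (x - x')) / norm a"
        by (intro divide_right_mono lip) (use that y rp tp in auto)
      finally show ?thesis using na by (simp add: dist_norm)
    qed
    have T0: "norm (T 0) \<le> \<tau>/4"
    proof -
      have "norm (A (0, y) - c) \<le> norm a * \<tau>/8 + norm a * \<tau>/8"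
        by (rule order_trans[OF norm_triangle_ineq4 add_mono])
           (use t3(2)[of 0 y] y c t3(1) in \<open>simp_all add: \<rho>_def\<close>)
      then have "norm (A (0, y) - c) / norm a \<le> (norm a * \<tau>/8 + norm a * \<tau>/8) / norm a"
        by (rule divide_right_mono) simp
      then show ?thesis using na by (simp add: T_def norm_divide)
    qed
    have Tm: "T ` cball 0 (\<tau>/2) \<subseteq> cball 0 (\<tau>/2)"
    proof (intro subsetI, elim imageE)
      fix z x assume zx: "z = T x" and x: "x \<in> cball 0 (\<tau>/2)"
      then have "norm (T x - T 0) \<le> 1/2 * norm x" using Td[of x 0] tp by (simp add: dist_norm)
      then show "z \<in> cball 0 (\<tau>/2)" using zx T0 x norm_triangle_sub[of "T x" "T 0"] by simp
    qed
    have "\<exists>!x. x \<in> cball 0 (\<tau>/2) \<and> T x = x"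
      by (rule Banach_fix[where c="1/2"]) (use Tm Td tp in \<open>auto intro!: compact_imp_complete\<close>)
    then obtain x where "x \<in> cball 0 (\<tau>/2)" "T x = x" by blast
    then show ?thesis using a tp by (intro exI[of _ x]) (auto simp: T_def)
  qed
  then obtain X' where X': "\<And>c y. norm c < \<rho> \<Longrightarrow> norm y < \<rho> \<Longrightarrow> norm (X' c y) < \<tau> \<and> A (X' c y, y) = c"
    by metis
  define X where "X = (\<lambda>(c, y). X' c y)"
  have X: "norm (X (c, y)) < \<tau>" "A (X (c, y), y) = c" if "norm c < \<rho>" "norm y < \<rho>" for c y
    using X'[OF that] by (simp_all add: X_def)
  have uniq: "x = X (A (x, y), y)" if "norm x < \<tau>" "norm y < \<rho>" "norm (A (x, y)) < \<rho>" for x y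
  proof -
    have "norm a / 2 * norm (x - X (A (x, y), y)) \<le> norm (A (x, y) - A (X (A (x, y), y), y))"
      using that rp by (intro low X) auto
    then have "norm (x - X (A (x, y), y)) \<le> 0"
      using X(2)[OF that(3,2)] na by (simp add: mult_le_0_iff)
    then show ?thesis by simp
  qed
  define box where "box = ball (0::complex) \<rho> \<times> ball (0::complex) \<rho>"
  have ob: "open box" unfolding box_def by (intro open_Times open_ball)
  have contX: "isCont X (c0, y0)" if c: "norm c0 < \<rho>" and y: "norm y0 < \<rho>" for c0 y0
  proof -
    let ?x0 = "X (c0, y0)"
    have b: "norm (X z - ?x0) \<le> 2 / norm a * norm (fst z - A (?x0, snd z))" if "z \<in> box" for z
    proof -
      obtain c y where z: "z = (c, y)" by (cases z)
      have cy: "norm c < \<rho>" "norm y < \<rho>" using that by (auto simp: z box_def)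
      have "norm a / 2 * norm (X (c, y) - ?x0) \<le> norm (A (X (c, y), y) - A (?x0, y))"
        using cy c assms X(1) rp y by (intro low) auto
      then show ?thesis using na X(2)[OF cy] by (simp add: z field_simps)
    qed
    have "isCont A (?x0, y0)" using hol X(1)[OF c y] y rp by (intro holo2_at_isCont) auto
    then have "isCont (\<lambda>z::complex\<times>complex. A (?x0, snd z)) (c0, y0)"
      by (intro isCont_o2[where f="\<lambda>z::complex\<times>complex. (?x0, snd z)" and g=A] continuous_intros) auto
    then have "isCont (\<lambda>z. 2 / norm a * norm (fst z - A (?x0, snd z))) (c0, y0)"
      by (intro continuous_intros) auto
    then have "((\<lambda>z. 2 / norm a * norm (fst z - A (?x0, snd z))) \<longlongrightarrow> 0) (at (c0, y0))"
      unfolding isCont_def using X(2)[OF c y] by simp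
    moreover have "\<forall>\<^sub>F z in at (c0, y0). norm (X z - ?x0) \<le> 2 / norm a * norm (fst z - A (?x0, snd z))"
      using b eventually_at_topological ob c y by (intro eventually_mono[OF eventually_at_in_open'[OF ob]]) (auto simp: box_def)
    ultimately have "((\<lambda>z. X z - ?x0) \<longlongrightarrow> 0) (at (c0, y0))"
      by (rule Lim_null_comparison[rotated])
    then show ?thesis unfolding isCont_def by (rule LIM_zero_cancel)
  qed
  have "holo2_at X (c0, y0)" if c: "norm c0 < \<rho>" and y: "norm y0 < \<rho>" for c0 y0
  proof -
    let ?x0 = "X (c0, y0)"
    have x0: "norm ?x0 < \<tau>" "norm y0 < \<tau>" using X(1)[OF c y] y rp by auto
    obtain p q where d: "(A has_derivative (\<lambda>v. p * fst v + q * snd v)) (at (?x0, y0))"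
      using hol[OF x0] unfolding holo2_at_def by blast
    have p: "p \<noteq> 0"
    proof
      assume "p = 0"
      then have "((\<lambda>x. A (x, y0)) has_field_derivative 0) (at ?x0)" using slice_fst[OF d] by simp
      then have "((\<lambda>x. norm ((A (x, y0) - A (?x0, y0)) / (x - ?x0))) \<longlongrightarrow> norm (0::complex)) (at ?x0)"
        unfolding has_field_derivative_iff by (rule tendsto_norm)
      moreover have "\<forall>\<^sub>F x in at ?x0. norm a / 2 \<le> norm ((A (x, y0) - A (?x0, y0)) / (x - ?x0))"
      proof -
        have "\<forall>\<^sub>F x in at ?x0. x \<in> ball 0 \<tau> - {?x0}"
          using x0 by (intro eventually_at_in_open) auto
        then show ?thesis
        proof eventually_elim
          case (elim x)
          then have "norm (x - ?x0) > 0" by simp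
          then show ?case using low[of x ?x0 y0] elim x0 by (simp add: norm_divide field_simps)
        qed
      qed
      ultimately have "norm a / 2 \<le> norm (0::complex)" by (rule tendsto_lowerbound) simp
      then show False using na by simp
    qed
    define \<Theta> where "\<Theta> = (\<lambda>z. (A z, snd z))"
    define G where "G = (\<lambda>z. (X z, snd z))"
    have "(G has_derivative (\<lambda>v. ((fst v - q * snd v) / p, snd v))) (at (c0, y0))"
    proof (rule has_derivative_inverse_basic[where f=\<Theta> and f'="\<lambda>v. (p * fst v + q * snd v, snd v)" and T=box])
      show "(\<Theta> has_derivative (\<lambda>v. (p * fst v + q * snd v, snd v))) (at (G (c0, y0)))"
        unfolding \<Theta>_def G_def using d by (auto intro!: derivative_eq_intros)
      show "bounded_linear (\<lambda>v. ((fst v - q * snd v) / p, snd v))"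
        by (intro bounded_linear_Pair bounded_linear_divide[THEN bounded_linear_compose] bounded_linear_sub
            bounded_linear_fst bounded_linear_snd bounded_linear_mult_right[THEN bounded_linear_compose])
      show "(\<lambda>v. ((fst v - q * snd v) / p, snd v)) \<circ> (\<lambda>v. (p * fst v + q * snd v, snd v)) = id"
        using p by (auto simp: fun_eq_iff)
      show "isCont G (c0, y0)" unfolding G_def using contX[OF c y] by (intro continuous_intros) auto
      show "open box" by (rule ob)
      show "(c0, y0) \<in> box" using c y by (simp add: box_def)
      show "\<And>z. z \<in> box \<Longrightarrow> \<Theta> (G z) = z" using X(2) by (auto simp: \<Theta>_def G_def box_def)
    qed
    then have "((\<lambda>z. fst (G z)) has_derivative (\<lambda>v. fst ((fst v - q * snd v) / p, snd v))) (at (c0, y0))"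
      by (rule has_derivative_fst)
    then have "(X has_derivative (\<lambda>v. 1/p * fst v + (-q/p) * snd v)) (at (c0, y0))"
      unfolding G_def by (simp add: diff_divide_distrib)
    then show ?thesis unfolding holo2_at_def by blast
  qed
  then have "implicit_chart A X \<tau> \<rho>"
    unfolding implicit_chart_def using tp rp X uniq by blast
  moreover have "\<forall>x y. norm x < \<tau> \<longrightarrow> norm y < \<rho> \<longrightarrow> P (x, y)" using PP rp by auto
  moreover have "\<forall>x x' y. norm x < \<tau> \<longrightarrow> norm x' < \<tau> \<longrightarrow> norm y < \<rho> \<longrightarrow>
        norm a / 2 * norm (x - x') \<le> norm (A (x, y) - A (x', y))" using low rp by auto
  ultimately show ?thesis by blast
qed

section \<open>Counting the points of a fibre\<close>

text \<open>
  Riemann's theorem on removable singularities, applied to \<open>\<phi> y / y ^ n\<close>.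
\<close>

lemma divide_power:
  assumes hol: "\<phi> holomorphic_on ball 0 R" and R: "R > 0"
    and b: "\<And>y. norm y < R \<Longrightarrow> norm (\<phi> y) \<le> C * norm y ^ n"
  shows "\<exists>g. g holomorphic_on ball 0 R \<and> (\<forall>y. norm y < R \<longrightarrow> \<phi> y = y ^ n * g y)"
proof -
  have "(\<lambda>y. \<phi> y / y^n) holomorphic_on (ball 0 R - {0})"
    by (intro holomorphic_intros holomorphic_on_subset[OF hol]) auto
  moreover have "(0::complex) \<in> interior (ball 0 R)" using R by simp
  moreover have "\<forall>\<^sub>F y in at 0. norm (\<phi> y / y^n) \<le> C"
  proof -
    have "\<forall>\<^sub>F y in at 0. y \<in> ball 0 R - {0::complex}" using R by (intro eventually_at_in_open) auto
    then show ?thesis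
    proof eventually_elim
      case (elim y)
      then show ?case using b[of y] by (simp add: norm_divide norm_power divide_le_eq)
    qed
  qed
  ultimately obtain g where g: "g holomorphic_on ball 0 R" "\<forall>y\<in>ball 0 R - {0}. g y = \<phi> y / y^n"
    using holomorphic_on_extend_bounded by blast
  have "\<phi> y = y^n * g y" if "norm y < R" "y \<noteq> 0" for y
    using g(2) that by simp
  moreover have "\<phi> 0 = 0^n * g 0" if "n > 0"
    using b[of 0] R that by (simp add: power_0_left)
  ultimately have *: "\<forall>y. norm y < R \<longrightarrow> \<phi> y = y^n * g y" if "n > 0" using that by metis
  show ?thesis
  proof (cases "n = 0")
    case True then show ?thesis using hol by auto
  next
    case False then show ?thesis using * g by auto
  qed
qed

lemma zorder_power_growth:
  assumes hol: "H holomorphic_on ball 0 R" and R: "R > 0"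
    and b: "\<And>y. norm y < R \<Longrightarrow> c * norm y ^ n \<le> norm (H y) \<and> norm (H y) \<le> C * norm y ^ n" and c: "c > 0"
  shows "zorder H 0 = int n"
proof -
  obtain g where g: "g holomorphic_on ball 0 R" "\<And>y. norm y < R \<Longrightarrow> H y = y ^ n * g y"
    using divide_power[OF hol R, of C n] b by blast
  have "isCont g 0"
    using holomorphic_on_imp_continuous_on[OF g(1)] R by (simp add: continuous_on_eq_continuous_at)
  then have "((\<lambda>y. norm (g y)) \<longlongrightarrow> norm (g 0)) (at 0)" unfolding isCont_def by (rule tendsto_norm)
  moreover have "\<forall>\<^sub>F y in at 0. c \<le> norm (g y)"
  proof -
    have "\<forall>\<^sub>F y in at 0. y \<in> ball 0 R - {0::complex}" using R by (intro eventually_at_in_open) auto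
    then show ?thesis
    proof eventually_elim
      case (elim y)
      then have "c * norm y ^ n \<le> norm (g y) * norm y ^ n"
        using b[of y] g(2)[of y] by (simp add: norm_mult norm_power mult.commute)
      then show ?case using elim by simp
    qed
  qed
  ultimately have "c \<le> norm (g 0)" by (rule tendsto_lowerbound) simp
  then have "g 0 \<noteq> 0" using c by auto
  then show ?thesis
    by (intro zorder_eqI[OF open_ball[of 0 R] _ g(1)]) (use R g(2) in \<open>auto simp: power_int_def\<close>)
qed

text \<open>
  Rouche's theorem on the circle of radius \<open>r\<close>: the only possible zero of \<open>H\<close> is 0, of order \<open>n\<close>.
\<close>

lemma zero_count:
  assumes H: "H holomorphic_on ball 0 R" and G: "G holomorphic_on ball 0 R" and r: "0 < r" "r < R"
    and b: "\<And>y. norm y < R \<Longrightarrow> c * norm y ^ n \<le> norm (H y) \<and> norm (H y) \<le> C * norm y ^ n" and c: "c > 0"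
    and less: "\<And>y. norm y = r \<Longrightarrow> norm (G y - H y) < norm (H y)"
  defines "Z \<equiv> {y \<in> ball 0 r. G y = 0}"
  shows "finite Z" and "(\<Sum>y\<in>Z. zorder G y) = int n"
    and "\<And>y. y \<in> Z \<Longrightarrow> zorder G y \<ge> 1"
    and "\<And>y. y \<in> Z \<Longrightarrow> deriv G y \<noteq> 0 \<Longrightarrow> zorder G y = 1"
proof -
  define r' where "r' = (r + R)/2"
  have r': "r < r'" "r' < R" "0 < r'" using r by (auto simp: r'_def)
  have Gr: "G (of_real r) \<noteq> 0"
  proof
    assume "G (of_real r) = 0"
    then show False using less[of "of_real r"] r by simp
  qed
  have fin: "finite {y \<in> cball 0 r'. G y = 0}"
  proof (cases "G constant_on ball 0 R")
    case True
    then have "G y \<noteq> 0" if "y \<in> cball 0 r'" for y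
      using that r r' Gr unfolding constant_on_def by (metis cball_subset_ball_iff dist_0_norm mem_ball mem_cball norm_of_real abs_of_pos order_le_less_trans)
    then have "{y \<in> cball 0 r'. G y = 0} = {}" by blast
    then show ?thesis by (simp only: finite.emptyI)
  next
    case False
    then show ?thesis by (intro holomorphic_compact_finite_zeros[OF G]) (use r' in auto)
  qed
  show finZ: "finite Z" by (rule finite_subset[OF _ fin]) (use r' in \<open>auto simp: Z_def\<close>)
  have Gs: "G holomorphic_on ball 0 r'" "H holomorphic_on ball 0 r'"
    using G H r' by (auto intro: holomorphic_on_subset)
  have G_eq: "(\<lambda>p. H p + (G p - H p)) = G" by auto
  have H0: "{p \<in> ball 0 r'. H p = 0} \<subseteq> {0}"
  proof
    fix p assume "p \<in> {p \<in> ball 0 r'. H p = 0}"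
    then have "c * norm p ^ n \<le> 0" using b[of p] r' by auto
    moreover have "c * norm p ^ n > 0" if "p \<noteq> 0" using that c by (intro mult_pos_pos zero_less_power) auto
    ultimately show "p \<in> {0}" by fastforce
  qed
  have H00: "H 0 = 0 \<longleftrightarrow> n > 0"
    using b[of 0] c r by (cases n) auto
  have pi: "path_image (circlepath 0 r) = sphere 0 r" using r by simp
  have "(\<Sum>p\<in>{p \<in> ball 0 r'. H p + (G p - H p) = 0}. winding_number (circlepath 0 r) p * zorder (\<lambda>p. H p + (G p - H p)) p)
          = (\<Sum>p\<in>{p \<in> ball 0 r'. H p = 0}. winding_number (circlepath 0 r) p * zorder H p)"
  proof (rule Rouche_theorem)
    show "finite {p \<in> ball 0 r'. H p + (G p - H p) = 0}"
      by (rule finite_subset[OF _ fin]) auto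
    show "finite {p \<in> ball 0 r'. H p = 0}" using H0 finite_subset by blast
    show "(\<lambda>p. G p - H p) holomorphic_on ball 0 r'" by (intro holomorphic_intros Gs)
    show "path_image (circlepath 0 r) \<subseteq> ball 0 r'" unfolding pi using r' by auto
    show "\<forall>z\<in>path_image (circlepath 0 r). cmod (G z - H z) < cmod (H z)" unfolding pi using less by auto
    show "\<forall>z. z \<notin> ball 0 r' \<longrightarrow> winding_number (circlepath 0 r) z = 0"
    proof (intro allI impI)
      fix z :: complex assume "z \<notin> ball 0 r'"
      then show "winding_number (circlepath 0 r) z = 0"
        by (intro winding_number_zero_outside[of _ "cball 0 r"]) (use r r' in auto)
    qed
  qed (use Gs r in auto)
  then have 1: "(\<Sum>p\<in>{p \<in> ball 0 r'. G p = 0}. winding_number (circlepath 0 r) p * zorder G p)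
          = (\<Sum>p\<in>{p \<in> ball 0 r'. H p = 0}. winding_number (circlepath 0 r) p * zorder H p)"
    unfolding G_eq by simp
  have "(\<Sum>p\<in>{p \<in> ball 0 r'. H p = 0}. winding_number (circlepath 0 r) p * zorder H p) = of_int (int n)"
  proof (cases "n > 0")
    case True
    then have "{p \<in> ball 0 r'. H p = 0} = {0}" using H0 H00 r' by auto
    then show ?thesis using zorder_power_growth[OF H _ b c] r winding_number_circlepath[of 0 0 r] by simp
  next
    case False
    then have "{p \<in> ball 0 r'. H p = 0} = {}" using H0 H00 by auto
    then show ?thesis using False by (simp only: sum.empty) simp
  qed
  moreover have "(\<Sum>p\<in>{p \<in> ball 0 r'. G p = 0}. winding_number (circlepath 0 r) p * zorder G p)
      = (\<Sum>p\<in>Z. of_int (zorder G p))"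
  proof (rule sum.mono_neutral_cong_right)
    show "finite {p \<in> ball 0 r'. G p = 0}" by (rule finite_subset[OF _ fin]) auto
    show "Z \<subseteq> {p \<in> ball 0 r'. G p = 0}" using r' by (auto simp: Z_def)
    show "\<forall>i\<in>{p \<in> ball 0 r'. G p = 0} - Z. winding_number (circlepath 0 r) i * zorder G i = 0"
    proof
      fix p assume p: "p \<in> {p \<in> ball 0 r'. G p = 0} - Z"
      then have "norm p \<noteq> r" using less[of p] by auto
      then have "norm p > r" using p by (auto simp: Z_def)
      then have "winding_number (circlepath 0 r) p = 0"
        by (intro winding_number_zero_outside[of _ "cball 0 r"]) (use r in auto)
      then show "winding_number (circlepath 0 r) p * zorder G p = 0" by simp
    qed
    show "winding_number (circlepath 0 r) p * zorder G p = of_int (zorder G p)" if "p \<in> Z" for p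
      using winding_number_circlepath[of p 0 r] that by (simp add: Z_def)
  qed
  ultimately have "(of_int (\<Sum>p\<in>Z. zorder G p) :: complex) = of_int (int n)" using 1 by simp
  then show "(\<Sum>y\<in>Z. zorder G y) = int n" by (simp only: of_int_eq_iff)
  show "zorder G y \<ge> 1" if "y \<in> Z" for y
  proof -
    have "\<exists>w\<in>ball 0 R. G w \<noteq> 0" using Gr r by (intro bexI[of _ "of_real r"]) auto
    then have "zorder G y > 0"
      using zorder_exist_zero[OF G open_ball connected_ball, of y] that r by (auto simp: Z_def)
    then show ?thesis by simp
  qed
  show "zorder G y = 1" if "y \<in> Z" "deriv G y \<noteq> 0" for y
    by (rule zorder_zero_eqI[OF G open_ball]) (use that r in \<open>auto simp: Z_def\<close>)
qed

definition fibre :: "(complex \<times> complex \<Rightarrow> complex) \<Rightarrow> (complex \<times> complex \<Rightarrow> complex) \<Rightarrow>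
    (complex \<times> complex) set \<Rightarrow> complex \<Rightarrow> complex \<Rightarrow> (complex \<times> complex) set" where
  "fibre A B U c e = {z \<in> U. A z = c \<and> B z = e}"

text \<open>
  The map \<open>(A, B)\<close> on \<open>U\<close> behaves like a branched cover of degree \<open>n\<close> over the bidisc of radius \<open>\<delta>\<close>: it has
  at most \<open>n\<close> preimages everywhere and \<open>n\<close> of them over a dense set of values, and it is open, so that a
  preimage persists when the value moves.
\<close>

definition branched_cover :: "(complex \<times> complex \<Rightarrow> complex) \<Rightarrow> (complex \<times> complex \<Rightarrow> complex) \<Rightarrow>
    (complex \<times> complex) set \<Rightarrow> real \<Rightarrow> nat \<Rightarrow> bool" where
  "branched_cover A B U \<delta> n \<longleftrightarrow> open U \<and> 0 \<in> U \<and> \<delta> > 0 \<and>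
     (\<forall>c e. norm c < \<delta> \<longrightarrow> norm e < \<delta> \<longrightarrow> finite (fibre A B U c e) \<and> card (fibre A B U c e) \<le> n) \<and>
     (\<forall>c e \<eta>. norm c < \<delta> \<longrightarrow> norm e < \<delta> \<longrightarrow> \<eta> > 0 \<longrightarrow>
        (\<exists>e'. norm (e' - e) < \<eta> \<and> norm e' < \<delta> \<and> card (fibre A B U c e') = n)) \<and>
     (\<forall>z V. z \<in> U \<longrightarrow> norm (A z) < \<delta> \<longrightarrow> norm (B z) < \<delta> \<longrightarrow> open V \<longrightarrow> z \<in> V \<longrightarrow>
        (\<exists>\<mu>>0. \<forall>c e. norm (c - A z) < \<mu> \<longrightarrow> norm (e - B z) < \<mu> \<longrightarrow> fibre A B (V \<inter> U) c e \<noteq> {}))"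

text \<open>
  On the curve \<open>A = c\<close>, parametrized by \<open>y\<close>, the function \<open>B\<close> becomes a perturbation \<open>H c\<close> of \<open>H 0\<close>, which
  has a zero of order \<open>n\<close> at 0. Hence \<open>H c - e\<close> has \<open>n\<close> zeros with multiplicity, and they are simple unless
  \<open>e\<close> is one of finitely many critical values. Openness follows from the minimum modulus principle.
\<close>

lemma branched_cover_exists:
  fixes A B :: "complex \<times> complex \<Rightarrow> complex" and P :: "complex \<times> complex \<Rightarrow> bool"
  assumes evA: "\<forall>\<^sub>F z in nhds 0. holo2_at A z" and evB: "\<forall>\<^sub>F z in nhds 0. holo2_at B z" and A0: "A 0 = 0"
    and der: "(A has_derivative (\<lambda>v. a * fst v + b * snd v)) (at 0)" and a: "a \<noteq> 0"
    and k: "k > 0"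
    and AB: "\<forall>\<^sub>F z in nhds 0. A z = 0 \<longrightarrow> k * norm (snd z) ^ n \<le> norm (B z) \<and> norm (B z) \<le> K * norm (snd z) ^ n"
    and P: "\<forall>\<^sub>F z in nhds 0. P z"
  shows "\<exists>U \<delta>. branched_cover A B U \<delta> n \<and> (\<forall>z\<in>U. P z)"
proof -
  define P' where "P' = (\<lambda>z. P z \<and> holo2_at A z \<and> holo2_at B z \<and>
     (A z = 0 \<longrightarrow> k * norm (snd z) ^ n \<le> norm (B z) \<and> norm (B z) \<le> K * norm (snd z) ^ n))"
  have "\<forall>\<^sub>F z in nhds 0. P' z"
    unfolding P'_def by (intro eventually_conj evA evB AB P)
  from implicit_function[OF evA A0 der a this] obtain X \<tau> \<rho> where
    chart: "implicit_chart A X \<tau> \<rho>" and PP: "\<And>x y. norm x < \<tau> \<Longrightarrow> norm y < \<rho> \<Longrightarrow> P' (x, y)" by blast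
  have tr: "\<tau> > 0" "\<rho> > 0"
    and X: "\<And>c y. norm c < \<rho> \<Longrightarrow> norm y < \<rho> \<Longrightarrow> norm (X (c, y)) < \<tau> \<and> A (X (c, y), y) = c \<and> holo2_at X (c, y)"
    and uniq: "\<And>x y. norm x < \<tau> \<Longrightarrow> norm y < \<rho> \<Longrightarrow> norm (A (x, y)) < \<rho> \<Longrightarrow> x = X (A (x, y), y)"
    using chart unfolding implicit_chart_def by blast+
  define H where "H = (\<lambda>c y. B (X (c, y), y))"
  have Hh: "holo2_at (\<lambda>z. H (fst z) (snd z)) (c, y)" if cy: "norm c < \<rho>" "norm y < \<rho>" for c y
  proof -
    obtain p q where X1: "(X has_derivative (\<lambda>v. p * fst v + q * snd v)) (at (c, y))"
      using X[OF cy] unfolding holo2_at_def by blast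
    obtain p' q' where B1: "(B has_derivative (\<lambda>v. p' * fst v + q' * snd v)) (at (X (c, y), y))"
      using PP[of "X (c,y)" y] X[OF cy] cy unfolding holo2_at_def P'_def by blast
    have "((\<lambda>z. (X z, snd z)) has_derivative (\<lambda>v. (p * fst v + q * snd v, snd v))) (at (c, y))"
      using X1 by (auto intro!: derivative_eq_intros)
    moreover from B1 have "(B has_derivative (\<lambda>v. p' * fst v + q' * snd v)) (at (X (c, y), snd (c, y)))"
      by simp
    ultimately have "((\<lambda>z. B (X z, snd z)) has_derivative
        (\<lambda>v. p' * fst (p * fst v + q * snd v, snd v) + q' * snd (p * fst v + q * snd v, snd v))) (at (c, y))"
      by (rule has_derivative_compose)
    then have "((\<lambda>z. B (X z, snd z)) has_derivative (\<lambda>v. p' * (p * fst v + q * snd v) + q' * snd v)) (at (c, y))"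
      by simp
    then show ?thesis unfolding holo2_at_def H_def
      by (intro exI[of _ "p'*p"] exI[of _ "p'*q+q'"]) (simp add: algebra_simps)
  qed
  have Hhol: "H c holomorphic_on ball 0 \<rho>" if "norm c < \<rho>" for c
    using holo2_slice(2)[OF Hh, of \<rho> \<rho> c] that by simp
  have H0b: "k * norm y ^ n \<le> norm (H 0 y) \<and> norm (H 0 y) \<le> K * norm y ^ n" if "norm y < \<rho>" for y
    using PP[of "X (0,y)" y] X[of 0 y] that tr unfolding P'_def H_def by auto
  define r where "r = \<rho>/2"
  have r: "0 < r" "r < \<rho>" using tr by (auto simp: r_def)
  have Hc: "continuous_on (cball 0 r \<times> cball 0 r) (\<lambda>z. H (fst z) (snd z))"
    using Hh r by (intro continuous_at_imp_continuous_on) (auto intro: holo2_at_isCont)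
  then have Hu: "uniformly_continuous_on (cball 0 r \<times> cball 0 r) (\<lambda>z. H (fst z) (snd z))"
    by (intro compact_uniformly_continuous compact_Times compact_cball)
  have Hunif: "\<exists>\<mu>>0. \<forall>c c' y. norm c \<le> r \<longrightarrow> norm c' \<le> r \<longrightarrow> norm y \<le> r \<longrightarrow> norm (c - c') < \<mu> \<longrightarrow>
      norm (H c y - H c' y) < \<epsilon>" if "\<epsilon> > 0" for \<epsilon>
  proof -
    obtain \<mu> where m: "\<mu> > 0" "\<And>z z'. z \<in> cball 0 r \<times> cball 0 r \<Longrightarrow> z' \<in> cball 0 r \<times> cball 0 r \<Longrightarrow>
        dist z' z < \<mu> \<Longrightarrow> dist (H (fst z') (snd z')) (H (fst z) (snd z)) < \<epsilon>"
      using Hu \<open>\<epsilon> > 0\<close> unfolding uniformly_continuous_on_def by metis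
    have "norm (H c y - H c' y) < \<epsilon>" if "norm c \<le> r" "norm c' \<le> r" "norm y \<le> r" "norm (c - c') < \<mu>" for c c' y
      using m(2)[of "(c', y)" "(c, y)"] that by (simp add: dist_Pair_Pair dist_norm)
    then show ?thesis using m(1) by blast
  qed
  define m0 where "m0 = k * r^n"
  have m0: "m0 > 0" using k r by (simp add: m0_def)
  obtain \<delta>1 where d1: "\<delta>1 > 0" "\<And>c c' y. norm c \<le> r \<Longrightarrow> norm c' \<le> r \<Longrightarrow> norm y \<le> r \<Longrightarrow> norm (c - c') < \<delta>1 \<Longrightarrow>
      norm (H c y - H c' y) < m0/2"
    using Hunif[of "m0/2"] m0 by (metis half_gt_zero)
  \<comment> \<open>on the circle of radius \<open>r\<close>, \<open>H c - e\<close> differs from \<open>H 0\<close> by less than \<open>m0\<close>, the lower bound of \<open>H 0\<close> there\<close>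
  define \<delta> where "\<delta> = min (min \<delta>1 r) (m0/2)"
  have d: "\<delta> > 0" "\<delta> \<le> r" using d1 r m0 by (auto simp: \<delta>_def)
  define Z where "Z = (\<lambda>c e. {y \<in> ball 0 r. H c y - e = 0})"
  have less: "norm ((H c y - e) - H 0 y) < norm (H 0 y)"
    if "norm c < \<delta>" "norm e < \<delta>" "norm y = r" for c e y
  proof -
    have "norm (H c y - H 0 y) < m0/2" using d1(2)[of c 0 y] that d r by (simp add: \<delta>_def)
    moreover have "norm e < m0/2" using that by (simp add: \<delta>_def)
    ultimately have "norm ((H c y - H 0 y) - e) < m0"
      using norm_triangle_ineq4[of "H c y - H 0 y" e] by linarith
    moreover have "m0 \<le> norm (H 0 y)" using H0b[of y] that r by (simp add: m0_def)
    ultimately show ?thesis by (simp add: algebra_simps)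
  qed
  have Zc: "finite (Z c e)" "(\<Sum>y\<in>Z c e. zorder (\<lambda>y. H c y - e) y) = int n"
      "\<And>y. y \<in> Z c e \<Longrightarrow> zorder (\<lambda>y. H c y - e) y \<ge> 1"
      "\<And>y. y \<in> Z c e \<Longrightarrow> deriv (\<lambda>y. H c y - e) y \<noteq> 0 \<Longrightarrow> zorder (\<lambda>y. H c y - e) y = 1"
    if ce: "norm c < \<delta>" "norm e < \<delta>" for c e
  proof -
    have hol: "(\<lambda>y. H c y - e) holomorphic_on ball 0 \<rho>" "H 0 holomorphic_on ball 0 \<rho>"
      using Hhol[of c] Hhol[of 0] ce d r tr by (auto intro!: holomorphic_intros)
    note z = zero_count[OF hol(2,1) r H0b k less[OF ce]]
    show "finite (Z c e)" "(\<Sum>y\<in>Z c e. zorder (\<lambda>y. H c y - e) y) = int n"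
      "\<And>y. y \<in> Z c e \<Longrightarrow> zorder (\<lambda>y. H c y - e) y \<ge> 1"
      "\<And>y. y \<in> Z c e \<Longrightarrow> deriv (\<lambda>y. H c y - e) y \<noteq> 0 \<Longrightarrow> zorder (\<lambda>y. H c y - e) y = 1"
      using z unfolding Z_def by auto
  qed
  have Zle: "card (Z c e) \<le> n" if ce: "norm c < \<delta>" "norm e < \<delta>" for c e
  proof -
    have "int (card (Z c e)) = (\<Sum>y\<in>Z c e. 1)" by simp
    also have "\<dots> \<le> (\<Sum>y\<in>Z c e. zorder (\<lambda>y. H c y - e) y)" by (rule sum_mono) (use Zc(3)[OF ce] in auto)
    finally show ?thesis using Zc(2)[OF ce] by simp
  qed
  have Zdense: "\<exists>e'. norm (e' - e) < \<eta> \<and> norm e' < \<delta> \<and> card (Z c e') = n"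
    if ce: "norm c < \<delta>" "norm e < \<delta>" and eta: "\<eta> > 0" for c e \<eta>
  proof -
    have cr: "norm c < \<rho>" using ce d r by simp
    have dh: "deriv (H c) holomorphic_on ball 0 \<rho>" by (rule holomorphic_deriv[OF Hhol[OF cr] open_ball])
    \<comment> \<open>critical values of \<open>H c\<close>; all zeros of \<open>H c - e'\<close> are simple when \<open>e'\<close> avoids them\<close>
    define E where "E = H c ` {y \<in> cball 0 r. deriv (H c) y = 0}"
    have finE: "finite E"
    proof (cases "deriv (H c) constant_on ball 0 \<rho>")
      case False
      then have "finite {y \<in> cball 0 r. deriv (H c) y = 0}"
        by (intro holomorphic_compact_finite_zeros[OF dh]) (use r in auto)
      then show ?thesis unfolding E_def by simp
    next
      case True
      then obtain l where l: "\<And>y. y \<in> ball 0 \<rho> \<Longrightarrow> deriv (H c) y = l" unfolding constant_on_def by blast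
      show ?thesis
      proof (cases "l = 0")
        case False
        then have "{y \<in> cball 0 r. deriv (H c) y = 0} = {}" using l r by auto
        then show ?thesis unfolding E_def by (simp only: image_empty finite.emptyI)
      next
        case True
        have "H c constant_on ball 0 \<rho>"
        proof (rule has_field_derivative_0_imp_constant_on)
          show "(H c has_field_derivative 0) (at z)" if "z \<in> ball 0 \<rho>" for z
            using holomorphic_derivI[OF Hhol[OF cr] open_ball that] l[OF that] True by simp
        qed (use connected_ball in auto)
        then obtain m where m: "\<And>y. y \<in> ball 0 \<rho> \<Longrightarrow> H c y = m" unfolding constant_on_def by blast
        have "E \<subseteq> {m}" unfolding E_def using m r by auto
        then show ?thesis using finite_subset by blast
      qed
    qed
    have "open (ball e \<eta> \<inter> ball 0 \<delta>)" "e \<in> ball e \<eta> \<inter> ball 0 \<delta>" using eta ce by auto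
    then have "infinite (ball e \<eta> \<inter> ball 0 \<delta>)" using finite_imp_not_open by (metis empty_iff)
    then have "\<not> ball e \<eta> \<inter> ball 0 \<delta> \<subseteq> E" using finE finite_subset by blast
    then obtain e' where e': "e' \<in> ball e \<eta> \<inter> ball 0 \<delta>" "e' \<notin> E" by blast
    then have ce': "norm e' < \<delta>" by simp
    have "zorder (\<lambda>y. H c y - e') y = 1" if y: "y \<in> Z c e'" for y
    proof (rule Zc(4)[OF ce(1) ce' y])
      have yr: "y \<in> ball 0 \<rho>" using y r by (auto simp: Z_def)
      have "deriv (\<lambda>y. H c y - e') y = deriv (H c) y"
        using holomorphic_on_imp_differentiable_at[OF Hhol[OF cr] open_ball yr] by simp
      moreover have "deriv (H c) y \<noteq> 0" using e'(2) y by (auto simp: E_def Z_def)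
      ultimately show "deriv (\<lambda>y. H c y - e') y \<noteq> 0" by simp
    qed
    then have "int (card (Z c e')) = int n" using Zc(2)[OF ce(1) ce'] by simp
    then show ?thesis using e'(1) by (intro exI[of _ e']) (auto simp: dist_norm norm_minus_commute)
  qed
  define U where "U = {z \<in> ball 0 \<tau> \<times> ball 0 r. norm (A z) < \<delta>}"
  have contA: "continuous_on (ball 0 \<tau> \<times> ball 0 r) A"
    using PP r by (intro continuous_at_imp_continuous_on) (auto simp: P'_def intro: holo2_at_isCont)
  have "open U"
  proof -
    have "open (ball (0::complex) \<tau> \<times> ball (0::complex) r)" by (intro open_Times open_ball)
    moreover have "U = (\<lambda>z. norm (A z)) -` {..<\<delta>} \<inter> (ball 0 \<tau> \<times> ball 0 r)" by (auto simp: U_def)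
    moreover have "continuous_on (ball 0 \<tau> \<times> ball 0 r) (\<lambda>z. norm (A z))"
      by (rule continuous_on_norm[OF contA])
    ultimately show ?thesis
      using continuous_on_open_vimage[of "ball 0 \<tau> \<times> ball 0 r" "\<lambda>z. norm (A z)"] open_lessThan
      by simp
  qed
  have fib: "fibre A B U c e = (\<lambda>y. (X (c, y), y)) ` Z c e" if "norm c < \<delta>" "norm e < \<delta>" for c e
  proof
    show "fibre A B U c e \<subseteq> (\<lambda>y. (X (c, y), y)) ` Z c e"
    proof
      fix z assume "z \<in> fibre A B U c e"
      then obtain x y where z: "z = (x, y)" "norm x < \<tau>" "norm y < r" "A (x, y) = c" "B (x, y) = e"
        by (cases z) (auto simp: fibre_def U_def)
      then have "x = X (c, y)" using uniq[of x y] that r d by simp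
      then show "z \<in> (\<lambda>y. (X (c, y), y)) ` Z c e" using z by (auto simp: Z_def H_def)
    qed
    show "(\<lambda>y. (X (c, y), y)) ` Z c e \<subseteq> fibre A B U c e"
      using X that r d by (auto simp: Z_def H_def fibre_def U_def)
  qed
  have cardfib: "card (fibre A B U c e) = card (Z c e)" if "norm c < \<delta>" "norm e < \<delta>" for c e
    unfolding fib[OF that] by (rule card_image) (auto simp: inj_on_def)
  have openmap: "\<exists>\<mu>>0. \<forall>c e. norm (c - A z) < \<mu> \<longrightarrow> norm (e - B z) < \<mu> \<longrightarrow> fibre A B (V \<inter> U) c e \<noteq> {}"
    if z: "z \<in> U" and Az: "norm (A z) < \<delta>" and Bz: "norm (B z) < \<delta>" and V: "open V" "z \<in> V" for z V
  proof -
    define c0 where "c0 = A z"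
    define e0 where "e0 = B z"
    define y0 where "y0 = snd z"
    have c0: "norm c0 < \<delta>" and e0: "norm e0 < \<delta>" using Az Bz by (auto simp: c0_def e0_def)
    have "z \<in> fibre A B U c0 e0" using z by (simp add: fibre_def c0_def e0_def)
    then have zX: "z = (X (c0, y0), y0)" and y0: "y0 \<in> Z c0 e0" unfolding fib[OF c0 e0] y0_def by auto
    have y0r: "norm y0 < r" using y0 by (simp add: Z_def)
    define \<Gamma> where "\<Gamma> = (\<lambda>w. (X w, snd w))"
    have "isCont \<Gamma> (c0, y0)"
      unfolding \<Gamma>_def using X[of c0 y0] c0 y0r d r by (intro continuous_intros holo2_at_isCont) auto
    then have "(\<Gamma> \<longlongrightarrow> \<Gamma> (c0, y0)) (nhds (c0, y0))"
      unfolding isCont_def tendsto_at_iff_tendsto_nhds .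
    moreover have "\<Gamma> (c0, y0) \<in> V \<inter> U" using V z zX by (simp add: \<Gamma>_def)
    ultimately have "\<forall>\<^sub>F w in nhds (c0, y0). \<Gamma> w \<in> V \<inter> U"
      using V \<open>open U\<close> by (intro topological_tendstoD) auto
    then have "\<forall>\<^sub>F w in nhds (c0, y0). (X w, snd w) \<in> V \<inter> U" by (simp add: \<Gamma>_def)
    then obtain s0 where s0: "s0 > 0" "\<And>w. dist w (c0, y0) < s0 \<Longrightarrow> (X w, snd w) \<in> V \<inter> U"
      unfolding eventually_nhds_metric by blast
    have VU: "(X (c, y), y) \<in> V \<inter> U" if "norm (c - c0) < s0/2" "norm (y - y0) < s0/2" for c y
      using s0(2)[of "(c, y)"] norm_Pair_le[of "c - c0" "y - y0"] that by (simp add: dist_norm)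
    \<comment> \<open>a circle around \<open>y0\<close> that carries no other zero of \<open>H c0 - e0\<close>\<close>
    have "\<exists>s>0. s < s0/2 \<and> s < r - norm y0 \<and> (\<forall>w. norm (w - y0) = s \<longrightarrow> H c0 w \<noteq> e0)"
    proof -
      have finZ: "finite (Z c0 e0 - {y0})" using Zc(1)[OF c0 e0] by simp
      then obtain s1 where s1: "s1 > 0" "\<And>w. w \<in> Z c0 e0 - {y0} \<Longrightarrow> w \<noteq> y0 \<Longrightarrow> s1 \<le> dist y0 w"
        using finite_set_avoid[OF finZ, of y0] by blast
      define s where "s = min (min (s0/4) ((r - norm y0)/2)) (s1/2)"
      have s: "s > 0" "s < s0/2" "s < r - norm y0" "s < s1"
      proof -
        have "s \<le> s0/4" "s \<le> (r - norm y0)/2" "s \<le> s1/2"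
          unfolding s_def by (rule min.coboundedI1, rule min.cobounded1, rule min.coboundedI1, rule min.cobounded2, rule min.cobounded2)
        moreover have "s0 > 0" "s1 > 0" "r - norm y0 > 0" using s0 s1 y0r by auto
        ultimately show "s < s0/2" "s < r - norm y0" "s < s1" by argo+
        show "s > 0" using s0 s1 y0r by (simp add: s_def)
      qed
      have "H c0 w \<noteq> e0" if w: "norm (w - y0) = s" for w
      proof
        assume "H c0 w = e0"
        moreover have "norm w < r" using w s norm_triangle_sub[of w y0] by linarith
        ultimately have "w \<in> Z c0 e0 - {y0}" using w s by (auto simp: Z_def)
        then show False using s1(2)[of w] w s by (auto simp: dist_norm norm_minus_commute)
      qed
      then show ?thesis using s by blast
    qed
    then obtain s where s: "s > 0" "s < s0/2" "s < r - norm y0" "\<And>w. norm (w - y0) = s \<Longrightarrow> H c0 w \<noteq> e0"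
      by blast
    have sub: "cball y0 s \<subseteq> ball 0 r"
    proof
      fix w assume "w \<in> cball y0 s"
      then show "w \<in> ball 0 r" using s norm_triangle_sub[of w y0] by (simp add: dist_norm norm_minus_commute)
    qed
    have hol: "H c holomorphic_on ball 0 r" if "norm c < \<delta>" for c
      using Hhol[of c] that d r by (auto intro: holomorphic_on_subset)
    obtain w0 where w0: "w0 \<in> sphere y0 s" "\<And>w. w \<in> sphere y0 s \<Longrightarrow> norm (H c0 w0 - e0) \<le> norm (H c0 w - e0)"
    proof -
      have "continuous_on (sphere y0 s) (\<lambda>w. norm (H c0 w - e0))"
        using sub by (intro continuous_intros continuous_on_subset[OF holomorphic_on_imp_continuous_on[OF hol[OF c0]]]) auto
      moreover have "sphere y0 s \<noteq> {}" using s by simp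
      ultimately show ?thesis using continuous_attains_inf[OF compact_sphere] that by blast
    qed
    define m1 where "m1 = norm (H c0 w0 - e0)"
    have m1: "m1 > 0" using s(4)[of w0] w0(1) by (auto simp: m1_def dist_norm norm_minus_commute)
    obtain \<mu>1 where mu1: "\<mu>1 > 0" "\<And>c c' y. norm c \<le> r \<Longrightarrow> norm c' \<le> r \<Longrightarrow> norm y \<le> r \<Longrightarrow> norm (c - c') < \<mu>1 \<Longrightarrow>
      norm (H c y - H c' y) < m1/4" using Hunif[of "m1/4"] m1 by (metis divide_pos_pos zero_less_numeral)
    define \<mu> where "\<mu> = min (min \<mu>1 (m1/4)) (min (s0/2) (\<delta> - norm c0))"
    have "fibre A B (V \<inter> U) c e \<noteq> {}" if ce: "norm (c - c0) < \<mu>" "norm (e - e0) < \<mu>" for c e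
    proof -
      have cd: "norm c < \<delta>" using ce norm_triangle_sub[of c c0] by (simp add: \<mu>_def)
      have diff: "norm ((H c w - e) - (H c0 w - e0)) < m1/2" if "w \<in> cball y0 s" for w
      proof -
        have "norm (H c w - H c0 w) < m1/4"
        proof (rule mu1(2))
          have "w \<in> ball 0 r" using that sub by blast
          then show "norm w \<le> r" by simp
        qed (use cd c0 d ce in \<open>auto simp: \<mu>_def\<close>)
        moreover have "norm (e - e0) < m1/4" using ce by (simp add: \<mu>_def)
        ultimately have "norm ((H c w - H c0 w) - (e - e0)) < m1/2"
          using norm_triangle_ineq4[of "H c w - H c0 w" "e - e0"] by linarith
        then show ?thesis by (simp add: algebra_simps)
      qed
      obtain w where w: "w \<in> ball y0 s" "H c w - e = 0"
      proof (rule holomorphic_contract_to_zero[where f="\<lambda>w. H c w - e" and \<xi>=y0 and r=s])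
        show "continuous_on (cball y0 s) (\<lambda>w. H c w - e)"
          by (intro continuous_intros continuous_on_subset[OF holomorphic_on_imp_continuous_on[OF hol[OF cd]] sub])
        show "(\<lambda>w. H c w - e) holomorphic_on ball y0 s"
          by (intro holomorphic_intros holomorphic_on_subset[OF hol[OF cd]]) (use sub ball_subset_cball in blast)
        show "norm (H c y0 - e) < norm (H c w - e)" if "norm (y0 - w) = s" for w
        proof -
          have "norm (H c y0 - e) < m1/2" using diff[of y0] y0 s by (simp add: Z_def)
          moreover have "m1 \<le> norm (H c0 w - e0)" using w0(2)[of w] that by (simp add: m1_def dist_norm)
          moreover have "norm (H c0 w - e0) - norm (H c w - e) < m1/2"
            using diff[of w] that norm_triangle_ineq3[of "H c w - e" "H c0 w - e0"] by (simp add: dist_norm)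
          ultimately show ?thesis by linarith
        qed
      qed (use s in auto)
      have "w \<in> ball 0 r" using w(1) sub ball_subset_cball by blast
      then have "norm w < \<rho>" using r by simp
      moreover have "(X (c, w), w) \<in> V \<inter> U"
        using w(1) s ce by (intro VU) (auto simp: dist_norm norm_minus_commute \<mu>_def)
      ultimately have "(X (c, w), w) \<in> fibre A B (V \<inter> U) c e"
        using X[of c w] cd d r w(2) by (auto simp: fibre_def H_def)
      then show ?thesis by blast
    qed
    moreover have "\<mu> > 0" using mu1 m1 s0 c0 by (simp add: \<mu>_def)
    ultimately show ?thesis unfolding c0_def e0_def by blast
  qed
  have "0 \<in> U" using tr r d A0 by (auto simp: U_def zero_prod_def)
  have "branched_cover A B U \<delta> n"
    unfolding branched_cover_def
  proof (intro conjI allI impI)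
    show "finite (fibre A B U c e)" "card (fibre A B U c e) \<le> n" if "norm c < \<delta>" "norm e < \<delta>" for c e
      using fib[OF that] cardfib[OF that] Zc(1)[OF that] Zle[OF that] by simp_all
    show "\<exists>e'. norm (e' - e) < \<eta> \<and> norm e' < \<delta> \<and> card (fibre A B U c e') = n"
      if "norm c < \<delta>" "norm e < \<delta>" "\<eta> > 0" for c e \<eta>
      using Zdense[OF that] cardfib[OF that(1)] by metis
    show "\<exists>\<mu>>0. \<forall>c e. norm (c - A z) < \<mu> \<longrightarrow> norm (e - B z) < \<mu> \<longrightarrow> fibre A B (V \<inter> U) c e \<noteq> {}"
      if "z \<in> U" "norm (A z) < \<delta>" "norm (B z) < \<delta>" "open V" "z \<in> V" for z V
      by (rule openmap[OF that])
  qed (fact \<open>open U\<close> \<open>0 \<in> U\<close> d(1))+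
  moreover have "\<forall>z\<in>U. P z" using PP r by (auto simp: U_def P'_def)
  ultimately show ?thesis by blast
qed

section \<open>Generic fibres of a generically injective map\<close>

lemma finite_set_min_dist:
  fixes S :: "'a::metric_space set"
  assumes "finite S"
  shows "\<exists>d>0. \<forall>x\<in>S. \<forall>y\<in>S. x \<noteq> y \<longrightarrow> d \<le> dist x y"
proof -
  define M where "M = insert 1 ((\<lambda>(x, y). dist x y) ` {(x, y) \<in> S \<times> S. x \<noteq> y})"
  have fM: "finite M" unfolding M_def using assms by (auto intro: finite_subset[of _ "S \<times> S"])
  have "M \<noteq> {}" by (simp add: M_def)
  with fM have "Min M \<in> M" by (rule Min_in)
  moreover have "\<And>m. m \<in> M \<Longrightarrow> Min M \<le> m" using fM by simp
  ultimately show ?thesis by (intro exI[of _ "Min M"]) (auto simp: M_def)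
qed

lemma cover_many:
  assumes bc: "branched_cover A B U \<delta> n" and T: "finite T" "T \<subseteq> fibre A B U c0 e0"
    and ce: "norm c0 < \<delta>" "norm e0 < \<delta>" and V: "\<And>t. t \<in> T \<Longrightarrow> open (V t) \<and> t \<in> V t"
  shows "\<exists>\<mu>>0. \<forall>c e. norm (c - c0) < \<mu> \<longrightarrow> norm (e - e0) < \<mu> \<longrightarrow> (\<forall>t\<in>T. fibre A B (V t \<inter> U) c e \<noteq> {})"
  using T V
proof (induction T rule: finite_induct)
  case empty
  then show ?case by (intro exI[of _ 1]) auto
next
  case (insert t T)
  then obtain \<mu> where m: "\<mu> > 0" "\<And>c e t. norm (c - c0) < \<mu> \<Longrightarrow> norm (e - e0) < \<mu> \<Longrightarrow> t \<in> T \<Longrightarrow> fibre A B (V t \<inter> U) c e \<noteq> {}"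
    by auto
  have "t \<in> U" "A t = c0" "B t = e0" using insert.prems(1) by (auto simp: fibre_def)
  then obtain \<mu>' where m': "\<mu>' > 0" "\<And>c e. norm (c - c0) < \<mu>' \<Longrightarrow> norm (e - e0) < \<mu>' \<Longrightarrow> fibre A B (V t \<inter> U) c e \<noteq> {}"
    using bc insert.prems(2)[of t] ce unfolding branched_cover_def by (metis insertI1)
  show ?case using m m' by (intro exI[of _ "min \<mu> \<mu>'"]) auto
qed

definition generic_values :: "(complex \<times> complex \<Rightarrow> complex) \<Rightarrow> (complex \<times> complex \<Rightarrow> complex) \<Rightarrow>
    (complex \<times> complex) set \<Rightarrow> real \<Rightarrow> nat \<Rightarrow> (complex \<times> complex \<Rightarrow> 'a) \<Rightarrow> (complex \<times> complex) set" where
  "generic_values A B U \<delta> n h = {p. norm (fst p) < \<delta> \<and> norm (snd p) < \<delta> \<and> card (h ` fibre A B U (fst p) (snd p)) = n}"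

text \<open>
  Points of a fibre with distinct images have neighbourhoods with disjoint images, and each of these
  neighbourhoods meets all nearby fibres.
\<close>

lemma card_lower_semicontinuous:
  fixes h :: "complex \<times> complex \<Rightarrow> 'a::metric_space"
  assumes bc: "branched_cover A B U \<delta> n" and h: "continuous_on U h"
    and ce: "norm c0 < \<delta>" "norm e0 < \<delta>"
  shows "\<exists>\<mu>>0. \<forall>c e. norm (c - c0) < \<mu> \<longrightarrow> norm (e - e0) < \<mu> \<longrightarrow>
    norm c < \<delta> \<and> norm e < \<delta> \<and> card (h ` fibre A B U c0 e0) \<le> card (h ` fibre A B U c e)"
proof -
  have U: "open U" and fin: "\<And>c e. norm c < \<delta> \<Longrightarrow> norm e < \<delta> \<Longrightarrow> finite (fibre A B U c e)"
    using bc unfolding branched_cover_def by auto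
  obtain T where T: "T \<subseteq> fibre A B U c0 e0" "inj_on h T" "h ` fibre A B U c0 e0 = h ` T"
    by (metis subset_image_inj subset_refl)
  have finT: "finite T" using T(1) fin[OF ce] finite_subset by blast
  obtain d where d: "d > 0" "\<And>s t. s \<in> T \<Longrightarrow> t \<in> T \<Longrightarrow> s \<noteq> t \<Longrightarrow> d \<le> dist (h s) (h t)"
  proof -
    have "\<exists>d>0. \<forall>x\<in>h ` T. \<forall>y\<in>h ` T. x \<noteq> y \<longrightarrow> d \<le> dist x y"
      by (rule finite_set_min_dist) (use finT in simp)
    then show ?thesis using that T(2) by (metis imageI inj_onD)
  qed
  define V where "V = (\<lambda>t. h -` ball (h t) (d/2) \<inter> U)"
  have oV: "open (V t)" for t unfolding V_def
    using continuous_on_open_vimage[OF U, of h] h by (metis open_ball)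
  have tV: "t \<in> V t" if "t \<in> T" for t using that T(1) d(1) by (auto simp: V_def fibre_def)
  obtain \<mu> where m: "\<mu> > 0" "\<And>c e t. norm (c - c0) < \<mu> \<Longrightarrow> norm (e - e0) < \<mu> \<Longrightarrow> t \<in> T \<Longrightarrow> fibre A B (V t \<inter> U) c e \<noteq> {}"
    using cover_many[OF bc finT T(1) ce, of V] oV tV by auto
  define \<mu>' where "\<mu>' = min \<mu> (min (\<delta> - norm c0) (\<delta> - norm e0))"
  have "norm c < \<delta> \<and> norm e < \<delta> \<and> card (h ` fibre A B U c0 e0) \<le> card (h ` fibre A B U c e)"
    if m': "norm (c - c0) < \<mu>'" "norm (e - e0) < \<mu>'" for c e
  proof -
    have ce': "norm c < \<delta>" "norm e < \<delta>"
      using m' norm_triangle_sub[of c c0] norm_triangle_sub[of e e0] by (auto simp: \<mu>'_def)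
    have "\<forall>t\<in>T. \<exists>z. z \<in> fibre A B (V t \<inter> U) c e" using m(2)[of c e] m' unfolding \<mu>'_def by (metis ex_in_conv min_less_iff_conj)
    then obtain z where z: "\<And>t. t \<in> T \<Longrightarrow> z t \<in> fibre A B (V t \<inter> U) c e" by metis
    have "inj_on (\<lambda>t. h (z t)) T"
    proof (rule inj_onI, rule ccontr)
      fix s t assume st: "s \<in> T" "t \<in> T" "h (z s) = h (z t)" "s \<noteq> t"
      then have "dist (h s) (h (z s)) < d/2" "dist (h t) (h (z s)) < d/2"
        using z[of s] z[of t] by (auto simp: fibre_def V_def)
      then have "dist (h s) (h t) < d" by (metis dist_triangle_half_l dist_commute)
      then show False using d(2)[OF st(1,2,4)] by simp
    qed
    moreover have "(\<lambda>t. h (z t)) ` T \<subseteq> h ` fibre A B U c e" using z by (auto simp: fibre_def)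
    ultimately have "card T \<le> card (h ` fibre A B U c e)"
      using fin[OF ce'] by (metis card_image card_mono finite_imageI)
    then show ?thesis using ce' T(2,3) by (simp add: card_image)
  qed
  moreover have "\<mu>' > 0" using m ce by (simp add: \<mu>'_def)
  ultimately show ?thesis by blast
qed

lemma generic_values_open:
  fixes h :: "complex \<times> complex \<Rightarrow> 'a::metric_space"
  assumes bc: "branched_cover A B U \<delta> n" and h: "continuous_on U h"
  shows "open (generic_values A B U \<delta> n h)"
  unfolding open_dist
proof
  fix p assume p: "p \<in> generic_values A B U \<delta> n h"
  obtain c0 e0 where p0: "p = (c0, e0)" by (cases p)
  have ce: "norm c0 < \<delta>" "norm e0 < \<delta>" "card (h ` fibre A B U c0 e0) = n"
    using p by (auto simp: p0 generic_values_def)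
  obtain \<mu> where m: "\<mu> > 0" "\<And>c e. norm (c - c0) < \<mu> \<Longrightarrow> norm (e - e0) < \<mu> \<Longrightarrow>
    norm c < \<delta> \<and> norm e < \<delta> \<and> n \<le> card (h ` fibre A B U c e)"
    using card_lower_semicontinuous[OF bc h ce(1,2)] unfolding ce(3) by blast
  have "q \<in> generic_values A B U \<delta> n h" if q: "dist q p < \<mu>" for q
  proof -
    obtain c e where q0: "q = (c, e)" by (cases q)
    have "norm (c - c0) < \<mu>" "norm (e - e0) < \<mu>"
      using q norm_fst_le[of "c - c0" "e - e0"] norm_snd_le[of "e - e0" "c - c0"] by (auto simp: q0 p0 dist_norm)
    note * = m(2)[OF this]
    then have "finite (fibre A B U c e)" "card (fibre A B U c e) \<le> n" using bc unfolding branched_cover_def by auto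
    then have "card (h ` fibre A B U c e) \<le> n" using card_image_le le_trans by blast
    then show ?thesis using * by (simp add: generic_values_def q0)
  qed
  then show "\<exists>e>0. \<forall>y. dist y p < e \<longrightarrow> y \<in> generic_values A B U \<delta> n h" using m(1) by blast
qed

text \<open>
  Near the given value there is one with \<open>n\<close> preimages, and so have all values in a neighbourhood of it.
  Among those take one whose fibre has the largest number of images under \<open>h\<close>. If two of its preimages
  had the same image, they would have to keep a common image for all nearby values, since otherwise the
  number of images would increase; then \<open>h\<close> would be self-intersecting on an open set.
\<close>

lemma generic_values_dense:
  fixes h :: "complex \<times> complex \<Rightarrow> 'a::metric_space"
  assumes bc: "branched_cover A B U \<delta> n" and h: "continuous_on U h"
    and D: "interior {z \<in> U. \<exists>z'\<in>U. z' \<noteq> z \<and> h z' = h z} = {}"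
    and AB: "continuous_on U A" "continuous_on U B"
    and ce: "norm c < \<delta>" "norm e < \<delta>" and eta: "\<eta> > 0"
  shows "\<exists>p\<in>generic_values A B U \<delta> n h. norm (fst p - c) < \<eta> \<and> norm (snd p - e) < \<eta>"
proof -
  have U: "open U" and fin: "\<And>c e. norm c < \<delta> \<Longrightarrow> norm e < \<delta> \<Longrightarrow> finite (fibre A B U c e)"
    and le: "\<And>c e. norm c < \<delta> \<Longrightarrow> norm e < \<delta> \<Longrightarrow> card (fibre A B U c e) \<le> n"
    using bc unfolding branched_cover_def by auto
  obtain e1 where e1: "norm (e1 - e) < \<eta>/2" "norm e1 < \<delta>" "card (fibre A B U c e1) = n"
    using bc ce eta unfolding branched_cover_def by (metis half_gt_zero)
  obtain \<mu> where m: "\<mu> > 0" "\<And>c' e'. norm (c' - c) < \<mu> \<Longrightarrow> norm (e' - e1) < \<mu> \<Longrightarrow>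
    norm c' < \<delta> \<and> norm e' < \<delta> \<and> n \<le> card (fibre A B U c' e')"
    using card_lower_semicontinuous[OF bc continuous_on_id ce(1) e1(2)] e1(3) by auto
  define O' where "O' = {p. norm (fst p - c) < min \<mu> (\<eta>/2) \<and> norm (snd p - e1) < min \<mu> (\<eta>/2)}"
  define k where "k = (\<lambda>p. card (h ` fibre A B U (fst p) (snd p)))"
  have O1: "norm (fst p) < \<delta>" "norm (snd p) < \<delta>" "card (fibre A B U (fst p) (snd p)) = n" if "p \<in> O'" for p
    using m(2)[of "fst p" "snd p"] le[of "fst p" "snd p"] that by (auto simp: O'_def intro: antisym)
  have kn: "k p \<le> n" if "p \<in> O'" for p
    using card_image_le[OF fin[OF O1(1,2)[OF that]], of h] O1(3)[OF that] by (simp add: k_def)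
  have "(c, e1) \<in> O'" using m eta by (simp add: O'_def)
  then obtain p where p: "p \<in> O'" "\<And>q. q \<in> O' \<Longrightarrow> k q \<le> k p"
    using ex_has_greatest_nat[of "\<lambda>p. p \<in> O'" "(c, e1)" k "Suc n"] kn by (metis less_Suc_eq_le)
  obtain c2 e2 where p2: "p = (c2, e2)" by (cases p)
  note p1 = O1[OF p(1), unfolded p2 fst_conv snd_conv]
  have "k p = n"
  proof (rule ccontr)
    assume "k p \<noteq> n"
    then have "card (h ` fibre A B U c2 e2) < card (fibre A B U c2 e2)"
      using kn[OF p(1)] p1(3) by (simp add: k_def p2)
    then have "\<not> inj_on h (fibre A B U c2 e2)" by (metis card_image less_irrefl)
    then obtain z1 z2 where z12: "z1 \<in> fibre A B U c2 e2" "z2 \<in> fibre A B U c2 e2" "z1 \<noteq> z2" "h z1 = h z2"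
      by (auto simp: inj_on_def)
    \<comment> \<open>\<open>T\<close> represents the other images; together with \<open>z1\<close> it represents all images of the fibre\<close>
    define F where "F = {z \<in> fibre A B U c2 e2. h z \<noteq> h z1}"
    obtain T where T: "T \<subseteq> F" "inj_on h T" "h ` F = h ` T" by (metis subset_image_inj subset_refl)
    have finF: "finite F" using fin[OF p1(1,2)] by (simp add: F_def)
    have finT: "finite T" using T(1) finF finite_subset by blast
    have imF: "h ` fibre A B U c2 e2 = insert (h z1) (h ` T)" unfolding T(3)[symmetric] using z12 by (auto simp: F_def)
    have nT: "h z1 \<notin> h ` T" using T(1) by (auto simp: F_def)
    then have kp: "k p = Suc (card T)" using imF finT T(2) by (simp add: k_def p2 card_image)
    obtain d where d: "d > 0" "\<And>x y. x \<in> insert (h z1) (h ` T) \<Longrightarrow> y \<in> insert (h z1) (h ` T) \<Longrightarrow> x \<noteq> y \<Longrightarrow> d \<le> dist x y"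
      using finT by (metis finite_imageI finite_insert finite_set_min_dist)
    define V where "V = (\<lambda>t. h -` ball (h t) (d/2) \<inter> U)"
    have oV: "open (V t)" for t unfolding V_def
      using continuous_on_open_vimage[OF U, of h] h by (metis open_ball)
    obtain W1 W2 where W: "open W1" "open W2" "z1 \<in> W1" "z2 \<in> W2" "W1 \<inter> W2 = {}"
      using hausdorff[OF z12(3)] by blast
    define V' where "V' = (\<lambda>t. if t = z2 then V z1 \<inter> W2 else V t)"
    have z2T: "z2 \<notin> T" using T(1) z12(4) by (auto simp: F_def)
    have zU: "z1 \<in> U" "z2 \<in> U" using z12 by (auto simp: fibre_def)
    have V': "open (V' t) \<and> t \<in> V' t" if "t \<in> insert z2 T" for t
    proof (cases "t = z2")
      case True
      have "open (V z1 \<inter> W2)" using oV W by blast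
      then show ?thesis using True W zU z12(4) d(1) by (auto simp: V'_def V_def)
    next
      case False
      then have "t \<in> T" using that by auto
      then show ?thesis using oV T(1) d(1) False by (auto simp: V'_def V_def F_def fibre_def)
    qed
    have TT: "insert z2 T \<subseteq> fibre A B U c2 e2" using T(1) z12(2) by (auto simp: F_def)
    obtain \<nu> where nu: "\<nu> > 0" "\<And>c e t. norm (c - c2) < \<nu> \<Longrightarrow> norm (e - e2) < \<nu> \<Longrightarrow> t \<in> insert z2 T \<Longrightarrow>
        fibre A B (V' t \<inter> U) c e \<noteq> {}"
      using cover_many[OF bc _ TT p1(1,2) V'] finT by (metis finite_insert)
    define N where "N = {z \<in> V z1 \<inter> W1. (A z, B z) \<in> (O' \<inter> {p. norm (fst p - c2) < \<nu> \<and> norm (snd p - e2) < \<nu>})}"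
    have oO: "open (O' \<inter> {p. norm (fst p - c2) < \<nu> \<and> norm (snd p - e2) < \<nu>})"
    proof -
      have box: "{p::complex\<times>complex. norm (fst p - a) < s \<and> norm (snd p - b) < t} = ball a s \<times> ball b t" for a b s t
        by (auto simp: dist_norm norm_minus_commute)
      show ?thesis unfolding O'_def box by (intro open_Int open_Times open_ball)
    qed
    have "open N"
    proof -
      have "open ((\<lambda>z. (A z, B z)) -` (O' \<inter> {p. norm (fst p - c2) < \<nu> \<and> norm (snd p - e2) < \<nu>}) \<inter> U)"
        using iffD1[OF continuous_on_open_vimage[OF U] continuous_on_Pair[OF AB]] oO by blast
      then have "open (((\<lambda>z. (A z, B z)) -` (O' \<inter> {p. norm (fst p - c2) < \<nu> \<and> norm (snd p - e2) < \<nu>}) \<inter> U) \<inter> (V z1 \<inter> W1))"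
        using open_Int[OF oV W(1)] by (rule open_Int)
      also have "((\<lambda>z. (A z, B z)) -` (O' \<inter> {p. norm (fst p - c2) < \<nu> \<and> norm (snd p - e2) < \<nu>}) \<inter> U) \<inter> (V z1 \<inter> W1) = N"
        by (auto simp: N_def V_def)
      finally show ?thesis .
    qed
    moreover have "z1 \<in> N" using z12(1) p(1) W(3) d(1) nu(1) by (auto simp: N_def V_def fibre_def p2)
    moreover have "N \<subseteq> {z \<in> U. \<exists>z'\<in>U. z' \<noteq> z \<and> h z' = h z}"
    proof
      fix z assume z: "z \<in> N"
      have zV: "z \<in> U" "dist (h z1) (h z) < d/2" "z \<in> W1" "(A z, B z) \<in> O'" "norm (A z - c2) < \<nu>" "norm (B z - e2) < \<nu>"
        using z by (auto simp: N_def V_def)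
      have "\<forall>t\<in>insert z2 T. \<exists>w. w \<in> fibre A B (V' t \<inter> U) (A z) (B z)" using nu(2)[OF zV(5,6)] by blast
      then obtain w where w: "\<And>t. t \<in> insert z2 T \<Longrightarrow> w t \<in> fibre A B (V' t \<inter> U) (A z) (B z)" by metis
      have w2: "w z2 \<in> U" "w z2 \<in> W2" "dist (h z1) (h (w z2)) < d/2"
        using w[of z2] by (auto simp: fibre_def V'_def V_def)
      have wt: "dist (h t) (h (w t)) < d/2" "w t \<in> fibre A B U (A z) (B z)" if "t \<in> T" for t
        using w[of t] that z2T by (auto simp: fibre_def V'_def V_def split: if_splits)
      have ne: "h (w t) \<noteq> x" if "t \<in> T" "dist (h z1) x < d/2" for t x
      proof
        assume "h (w t) = x"
        then have "dist (h z1) (h t) < d" using wt(1)[OF that(1)] that(2) by (metis dist_triangle_half_l dist_commute)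
        then show False using d(2)[of "h z1" "h t"] that(1) nT by force
      qed
      have inj: "inj_on (\<lambda>t. h (w t)) T"
      proof (rule inj_onI, rule ccontr)
        fix s t assume st: "s \<in> T" "t \<in> T" "h (w s) = h (w t)" "s \<noteq> t"
        then have "dist (h s) (h t) < d" using wt(1)[of s] wt(1)[of t] by (metis dist_triangle_half_l dist_commute)
        moreover have "h s \<noteq> h t" using T(2) st by (auto simp: inj_on_def)
        ultimately show False using d(2)[of "h s" "h t"] st by force
      qed
      have "h (w z2) = h z"
      proof (rule ccontr)
        assume neq: "h (w z2) \<noteq> h z"
        let ?S = "insert (h z) (insert (h (w z2)) ((\<lambda>t. h (w t)) ` T))"
        have "h z \<notin> (\<lambda>t. h (w t)) ` T" "h (w z2) \<notin> (\<lambda>t. h (w t)) ` T"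
          using ne[OF _ zV(2)] ne[OF _ w2(3)] by (metis (no_types, lifting) imageE)+
        then have "card ?S = Suc (Suc (card T))"
          using neq inj finT by (simp add: card_image)
        moreover have "?S \<subseteq> h ` fibre A B U (A z) (B z)"
          using zV(1) wt(2) w[of z2] by (auto simp: fibre_def)
        then have "card ?S \<le> k (A z, B z)" unfolding k_def using fin O1[OF zV(4)] by (intro card_mono) auto
        ultimately show False using p(2)[OF zV(4)] kp by simp
      qed
      moreover have "w z2 \<noteq> z" using w2(2) zV(3) W(5) by auto
      ultimately show "z \<in> {z \<in> U. \<exists>z'\<in>U. z' \<noteq> z \<and> h z' = h z}" using zV(1) w2(1) by auto
    qed
    ultimately have "z1 \<in> interior {z \<in> U. \<exists>z'\<in>U. z' \<noteq> z \<and> h z' = h z}" by (rule interiorI)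
    then show False using D by simp
  qed
  then have "p \<in> generic_values A B U \<delta> n h" using O1[OF p(1)] by (simp add: generic_values_def k_def)
  moreover have "norm (fst p - c) < \<eta>" using p(1) eta by (auto simp: O'_def)
  moreover have "norm (snd p - e) < \<eta>"
  proof -
    have "norm (snd p - e1) < \<eta>/2" using p(1) by (simp add: O'_def)
    then show ?thesis using e1(1) norm_triangle_mono[of "snd p - e1" "\<eta>/2" "e1 - e" "\<eta>/2"]
      by (smt (verit) field_sum_of_halves norm_diff_triangle_less)
  qed
  ultimately show ?thesis by blast
qed

section \<open>Multiplicity of the image of a germ\<close>

lemma isCont_eventually_dist:
  assumes "isCont f x" "e > 0" shows "\<forall>\<^sub>F y in nhds x. dist (f y) (f x) < e"
  using assms unfolding isCont_def tendsto_at_iff_tendsto_nhds by (auto dest: tendstoD)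

lemma mult_norm_power_le_0D:
  fixes y :: complex
  assumes "k * norm y ^ n \<le> 0" "k > 0" shows "y = 0"
proof (rule ccontr)
  assume "y \<noteq> 0"
  then have "k * norm y ^ n > 0" using assms(2) by simp
  then show False using assms(1) by simp
qed

definition self_intersecting :: "(complex \<times> complex \<Rightarrow> 'a) \<Rightarrow> (complex \<times> complex) set \<Rightarrow> (complex \<times> complex) set" where
  "self_intersecting h U = {z \<in> U. \<exists>z'\<in>U. z' \<noteq> z \<and> h z' = h z}"

text \<open>
  The kernel of the linear form \<open>q - \<kappa> * p - \<kappa>' * u\<close> in the target is the tangent cone of the image. On the
  curve \<open>u = 0\<close> the order of \<open>p\<close> is exactly \<open>n\<close> and that of \<open>q\<close> at least \<open>n\<close>, so a suitable multiple of \<open>p\<close>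
  cancels the term of order \<open>n\<close> of \<open>q\<close>. Subtracting a multiple of \<open>u\<close> removes the derivative in the first
  variable, so that the form changes by \<open>o (norm (u z))\<close> when one leaves the curve.
\<close>

lemma tangent_cone_form:
  assumes eu: "\<forall>\<^sub>F z in nhds 0. holo2_at u z" and ep: "\<forall>\<^sub>F z in nhds 0. holo2_at p z"
    and eq: "\<forall>\<^sub>F z in nhds 0. holo2_at q z" and u0: "u 0 = 0"
    and du: "(u has_derivative (\<lambda>v. a1 * fst v + b1 * snd v)) (at 0)" and a1: "a1 \<noteq> 0" and k: "k > 0"
    and lo: "\<forall>\<^sub>F z in nhds 0. k * norm (snd z) ^ n \<le> norm (p z) + K * norm (u z)"
    and up2: "\<forall>\<^sub>F z in nhds 0. norm (p z) \<le> K * (norm (u z) + norm (snd z) ^ n)"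
    and up3: "\<forall>\<^sub>F z in nhds 0. norm (q z) \<le> K * (norm (u z) + norm (snd z) ^ n)"
  shows "\<exists>\<kappa> \<kappa>' q'. ((\<lambda>z. q z - \<kappa> * p z - \<kappa>' * u z) has_derivative (\<lambda>v. q' * snd v)) (at 0) \<and>
     (\<forall>\<eta>>0. \<forall>\<^sub>F z in nhds 0. norm (q z - \<kappa> * p z - \<kappa>' * u z) \<le> \<eta> * (norm (u z) + norm (snd z) ^ n))"
proof -
  define P where "P = (\<lambda>z. holo2_at p z \<and> holo2_at q z \<and>
     k * norm (snd z) ^ n \<le> norm (p z) + K * norm (u z) \<and>
     norm (p z) \<le> K * (norm (u z) + norm (snd z) ^ n) \<and> norm (q z) \<le> K * (norm (u z) + norm (snd z) ^ n))"
  have "\<forall>\<^sub>F z in nhds 0. P z" unfolding P_def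
    by (intro eventually_conj ep eq lo up2 up3)
  from implicit_function[OF eu u0 du a1 this] obtain X \<tau> \<rho> where
    chart: "implicit_chart u X \<tau> \<rho>" and PP: "\<And>x y. norm x < \<tau> \<Longrightarrow> norm y < \<rho> \<Longrightarrow> P (x, y)"
    and low: "\<And>x x' y. norm x < \<tau> \<Longrightarrow> norm x' < \<tau> \<Longrightarrow> norm y < \<rho> \<Longrightarrow>
        norm a1 / 2 * norm (x - x') \<le> norm (u (x, y) - u (x', y))" by blast
  have tr: "\<tau> > 0" "\<rho> > 0"
    and X: "\<And>c y. norm c < \<rho> \<Longrightarrow> norm y < \<rho> \<Longrightarrow> norm (X (c, y)) < \<tau> \<and> u (X (c, y), y) = c \<and> holo2_at X (c, y)"
    and uniq: "\<And>x y. norm x < \<tau> \<Longrightarrow> norm y < \<rho> \<Longrightarrow> norm (u (x, y)) < \<rho> \<Longrightarrow> x = X (u (x, y), y)"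
    using chart unfolding implicit_chart_def by blast+
  define \<xi> where "\<xi> = (\<lambda>y. X (0, y))"
  have xi: "norm (\<xi> y) < \<tau>" "u (\<xi> y, y) = 0" if "norm y < \<rho>" for y using X[of 0 y] that tr by (auto simp: \<xi>_def)
  have xi0: "\<xi> 0 = 0" using uniq[of 0 0] u0 tr by (simp add: \<xi>_def zero_prod_def)
  have xih: "\<xi> holomorphic_on ball 0 \<rho>"
    unfolding \<xi>_def using X tr by (intro holo2_slice(2)[of \<rho> \<rho> X 0]) auto
  have comp: "(\<lambda>y. g (\<xi> y, y)) holomorphic_on ball 0 \<rho>"
    if g: "\<And>x y. norm x < \<tau> \<Longrightarrow> norm y < \<rho> \<Longrightarrow> holo2_at g (x, y)" for g
    by (rule holo2_along_graph[OF xih]) (use g xi in auto)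
  have pb: "k * norm y ^ n \<le> norm (p (\<xi> y, y))" "norm (p (\<xi> y, y)) \<le> K * norm y ^ n"
    "norm (q (\<xi> y, y)) \<le> K * norm y ^ n" if "norm y < \<rho>" for y
    using PP[OF xi(1)[OF that] that] xi(2)[OF that] by (auto simp: P_def)
  obtain g2 where g2: "g2 holomorphic_on ball 0 \<rho>" "\<And>y. norm y < \<rho> \<Longrightarrow> p (\<xi> y, y) = y^n * g2 y"
    using divide_power[OF comp[of p] tr(2), of K n] pb PP by (auto simp: P_def)
  obtain g3 where g3: "g3 holomorphic_on ball 0 \<rho>" "\<And>y. norm y < \<rho> \<Longrightarrow> q (\<xi> y, y) = y^n * g3 y"
    using divide_power[OF comp[of q] tr(2), of K n] pb PP by (auto simp: P_def)
  have c2: "isCont g2 0" and c3: "isCont g3 0"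
    using holomorphic_on_imp_continuous_on[OF g2(1)] holomorphic_on_imp_continuous_on[OF g3(1)] tr
    by (simp_all add: continuous_on_eq_continuous_at)
  have "k \<le> norm (g2 0)"
  proof (rule tendsto_lowerbound)
    show "((\<lambda>y. norm (g2 y)) \<longlongrightarrow> norm (g2 0)) (at 0)" using c2 unfolding isCont_def by (rule tendsto_norm)
    have "\<forall>\<^sub>F y in at 0. y \<in> ball 0 \<rho> - {0::complex}" using tr by (intro eventually_at_in_open) auto
    then show "\<forall>\<^sub>F y in at 0. k \<le> norm (g2 y)"
    proof eventually_elim
      case (elim y)
      then have "k * norm y ^ n \<le> norm (g2 y) * norm y ^ n"
        using pb(1)[of y] g2(2)[of y] by (simp add: norm_mult norm_power mult.commute)
      then show ?case using elim by simp
    qed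
  qed simp
  then have g20: "g2 0 \<noteq> 0" using k by auto
  define \<kappa> where "\<kappa> = g3 0 / g2 0"
  define r where "r = (\<lambda>z. q z - \<kappa> * p z)"
  have er: "\<forall>\<^sub>F z in nhds 0. holo2_at r z"
    using ep eq unfolding r_def by eventually_elim (intro holo2_at_intros)
  obtain a2 b2 where dr: "(r has_derivative (\<lambda>v. a2 * fst v + b2 * snd v)) (at 0)"
    using eventually_nhds_x_imp_x[OF er] unfolding holo2_at_def by blast
  define \<kappa>' where "\<kappa>' = a2 / a1"
  define Q where "Q = (\<lambda>z. r z - \<kappa>' * u z)"
  have eQ: "\<forall>\<^sub>F z in nhds 0. holo2_at Q z"
    using er eu unfolding Q_def by eventually_elim (intro holo2_at_intros)
  have dQ: "(Q has_derivative (\<lambda>v. 0 * fst v + (b2 - \<kappa>' * b1) * snd v)) (at 0)"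
  proof -
    have "(Q has_derivative (\<lambda>v. (a2 * fst v + b2 * snd v) - \<kappa>' * (a1 * fst v + b1 * snd v))) (at 0)"
      unfolding Q_def by (intro has_derivative_diff has_derivative_mult_right dr du)
    then show ?thesis using a1 by (simp add: \<kappa>'_def algebra_simps)
  qed
  have "\<forall>\<^sub>F z in nhds 0. norm (Q z) \<le> \<eta> * (norm (u z) + norm (snd z) ^ n)" if eta: "\<eta> > 0" for \<eta>
  proof -
    define e where "e = \<eta> * norm a1 / 2"
    have e: "e > 0" using eta a1 by (simp add: e_def)
    obtain t1 where t1: "t1 > 0" "\<And>x x' y. norm x < t1 \<Longrightarrow> norm x' < t1 \<Longrightarrow> norm y < t1 \<Longrightarrow>
      norm (Q (x, y) - Q (x', y) - 0 * (x - x')) \<le> e * norm (x - x')"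
      using strict_fst[OF eQ dQ e] by blast
    have c: "isCont \<xi> 0" "isCont (\<lambda>y. g3 y - \<kappa> * g2 y) 0"
      using holomorphic_on_imp_continuous_on[OF xih] tr c2 c3
      by (auto simp: continuous_on_eq_continuous_at)
    have "\<forall>\<^sub>F y in nhds 0. dist (\<xi> y) (\<xi> 0) < t1"
      by (rule isCont_eventually_dist[OF c(1) t1(1)])
    moreover have "\<forall>\<^sub>F y in nhds 0. dist (g3 y - \<kappa> * g2 y) (g3 0 - \<kappa> * g2 0) < \<eta>"
      by (rule isCont_eventually_dist[OF c(2) eta])
    ultimately have "\<forall>\<^sub>F y in nhds 0. norm (\<xi> y) < t1 \<and> norm (g3 y - \<kappa> * g2 y) < \<eta>"
      by eventually_elim (use g20 in \<open>simp add: xi0 \<kappa>_def dist_norm\<close>)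
    then obtain t2 where t2: "t2 > 0" "\<And>y. norm y < t2 \<Longrightarrow> norm (\<xi> y) < t1 \<and> norm (g3 y - \<kappa> * g2 y) < \<eta>"
      unfolding eventually_nhds_metric by (auto simp: dist_norm)
    define t where "t = min (min t1 t2) (min \<tau> \<rho>)"
    have "norm (Q (x, y)) \<le> \<eta> * (norm (u (x, y)) + norm y ^ n)" if x: "norm x < t" and y: "norm y < t" for x y
    proof -
      have yr: "norm y < \<rho>" and xt: "norm x < \<tau>" using x y by (auto simp: t_def)
      have "Q (\<xi> y, y) = y^n * (g3 y - \<kappa> * g2 y)"
        using g2(2)[OF yr] g3(2)[OF yr] xi(2)[OF yr] by (simp add: Q_def r_def algebra_simps)
      then have 1: "norm (Q (\<xi> y, y)) \<le> norm y ^ n * \<eta>"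
        using t2(2)[of y] y by (simp add: norm_mult norm_power t_def mult_left_mono)
      have "norm (Q (x, y) - Q (\<xi> y, y)) \<le> e * norm (x - \<xi> y)"
        using t1(2)[of x "\<xi> y" y] t2(2)[of y] x y by (simp add: t_def)
      also have "\<dots> = \<eta> * (norm a1 / 2 * norm (x - \<xi> y))" by (simp add: e_def)
      also have "\<dots> \<le> \<eta> * norm (u (x, y))"
        using low[OF xt xi(1)[OF yr] yr] xi(2)[OF yr] eta by (intro mult_left_mono) auto
      finally show ?thesis using 1 norm_triangle_sub[of "Q (x, y)" "Q (\<xi> y, y)"]
        by (simp add: algebra_simps)
    qed
    moreover have "t > 0" using t1 t2 tr by (simp add: t_def)
    ultimately show ?thesis unfolding nhds0_box by (intro exI[of _ t]) auto
  qed
  then show ?thesis using dQ unfolding Q_def r_def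
    by (intro exI[of _ \<kappa>] exI[of _ \<kappa>'] exI[of _ "b2 - \<kappa>' * b1"]) auto
qed

text \<open>
  A direction \<open>v\<close> is generic if it is not in the tangent cone \<open>L = 0\<close>. The forms \<open>\<alpha>\<close> and \<open>\<beta>\<close>, which vanish on
  \<open>v\<close>, differ from the first two coordinates by multiples of \<open>L\<close>. As \<open>L\<close> is small compared to \<open>u\<close> and
  \<open>y ^ n\<close>, the equation \<open>\<alpha> (h z) = 0\<close> forces \<open>u\<close> to be small compared to \<open>y ^ n\<close>, and there \<open>\<beta> (h z)\<close> has order
  exactly \<open>n\<close>. So \<open>(A, B)\<close>, the composition of \<open>(\<alpha>, \<beta>)\<close> with \<open>h\<close>, is a branched cover of degree \<open>n\<close>, and
  the points of the image on the line through \<open>w\<close> in direction \<open>v\<close> are the images of one of its fibres.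
\<close>

lemma holo2_image_multiplicity:
  fixes h :: "complex \<times> complex \<Rightarrow> complex^3"
  assumes holo: "\<And>i. \<forall>\<^sub>F z in nhds 0. holo2_at (\<lambda>z. h z $ i) z" and h0: "h 0 = 0"
    and idx: "i1 \<noteq> i2" "i1 \<noteq> i3" "i2 \<noteq> i3" "\<And>i::3. i = i1 \<or> i = i2 \<or> i = i3"
    and k: "k > 0" and K: "K \<ge> 0" and n: "n > 0"
    and x1: "\<forall>\<^sub>F z in nhds 0. snd z = 0 \<longrightarrow> k * norm (fst z) \<le> norm (h z $ i1)"
    and lo: "\<forall>\<^sub>F z in nhds 0. k * norm (snd z) ^ n \<le> norm (h z $ i2) + K * norm (h z $ i1)"
    and up2: "\<forall>\<^sub>F z in nhds 0. norm (h z $ i2) \<le> K * (norm (h z $ i1) + norm (snd z) ^ n)"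
    and up3: "\<forall>\<^sub>F z in nhds 0. norm (h z $ i3) \<le> K * (norm (h z $ i1) + norm (snd z) ^ n)"
    and D: "open O0" "0 \<in> O0" "interior (self_intersecting h O0) = {}"
  shows "\<forall>\<^sub>F r in at_right 0. has_multiplicity (h ` ball 0 r) n"
proof -
  define u where "u = (\<lambda>z. h z $ i1)"
  define p where "p = (\<lambda>z. h z $ i2)"
  define q where "q = (\<lambda>z. h z $ i3)"
  have u0: "u 0 = 0" "p 0 = 0" "q 0 = 0" using h0 by (simp_all add: u_def p_def q_def)
  have eu: "\<forall>\<^sub>F z in nhds 0. holo2_at u z" and ep: "\<forall>\<^sub>F z in nhds 0. holo2_at p z"
    and eq: "\<forall>\<^sub>F z in nhds 0. holo2_at q z" using holo by (simp_all add: u_def p_def q_def)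
  obtain a1 b1 where du: "(u has_derivative (\<lambda>v. a1 * fst v + b1 * snd v)) (at 0)"
    using eventually_nhds_x_imp_x[OF eu] unfolding holo2_at_def by blast
  have a1: "a1 \<noteq> 0"
    by (rule fst_derivative_nonzero[OF eu u0(1) du k]) (use x1 in \<open>simp add: u_def\<close>)
  obtain \<kappa> \<kappa>' q' where
    dQ: "((\<lambda>z. q z - \<kappa> * p z - \<kappa>' * u z) has_derivative (\<lambda>v. q' * snd v)) (at 0)" and
    Qs: "\<And>\<eta>. \<eta> > 0 \<Longrightarrow> \<forall>\<^sub>F z in nhds 0. norm (q z - \<kappa> * p z - \<kappa>' * u z) \<le> \<eta> * (norm (u z) + norm (snd z) ^ n)"
    using tangent_cone_form[OF eu ep eq u0(1) du a1 k] lo up2 up3 unfolding u_def p_def q_def by blast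
  define L where "L = (\<lambda>w::complex^3. w $ i3 - \<kappa> * w $ i2 - \<kappa>' * w $ i1)"
  define Q where "Q = (\<lambda>z. L (h z))"
  have Qeq: "Q = (\<lambda>z. q z - \<kappa> * p z - \<kappa>' * u z)" by (simp add: Q_def L_def p_def q_def u_def)
  have dQ: "(Q has_derivative (\<lambda>v. q' * snd v)) (at 0)" using dQ by (simp add: Qeq)
  have Qs: "\<forall>\<^sub>F z in nhds 0. norm (Q z) \<le> \<eta> * (norm (u z) + norm (snd z) ^ n)" if "\<eta> > 0" for \<eta>
    using Qs[OF that] by (simp add: Qeq)
  have eQ: "\<forall>\<^sub>F z in nhds 0. holo2_at Q z"
    using ep eq eu unfolding Qeq by eventually_elim (intro holo2_at_intros)
  have contL: "continuous_on UNIV L" unfolding L_def by (intro continuous_intros)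
  define V where "V = {v. L v \<noteq> 0}"
  have Vopen: "open V" unfolding V_def
    by (intro open_Collect_neq continuous_intros contL)
  have Vdense: "closure V = UNIV"
  proof (rule UNIV_eq_I[symmetric])
    fix v :: "complex^3"
    show "v \<in> closure V" unfolding closure_approachable
    proof (intro allI impI)
      fix e :: real assume e: "e > 0"
      show "\<exists>w\<in>V. dist w v < e"
      proof (cases "L v = 0")
        case False then show ?thesis using e by (intro bexI[of _ v]) (auto simp: V_def)
      next
        case True
        define w where "w = v + axis i3 (of_real (e/2))"
        have "L w = of_real (e/2)" using True idx by (simp add: w_def L_def axis_def algebra_simps)
        then have "w \<in> V" using e by (auto simp: V_def)
        moreover have "norm (axis i3 (of_real (e/2)) :: complex^3) = e/2"
          using e by (simp add: norm_vec_def L2_set_def axis_def if_distrib if_distribR sum.delta cong: if_cong)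
        then have "dist w v < e" using e by (simp add: w_def dist_norm)
        ultimately show ?thesis by blast
      qed
    qed
  qed
  have V0: "0 \<notin> V" by (simp add: V_def L_def)
  \<comment> \<open>radii \<open>r\<close> for which 0 is the only zero of \<open>h\<close> in the closed ball\<close>
  have "\<forall>\<^sub>F z in nhds 0. h z = 0 \<longrightarrow> z = 0"
    using lo x1
  proof eventually_elim
    case (elim z)
    show ?case
    proof
      assume "h z = 0"
      then have hz: "h z $ i = 0" for i by simp
      have "k * norm (snd z) ^ n \<le> 0" using elim(1) hz by simp
      then have "snd z = 0" using k by (rule mult_norm_power_le_0D)
      moreover from this have "k * norm (fst z) \<le> 0" using elim(2) hz by simp
      then have "fst z = 0" using k by (simp add: mult_le_0_iff)
      ultimately show "z = 0" by (simp add: prod_eq_iff)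
    qed
  qed
  moreover have "\<forall>\<^sub>F z in nhds 0. \<forall>i. holo2_at (\<lambda>z. h z $ i) z"
    using holo by (simp add: eventually_all_finite)
  moreover have "\<forall>\<^sub>F z in nhds 0. z \<in> O0" using D by (simp add: eventually_nhds_in_open)
  ultimately have "\<forall>\<^sub>F z in nhds 0. (h z = 0 \<longrightarrow> z = 0) \<and> (\<forall>i. holo2_at (\<lambda>z. h z $ i) z) \<and> z \<in> O0"
    by (simp add: eventually_conj_iff)
  then obtain r0 where r0: "r0 > 0"
    "\<And>z. norm z < r0 \<Longrightarrow> (h z = 0 \<longrightarrow> z = 0) \<and> (\<forall>i. holo2_at (\<lambda>z. h z $ i) z) \<and> z \<in> O0"
    unfolding eventually_nhds_metric by (auto simp: dist_norm)
  have conth: "continuous_on (ball 0 r0) h"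
  proof -
    have "isCont h z" if "norm z < r0" for z
      unfolding isCont_def
    proof (rule vec_tendstoI)
      fix i
      have "isCont (\<lambda>z. h z $ i) z" using r0(2)[OF that] by (intro holo2_at_isCont) blast
      then show "(\<lambda>z. h z $ i) \<midarrow>z\<rightarrow> h z $ i" by (simp add: isCont_def)
    qed
    then show ?thesis by (intro continuous_at_imp_continuous_on) auto
  qed
  have "has_multiplicity (h ` ball 0 r) n" if r: "0 < r" "r < r0" for r
    unfolding has_multiplicity_def
  proof (intro exI[of _ V] conjI ballI Vopen Vdense V0)
    fix v assume "v \<in> V"
    then have Lv: "L v \<noteq> 0" by (simp add: V_def)
    define k1 where "k1 = v $ i1 / L v"
    define k2 where "k2 = v $ i2 / L v"
    define \<alpha> where "\<alpha> = (\<lambda>w. w $ i1 - k1 * L w)"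
    define \<beta> where "\<beta> = (\<lambda>w. w $ i2 - k2 * L w)"
    define A where "A = (\<lambda>z. \<alpha> (h z))"
    define B where "B = (\<lambda>z. \<beta> (h z))"
    have Aeq: "A = (\<lambda>z. u z - k1 * Q z)" and Beq: "B = (\<lambda>z. p z - k2 * Q z)"
      by (simp_all add: A_def B_def \<alpha>_def \<beta>_def Q_def u_def p_def)
    have evA: "\<forall>\<^sub>F z in nhds 0. holo2_at A z"
      using eQ eu unfolding Aeq by eventually_elim (intro holo2_at_intros)
    have evB: "\<forall>\<^sub>F z in nhds 0. holo2_at B z"
      using eQ ep unfolding Beq by eventually_elim (intro holo2_at_intros)
    have A0: "A 0 = 0" "B 0 = 0" using h0 by (simp_all add: A_def B_def \<alpha>_def \<beta>_def L_def)
    have dA: "(A has_derivative (\<lambda>v. a1 * fst v + (b1 - k1 * q') * snd v)) (at 0)"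
    proof -
      have "(A has_derivative (\<lambda>v. (a1 * fst v + b1 * snd v) - k1 * (q' * snd v))) (at 0)"
        unfolding Aeq by (intro has_derivative_diff has_derivative_mult_right dQ du)
      then show ?thesis by (simp add: algebra_simps)
    qed
    \<comment> \<open>the scale \<open>\<eta>\<close> on which \<open>Q\<close> is small absorbs its contributions to \<open>A\<close> and to \<open>B\<close>\<close>
    define N where "N = 1 + norm k1 + norm k2"
    define M where "M = 1 + k + K"
    define \<eta> where "\<eta> = k / (8 * N * M)"
    have NM: "N \<ge> 1" "M \<ge> 1" "norm k1 \<le> N" "norm k2 \<le> N" "K \<le> M" "k \<le> M" using k K by (auto simp: N_def M_def)
    have eta: "\<eta> > 0" using k NM by (simp add: \<eta>_def)
    have etaN: "N * \<eta> = k / (8 * M)" using NM by (simp add: \<eta>_def)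
    have eN8: "N * \<eta> \<le> 1/8" unfolding etaN using NM k by (simp add: field_simps)
    have eNK: "N * \<eta> * K \<le> k/8"
    proof -
      have "N * \<eta> * K \<le> N * \<eta> * M" using NM eta by (intro mult_left_mono) auto
      also have "\<dots> = k/8" using NM by (simp add: etaN)
      finally show ?thesis .
    qed
    have eNk: "N * \<eta> \<le> k/8" unfolding etaN using NM k by (simp add: field_simps)
    have AB: "\<forall>\<^sub>F z in nhds 0. A z = 0 \<longrightarrow> norm (u z) \<le> norm (snd z) ^ n \<and>
        k/2 * norm (snd z) ^ n \<le> norm (B z) \<and> norm (B z) \<le> (2 * K + 1) * norm (snd z) ^ n"
      using Qs[OF eta] lo up2
    proof eventually_elim
      case (elim z)
      show ?case
      proof
        assume "A z = 0"
        define s where "s = norm (u z)"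
        define y where "y = norm (snd z) ^ n"
        have s0: "s \<ge> 0" "y \<ge> 0" by (simp_all add: s_def y_def)
        have kQ: "norm (k * Q z) \<le> N * \<eta> * (s + y)" if "norm k \<le> N" for k :: complex
        proof -
          have "norm (k * Q z) \<le> N * (\<eta> * (s + y))" unfolding norm_mult
            by (intro mult_mono) (use elim that NM in \<open>auto simp: s_def y_def\<close>)
          then show ?thesis by (simp add: mult.assoc)
        qed
        have "u z = k1 * Q z" using \<open>A z = 0\<close> by (simp add: Aeq)
        then have "s = norm (k1 * Q z)" by (simp add: s_def)
        then have s1: "s \<le> N * \<eta> * (s + y)" using kQ[OF NM(3)] by simp
        also have "\<dots> \<le> 1/8 * (s + y)" using eN8 s0 by (intro mult_right_mono) auto
        finally have sy: "s \<le> y" using s0 by simp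
        have Ne: "N * \<eta> \<ge> 0" using NM eta by simp
        have s2: "s \<le> N * \<eta> * (2 * y)"
          using s1 mult_left_mono[of "s + y" "2 * y" "N * \<eta>"] sy Ne by simp
        have q2: "norm (k2 * Q z) \<le> N * \<eta> * (2 * y)"
          using kQ[OF NM(4)] mult_left_mono[of "s + y" "2 * y" "N * \<eta>"] sy Ne by simp
        have "K * s \<le> K * (N * \<eta> * (2 * y))" using K s2 by (intro mult_left_mono) auto
        also have "\<dots> = (N * \<eta> * K) * (2 * y)" by simp
        also have "\<dots> \<le> k/8 * (2 * y)" using eNK s0 by (intro mult_right_mono) auto
        finally have Ks: "K * s \<le> k/4 * y" by simp
        have q3: "norm (k2 * Q z) \<le> k/4 * y"
          using q2 mult_right_mono[OF eNk, of "2 * y"] s0 by simp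
        have "norm (p z) \<le> norm (B z) + norm (k2 * Q z)"
          using norm_triangle_ineq[of "B z" "k2 * Q z"] by (simp add: Beq)
        then have lower: "k/2 * y \<le> norm (B z)"
          using elim(2) Ks q3 unfolding s_def u_def y_def p_def by simp
        have "norm (B z) \<le> norm (p z) + norm (k2 * Q z)" unfolding Beq by (rule norm_triangle_ineq4)
        also have "\<dots> \<le> K * (s + y) + 1/8 * (2 * y)"
          using elim(3) q2 mult_right_mono[OF eN8, of "2 * y"] s0 unfolding s_def u_def y_def p_def by simp
        also have "\<dots> \<le> K * (2 * y) + y" using mult_left_mono[of "s + y" "2 * y" K] sy K s0 by simp
        finally have "norm (B z) \<le> (2 * K + 1) * y" by (simp add: algebra_simps)
        then show "norm (u z) \<le> norm (snd z) ^ n \<and> k/2 * norm (snd z) ^ n \<le> norm (B z) \<and> norm (B z) \<le> (2 * K + 1) * norm (snd z) ^ n"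
          using lower sy by (simp add: s_def y_def)
      qed
    qed
    have "\<forall>\<^sub>F z in nhds 0. A z = 0 \<and> B z = 0 \<longrightarrow> z = 0"
      using AB x1
    proof eventually_elim
      case (elim z)
      show ?case
      proof
        assume z: "A z = 0 \<and> B z = 0"
        then have "k/2 * norm (snd z) ^ n \<le> 0" using elim(1) by simp
        then have y: "snd z = 0" by (rule mult_norm_power_le_0D) (use k in simp)
        then have "k * norm (fst z) \<le> 0" using elim z n by (simp add: u_def power_0_left)
        then have "fst z = 0" using k by (simp add: mult_le_0_iff)
        then show "z = 0" using y by (simp add: prod_eq_iff)
      qed
    qed
    then obtain rv where rv: "rv > 0" "\<And>z. norm z < rv \<Longrightarrow> A z = 0 \<Longrightarrow> B z = 0 \<Longrightarrow> z = 0"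
      unfolding eventually_nhds_metric by (auto simp: dist_norm)
    have ch: "continuous_on (cball 0 r) h" by (rule continuous_on_subset[OF conth]) (use r in auto)
    \<comment> \<open>below \<open>\<epsilon>v\<close>, the points of \<open>ball 0 r\<close> with image in \<open>ball 0 \<epsilon>\<close> lie where \<open>(A, B)\<close> vanishes at 0 only\<close>
    obtain \<epsilon>v where ev: "\<epsilon>v > 0" "\<And>z. norm z \<le> r \<Longrightarrow> norm (h z) < \<epsilon>v \<Longrightarrow> norm z < rv"
    proof (cases "cball 0 r - ball 0 rv = ({}::(complex\<times>complex) set)")
      case True
      then have "norm z < rv" if "norm z \<le> r" for z :: "complex \<times> complex" using that by auto
      then show ?thesis using that[of 1] by auto
    next
      case False
      have "compact (cball 0 r - ball 0 rv :: (complex\<times>complex) set)" by (intro compact_diff) auto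
      moreover have "continuous_on (cball 0 r - ball 0 rv) (\<lambda>z. norm (h z))"
        by (intro continuous_on_norm continuous_on_subset[OF ch]) auto
      ultimately obtain z0 where z0: "z0 \<in> cball 0 r - ball 0 rv" "\<And>z. z \<in> cball 0 r - ball 0 rv \<Longrightarrow> norm (h z0) \<le> norm (h z)"
        using continuous_attains_inf[OF _ False] by blast
      have "h z0 \<noteq> 0" using r0(2)[of z0] z0(1) r rv by auto
      then show ?thesis using that[of "norm (h z0)"] z0(2) by (force simp: not_less)
    qed
    show "\<forall>\<^sub>F \<epsilon> in at_right 0. \<exists>\<delta>>0. \<exists>W. open W \<and> ball 0 \<delta> \<subseteq> closure W \<and>
       (\<forall>w\<in>W \<inter> ball 0 \<delta>. 0 \<notin> cline w v \<longrightarrow> finite (h ` ball 0 r \<inter> cline w v \<inter> ball 0 \<epsilon>) \<and>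
          card (h ` ball 0 r \<inter> cline w v \<inter> ball 0 \<epsilon>) = n)"
      unfolding eventually_at_right_field
    proof (rule exI[of _ \<epsilon>v], intro conjI allI impI)
      fix \<epsilon> :: real assume eps: "0 < \<epsilon>" "\<epsilon> < \<epsilon>v"
      have evP: "\<forall>\<^sub>F z in nhds 0. norm z < r \<and> norm (h z) < \<epsilon>"
      proof (rule eventually_conj)
        show "\<forall>\<^sub>F z in nhds 0. norm (z::complex\<times>complex) < r"
          unfolding eventually_nhds_metric using r by (auto simp: dist_norm)
        have "isCont h 0" using conth r0(1) by (simp add: continuous_on_eq_continuous_at)
        then have "\<forall>\<^sub>F z in nhds 0. dist (h z) (h 0) < \<epsilon>"
          using eps(1) by (rule isCont_eventually_dist)
        then show "\<forall>\<^sub>F z in nhds 0. norm (h z) < \<epsilon>" using h0 by simp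
      qed
      have AB': "\<forall>\<^sub>F z in nhds 0. A z = 0 \<longrightarrow> k/2 * norm (snd z) ^ n \<le> norm (B z) \<and> norm (B z) \<le> (2 * K + 1) * norm (snd z) ^ n"
        using AB by eventually_elim blast
      have k2: "k/2 > 0" using k by simp
      obtain U \<delta>1 where bc: "branched_cover A B U \<delta>1 n" and UP: "\<And>z. z \<in> U \<Longrightarrow> norm z < r \<and> norm (h z) < \<epsilon>"
        using branched_cover_exists[OF evA evB A0(1) dA a1 k2 AB' evP] by blast
      have U: "open U" "0 \<in> U" "\<delta>1 > 0" using bc by (auto simp: branched_cover_def)
      have Ur0: "U \<subseteq> ball 0 r0" using UP r by force
      have cont\<alpha>: "continuous_on S \<alpha>" "continuous_on S \<beta>" for S
        unfolding \<alpha>_def \<beta>_def L_def by (intro continuous_intros)+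
      have cA: "continuous_on S A" "continuous_on S B" if "continuous_on S h" for S
        unfolding A_def B_def
        using continuous_on_compose2[OF cont\<alpha>(1)[of UNIV] that] continuous_on_compose2[OF cont\<alpha>(2)[of UNIV] that] by auto
      \<comment> \<open>\<open>(A, B)\<close> is bounded away from 0 on the compact set \<open>C\<close>, so small values are taken in \<open>U\<close> only\<close>
      define C where "C = {z \<in> cball 0 r. norm (h z) \<le> \<epsilon>} - U"
      have "compact C"
      proof -
        have "closed (cball 0 r \<inter> (\<lambda>z. norm (h z)) -` {..\<epsilon>})"
          by (intro continuous_closed_preimage continuous_on_norm ch) auto
        moreover have "{z \<in> cball 0 r. norm (h z) \<le> \<epsilon>} = cball 0 r \<inter> (cball 0 r \<inter> (\<lambda>z. norm (h z)) -` {..\<epsilon>})" by auto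
        ultimately show ?thesis unfolding C_def using U(1)
          by (metis compact_Int_closed compact_cball compact_diff)
      qed
      have ABne: "norm (A z) + norm (B z) > 0" if "z \<in> C" for z
      proof (rule ccontr)
        assume "\<not> norm (A z) + norm (B z) > 0"
        then have "A z = 0" "B z = 0" using norm_ge_zero[of "A z"] norm_ge_zero[of "B z"]
          by (smt (verit) norm_le_zero_iff)+
        moreover have "norm z < rv" using that ev(2)[of z] eps by (auto simp: C_def)
        ultimately have "z = 0" using rv(2) by blast
        then show False using that U by (simp add: C_def)
      qed
      obtain \<mu> where mu: "\<mu> > 0" "\<And>z. z \<in> C \<Longrightarrow> \<mu> \<le> norm (A z) + norm (B z)"
      proof (cases "C = {}")
        case True then show ?thesis using that[of 1] by auto
      next
        case False
        have cC: "continuous_on C h" by (rule continuous_on_subset[OF ch]) (auto simp: C_def)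
        have "continuous_on C (\<lambda>z. norm (A z) + norm (B z))" by (intro continuous_intros cA cC)
        then obtain z0 where "z0 \<in> C" "\<And>z. z \<in> C \<Longrightarrow> norm (A z0) + norm (B z0) \<le> norm (A z) + norm (B z)"
          using continuous_attains_inf[OF \<open>compact C\<close> False] by blast
        then show ?thesis using that ABne by blast
      qed
      define \<delta>2 where "\<delta>2 = min \<delta>1 (\<mu>/2)"
      have d2: "\<delta>2 > 0" "\<delta>2 \<le> \<delta>1" using U(3) mu(1) by (auto simp: \<delta>2_def)
      have fib: "{z \<in> ball 0 r. norm (h z) < \<epsilon> \<and> A z = c \<and> B z = e} = fibre A B U c e"
        if "norm c < \<delta>2" "norm e < \<delta>2" for c e
      proof -
        have "z \<in> U" if "z \<in> ball 0 r" "norm (h z) < \<epsilon>" "A z = c" "B z = e" for z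
        proof (rule ccontr)
          assume "z \<notin> U"
          then have "z \<in> C" using that by (auto simp: C_def)
          from mu(2)[OF this] show False using that \<open>norm c < \<delta>2\<close> \<open>norm e < \<delta>2\<close> by (simp add: \<delta>2_def)
        qed
        then show ?thesis using UP by (auto simp: fibre_def)
      qed
      have hU: "continuous_on U h" by (rule continuous_on_subset[OF conth Ur0])
      have DU: "interior {z \<in> U. \<exists>z'\<in>U. z' \<noteq> z \<and> h z' = h z} = {}"
      proof -
        have "{z \<in> U. \<exists>z'\<in>U. z' \<noteq> z \<and> h z' = h z} \<subseteq> self_intersecting h O0"
          using r0(2) Ur0 by (force simp: self_intersecting_def)
        then show ?thesis using interior_mono D(3) by blast
      qed
      define G where "G = generic_values A B U \<delta>1 n h"
      have Gopen: "open G" unfolding G_def by (rule generic_values_open[OF bc hU])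
      define W where "W = {w. norm (\<alpha> w) < \<delta>2 \<and> norm (\<beta> w) < \<delta>2 \<and> (\<alpha> w, \<beta> w) \<in> G}"
      have Wopen: "open W"
      proof -
        have "open ((\<lambda>w. (\<alpha> w, \<beta> w)) -` G)"
          by (rule open_vimage[OF Gopen]) (intro continuous_on_Pair cont\<alpha>)
        moreover have "open {w. norm (\<alpha> w) < \<delta>2}" "open {w. norm (\<beta> w) < \<delta>2}"
          by (intro open_Collect_less continuous_on_norm cont\<alpha> continuous_on_const)+
        moreover have "W = {w. norm (\<alpha> w) < \<delta>2} \<inter> {w. norm (\<beta> w) < \<delta>2} \<inter> ((\<lambda>w. (\<alpha> w, \<beta> w)) -` G)"
          by (auto simp: W_def)
        ultimately show ?thesis by auto
      qed
      obtain \<delta> where d: "\<delta> > 0" "\<And>w. norm w < \<delta> \<Longrightarrow> norm (\<alpha> w) < \<delta>2 \<and> norm (\<beta> w) < \<delta>2"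
      proof -
        have "open ({w. norm (\<alpha> w) < \<delta>2} \<inter> {w. norm (\<beta> w) < \<delta>2})"
          by (intro open_Int open_Collect_less continuous_on_norm cont\<alpha> continuous_on_const)
        moreover have "0 \<in> {w. norm (\<alpha> w) < \<delta>2} \<inter> {w. norm (\<beta> w) < \<delta>2}"
          using d2 by (simp add: \<alpha>_def \<beta>_def L_def)
        ultimately obtain \<delta> where "\<delta> > 0" "ball 0 \<delta> \<subseteq> {w. norm (\<alpha> w) < \<delta>2} \<inter> {w. norm (\<beta> w) < \<delta>2}"
          by (meson open_contains_ball)
        then show ?thesis using that[of \<delta>] by (auto simp: subset_iff)
      qed
      have Wdense: "ball 0 \<delta> \<subseteq> closure W"
      proof
        fix w :: "complex^3" assume "w \<in> ball 0 \<delta>"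
        then have w: "norm (\<alpha> w) < \<delta>2" "norm (\<beta> w) < \<delta>2" using d(2) by auto
        \<comment> \<open>moving along \<open>e1\<close> and \<open>e2\<close> changes \<open>\<alpha>\<close> and \<open>\<beta>\<close> independently\<close>
        define e1 where "e1 = axis i1 1 + axis i3 \<kappa>'"
        define e2 where "e2 = axis i2 1 + axis i3 \<kappa>"
        have Le: "L e1 = 0" "L e2 = 0" "e1 $ i1 = 1" "e1 $ i2 = 0" "e2 $ i1 = 0" "e2 $ i2 = 1"
          using idx by (auto simp: e1_def e2_def L_def axis_def)
        show "w \<in> closure W" unfolding closure_approachable
        proof (intro allI impI)
          fix e :: real assume e: "e > 0"
          define m where "m = 1 + norm e1 + norm e2"
          have m: "m \<ge> 1" "norm e1 \<le> m" "norm e2 \<le> m" by (auto simp: m_def)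
          define \<eta>' where "\<eta>' = min (e / (2 * m)) (min (\<delta>2 - norm (\<alpha> w)) (\<delta>2 - norm (\<beta> w)))"
          have et: "\<eta>' > 0" using e m w by (auto simp: \<eta>'_def)
          obtain g where g: "g \<in> G" "norm (fst g - \<alpha> w) < \<eta>'" "norm (snd g - \<beta> w) < \<eta>'"
          proof -
            have "norm (\<alpha> w) < \<delta>1" "norm (\<beta> w) < \<delta>1" using w d2 by linarith+
            from generic_values_dense[OF bc hU DU cA(1)[OF hU] cA(2)[OF hU] this et] show ?thesis
              using that unfolding G_def by blast
          qed
          define w' where "w' = w + (fst g - \<alpha> w) *s e1 + (snd g - \<beta> w) *s e2"
          have lin: "L (x + s *s y) = L x + s * L y" for x y s by (simp add: L_def algebra_simps)
          have "L w' = L w" unfolding w'_def lin Le by simp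
          then have ab: "\<alpha> w' = fst g" "\<beta> w' = snd g"
            unfolding \<alpha>_def \<beta>_def by (simp_all add: w'_def Le \<alpha>_def \<beta>_def)
          have "norm (fst g) < \<delta>2" "norm (snd g) < \<delta>2"
            using g norm_triangle_sub[of "fst g" "\<alpha> w"] norm_triangle_sub[of "snd g" "\<beta> w"] by (auto simp: \<eta>'_def)
          then have "w' \<in> W" using g(1) by (simp add: W_def ab)
          have nsm: "norm (s *s x) = norm s * norm x" for s and x :: "complex^3"
            by (simp add: norm_vec_def norm_mult L2_set_right_distrib vector_scalar_mult_def)
          have "dist w' w \<le> norm (fst g - \<alpha> w) * norm e1 + norm (snd g - \<beta> w) * norm e2"
          proof -
            have "w' - w = (fst g - \<alpha> w) *s e1 + (snd g - \<beta> w) *s e2" by (simp add: w'_def)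
            then show ?thesis unfolding dist_norm nsm[symmetric] by (simp only: norm_triangle_ineq)
          qed
          also have "\<dots> < \<eta>' * m + \<eta>' * m"
          proof -
            have "norm (fst g - \<alpha> w) * norm e1 \<le> norm (fst g - \<alpha> w) * m" by (intro mult_left_mono m) auto
            also have "\<dots> < \<eta>' * m" using g m by (intro mult_strict_right_mono) auto
            moreover have "norm (snd g - \<beta> w) * norm e2 \<le> norm (snd g - \<beta> w) * m" by (intro mult_left_mono m) auto
            moreover have "norm (snd g - \<beta> w) * m < \<eta>' * m" using g m by (intro mult_strict_right_mono) auto
            ultimately show ?thesis by linarith
          qed
          also have "\<dots> \<le> e"
          proof -
            have "\<eta>' \<le> e / (2 * m)" by (simp add: \<eta>'_def)
            then have "\<eta>' * (2 * m) \<le> e" using m by (simp add: pos_le_divide_eq)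
            then show ?thesis by simp
          qed
          finally show "\<exists>y\<in>W. dist y w < e" using \<open>w' \<in> W\<close> by blast
        qed
      qed
      have cl: "w' \<in> cline w v \<longleftrightarrow> \<alpha> w' = \<alpha> w \<and> \<beta> w' = \<beta> w" for w w'
      proof
        assume "w' \<in> cline w v"
        then obtain s where "w' = w + s *s v" by (auto simp: cline_def)
        then show "\<alpha> w' = \<alpha> w \<and> \<beta> w' = \<beta> w" using Lv
          by (simp add: \<alpha>_def \<beta>_def k1_def k2_def L_def field_simps)
      next
        assume ab: "\<alpha> w' = \<alpha> w \<and> \<beta> w' = \<beta> w"
        define s where "s = (L w' - L w) / L v"
        have 1: "w' $ i1 = w $ i1 + s * v $ i1" "w' $ i2 = w $ i2 + s * v $ i2"
          using ab Lv by (simp_all add: \<alpha>_def \<beta>_def k1_def k2_def s_def field_simps)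
        have "L w' = L w + s * L v" using Lv by (simp add: s_def)
        then have 3: "w' $ i3 = w $ i3 + s * v $ i3" using 1 unfolding L_def by (simp add: algebra_simps)
        have "w' = w + s *s v" unfolding vec_eq_iff
        proof
          fix i show "w' $ i = (w + s *s v) $ i" using idx(4)[of i] 1 3 by auto
        qed
        then show "w' \<in> cline w v" by (auto simp: cline_def)
      qed
      show "\<exists>\<delta>>0. \<exists>W. open W \<and> ball 0 \<delta> \<subseteq> closure W \<and>
       (\<forall>w\<in>W \<inter> ball 0 \<delta>. 0 \<notin> cline w v \<longrightarrow> finite (h ` ball 0 r \<inter> cline w v \<inter> ball 0 \<epsilon>) \<and>
          card (h ` ball 0 r \<inter> cline w v \<inter> ball 0 \<epsilon>) = n)"
      proof (intro exI[of _ \<delta>] exI[of _ W] conjI ballI impI d(1) Wopen Wdense)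
        fix w assume w: "w \<in> W \<inter> ball 0 \<delta>"
        have "h ` ball 0 r \<inter> cline w v \<inter> ball 0 \<epsilon> = h ` {z \<in> ball 0 r. norm (h z) < \<epsilon> \<and> A z = \<alpha> w \<and> B z = \<beta> w}"
          by (auto simp: cl A_def B_def)
        also have "\<dots> = h ` fibre A B U (\<alpha> w) (\<beta> w)" using w by (subst fib) (auto simp: W_def)
        finally have eqf: "h ` ball 0 r \<inter> cline w v \<inter> ball 0 \<epsilon> = h ` fibre A B U (\<alpha> w) (\<beta> w)" .
        have ww: "norm (\<alpha> w) < \<delta>1" "norm (\<beta> w) < \<delta>1" "(\<alpha> w, \<beta> w) \<in> G" using w d2 by (auto simp: W_def)
        then have "finite (fibre A B U (\<alpha> w) (\<beta> w))" using bc by (simp add: branched_cover_def)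
        then show "finite (h ` ball 0 r \<inter> cline w v \<inter> ball 0 \<epsilon>)" unfolding eqf by simp
        show "card (h ` ball 0 r \<inter> cline w v \<inter> ball 0 \<epsilon>) = n" unfolding eqf using ww(3) by (simp add: G_def generic_values_def)
      qed
    qed (rule ev(1))
  qed
  then show ?thesis unfolding eventually_at_right_field using r0(1) by blast
qed

section \<open>Polynomials in two variables\<close>

text \<open>
  The outer variable of the polynomial is \<open>y\<close>, so that degree and leading coefficient refer to \<open>y\<close>.
\<close>

definition ev :: "complex poly poly \<Rightarrow> complex \<times> complex \<Rightarrow> complex" where
  "ev Q z = poly (poly Q [:snd z:]) (fst z)"

lemma ev_simps [simp]:
  "ev 0 z = 0" "ev 1 z = 1" "ev (Q + Q') z = ev Q z + ev Q' z" "ev (Q - Q') z = ev Q z - ev Q' z"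
  "ev (- Q) z = - ev Q z" "ev (Q * Q') z = ev Q z * ev Q' z" "ev (Q ^ n) z = ev Q z ^ n"
  by (simp_all add: ev_def)

lemma ev_sum [simp]: "ev (\<Sum>i\<in>I. Q i) z = (\<Sum>i\<in>I. ev (Q i) z)"
  by (simp add: ev_def poly_sum)

lemma ev_const [simp]: "ev [:[:c:]:] z = c" and ev_X [simp]: "ev [:[:0, 1:]:] z = fst z"
  and ev_Y [simp]: "ev [:0, 1:] z = snd z"
  by (simp_all add: ev_def)

lemma ev_expand: "ev Q z = (\<Sum>b\<le>degree Q. poly (coeff Q b) (fst z) * snd z ^ b)"
proof -
  have "[:c:] ^ n = [:c ^ n:]" for c :: complex and n by (induction n) auto
  then show ?thesis by (simp add: ev_def poly_altdef[of Q] poly_sum mult.commute)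
qed

lemma ev_expand':
  assumes "degree Q \<le> N"
  shows "ev Q z = (\<Sum>b\<le>N. poly (coeff Q b) (fst z) * snd z ^ b)"
  unfolding ev_expand
  by (rule sum.mono_neutral_left) (use assms in \<open>auto simp: coeff_eq_0\<close>)

lemma ev_expand2: "ev Q z = (\<Sum>b\<le>degree Q. \<Sum>a\<le>degree (coeff Q b). coeff (coeff Q b) a * fst z ^ a * snd z ^ b)"
  by (simp add: ev_expand poly_altdef sum_distrib_right)

definition polyfun2 :: "(complex \<times> complex \<Rightarrow> complex) \<Rightarrow> bool" where
  "polyfun2 h \<longleftrightarrow> (\<exists>Q. h = ev Q)"

lemma polyfun2_ev [intro]: "polyfun2 (ev Q)" by (auto simp: polyfun2_def)
lemma polyfun2_fst: "polyfun2 fst" unfolding polyfun2_def by (rule exI[of _ "[:[:0, 1:]:]"]) auto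
lemma polyfun2_snd: "polyfun2 snd" unfolding polyfun2_def by (rule exI[of _ "[:0, 1:]"]) auto
lemma polyfun2_const: "polyfun2 (\<lambda>_. c)" unfolding polyfun2_def by (rule exI[of _ "[:[:c:]:]"]) auto
lemma polyfun2_add: assumes "polyfun2 f" "polyfun2 g" shows "polyfun2 (\<lambda>z. f z + g z)"
proof -
  obtain Q Q' where "f = ev Q" "g = ev Q'" using assms by (auto simp: polyfun2_def)
  then show ?thesis unfolding polyfun2_def by (intro exI[of _ "Q + Q'"]) auto
qed
lemma polyfun2_mult: assumes "polyfun2 f" "polyfun2 g" shows "polyfun2 (\<lambda>z. f z * g z)"
proof -
  obtain Q Q' where "f = ev Q" "g = ev Q'" using assms by (auto simp: polyfun2_def)
  then show ?thesis unfolding polyfun2_def by (intro exI[of _ "Q * Q'"]) auto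
qed
lemma polyfun2_power: "polyfun2 f \<Longrightarrow> polyfun2 (\<lambda>z. f z ^ n)"
  by (induction n) (auto intro: polyfun2_const polyfun2_mult)
lemma polyfun2_sum: "(\<And>i. i \<in> I \<Longrightarrow> polyfun2 (f i)) \<Longrightarrow> polyfun2 (\<lambda>z. \<Sum>i\<in>I. f i z)"
  by (induction I rule: infinite_finite_induct) (auto intro: polyfun2_const polyfun2_add)
lemma polyfun2_diff: "polyfun2 f \<Longrightarrow> polyfun2 g \<Longrightarrow> polyfun2 (\<lambda>z. f z - g z)"
  using polyfun2_add[of f "\<lambda>z. (-1) * g z"] polyfun2_mult[OF polyfun2_const[of "-1"], of g] by simp

lemmas polyfun2_intros = polyfun2_fst polyfun2_snd polyfun2_const polyfun2_add polyfun2_mult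
  polyfun2_power polyfun2_sum polyfun2_diff

lemma polyfun2_compose:
  assumes "polyfun2 f" "polyfun2 g1" "polyfun2 g2"
  shows "polyfun2 (\<lambda>z. f (g1 z, g2 z))"
proof -
  obtain Q where "f = ev Q" using assms(1) by (auto simp: polyfun2_def)
  then show ?thesis using assms(2,3) by (simp add: ev_expand2) (intro polyfun2_intros)
qed

lemma polyfun2_holo: "polyfun2 f \<Longrightarrow> holo2_at f z"
  by (auto simp: polyfun2_def ev_expand2[abs_def] intro!: holo2_at_intros)

lemma polynomial_sum_zero_coeffs:
  fixes c :: "nat \<Rightarrow> complex"
  assumes "\<And>y. (\<Sum>b\<le>N. c b * y ^ b) = 0" "b \<le> N" shows "c b = 0"
  using polyfun_eq_0[of c N] assms by blast

text \<open>
  Compare coefficients for \<open>s = 2\<close>: the powers of 2 determine the exponents.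
\<close>

lemma weighted_homogeneous_coeff:
  assumes hom: "\<And>s x y. ev Q (s^w1 * x, s^w2 * y) = s^d * ev Q (x, y)"
    and nz: "coeff (coeff Q b) a \<noteq> 0"
  shows "w1 * a + w2 * b = d"
proof -
  have b: "b \<le> degree Q" using nz by (intro le_degree) auto
  have a: "a \<le> degree (coeff Q b)" using nz by (intro le_degree) auto
  have 1: "poly (coeff Q b) (2^w1 * x) * 2^(w2*b) - 2^d * poly (coeff Q b) x = 0" for x
  proof (rule polynomial_sum_zero_coeffs[where N="degree Q" and c="\<lambda>b. poly (coeff Q b) (2^w1 * x) * 2^(w2*b) - 2^d * poly (coeff Q b) x"])
    fix y :: complex
    have "ev Q (2^w1 * x, 2^w2 * y) - 2^d * ev Q (x, y) = 0" using hom[of 2 x y] by simp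
    then show "(\<Sum>b\<le>degree Q. (poly (coeff Q b) (2^w1 * x) * 2^(w2*b) - 2^d * poly (coeff Q b) x) * y^b) = 0"
      by (simp add: ev_expand algebra_simps sum_subtractf sum_distrib_left power_mult_distrib power_mult[symmetric])
  qed (rule b)
  have "coeff (coeff Q b) a * (2^(w1*a) * 2^(w2*b) - 2^d) = 0"
  proof (rule polynomial_sum_zero_coeffs[where N="degree (coeff Q b)" and c="\<lambda>a. coeff (coeff Q b) a * (2^(w1*a) * 2^(w2*b) - 2^d)"])
    fix x :: complex
    show "(\<Sum>a\<le>degree (coeff Q b). coeff (coeff Q b) a * (2^(w1*a) * 2^(w2*b) - 2^d) * x^a) = 0"
      using 1[of x] by (simp add: poly_altdef algebra_simps sum_subtractf sum_distrib_left sum_distrib_right power_mult_distrib power_mult[symmetric])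
  qed (rule a)
  then have "(2::complex)^(w1*a + w2*b) = 2^d" using nz by (simp add: power_add)
  then have "(of_nat (2^(w1*a + w2*b)) :: complex) = of_nat (2^d)" by simp
  then have "(2::nat)^(w1*a + w2*b) = 2^d" by (simp only: of_nat_eq_iff)
  then show ?thesis by simp
qed

definition vanishes_to_order :: "nat \<Rightarrow> complex poly poly \<Rightarrow> bool" where
  "vanishes_to_order l Q \<longleftrightarrow> (\<forall>a b. a + b < l \<longrightarrow> coeff (coeff Q b) a = 0)"

lemma vanishes_to_order_mult:
  assumes "vanishes_to_order l Q" "vanishes_to_order l' Q'"
  shows "vanishes_to_order (l + l') (Q * Q')"
  unfolding vanishes_to_order_def
proof (intro allI impI)
  fix a b assume ab: "a + b < l + l'"
  have "coeff (coeff Q j) i * coeff (coeff Q' (b - j)) (a - i) = 0" if "j \<le> b" "i \<le> a" for i j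
  proof (cases "i + j < l")
    case True then show ?thesis using assms(1) by (simp add: vanishes_to_order_def)
  next
    case False
    then have "(a - i) + (b - j) < l'" using that ab by linarith
    then show ?thesis using assms(2) by (simp add: vanishes_to_order_def)
  qed
  then show "coeff (coeff (Q * Q') b) a = 0"
    by (simp add: coeff_mult coeff_sum sum.neutral)
qed

lemma vanishes_to_order_power: "vanishes_to_order 1 Q \<Longrightarrow> vanishes_to_order l (Q ^ l)"
proof (induction l)
  case 0 then show ?case by (simp add: vanishes_to_order_def)
next
  case (Suc l)
  then show ?case using vanishes_to_order_mult[of 1 Q l "Q^l"] by simp
qed

lemma vanishes_to_order_mult1: "vanishes_to_order l Q \<Longrightarrow> vanishes_to_order l (Q * Q')"
  using vanishes_to_order_mult[of l Q 0 Q'] by (simp add: vanishes_to_order_def)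

lemma vanishes_to_order_add: "vanishes_to_order l Q \<Longrightarrow> vanishes_to_order l Q' \<Longrightarrow> vanishes_to_order l (Q + Q')"
  by (auto simp: vanishes_to_order_def)

lemma ev_zero: "ev Q 0 = coeff (coeff Q 0) 0"
proof -
  have "poly (p :: complex poly) 0 = coeff p 0" for p by (rule poly_0_coeff_0)
  moreover have "poly Q 0 = coeff Q 0" by (rule poly_0_coeff_0)
  ultimately show ?thesis by (simp add: ev_def)
qed

text \<open>
  The leading coefficient in \<open>y\<close> is invertible, so \<open>Q\<close> can be divided by \<open>Q2\<close> repeatedly. In this way \<open>Q\<close>
  becomes a polynomial in \<open>y\<close> of degree less than that of \<open>Q2\<close>, with coefficients that depend on \<open>x\<close> and on
  the value of \<open>Q2\<close>, hence are constant on the common levels of \<open>x\<close> and \<open>Q2\<close>.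
\<close>

lemma adic_expansion:
  fixes Q2 :: "complex poly poly"
  assumes n: "degree Q2 > 0" and c: "lead_coeff Q2 = [:c:]" "c \<noteq> 0"
  shows "\<exists>D r. (\<forall>i. degree (r i) < degree Q2) \<and> Q = (\<Sum>i\<le>(D::nat). r i * Q2 ^ i)"
proof (induction "degree Q" arbitrary: Q rule: less_induct)
  case less
  show ?case
  proof (cases "degree Q < degree Q2")
    case True
    then show ?thesis by (intro exI[of _ 0] exI[of _ "\<lambda>i. if i = 0 then Q else 0"]) (use n in auto)
  next
    case False
    obtain q r where qr: "pseudo_divmod Q Q2 = (q, r)" by (cases "pseudo_divmod Q Q2")
    define e where "e = Suc (degree Q) - degree Q2"
    have Q20: "Q2 \<noteq> 0" using n by auto
    from pseudo_divmod[OF Q20 qr] have 1: "smult ([:c:] ^ e) Q = Q2 * q + r" and 2: "r = 0 \<or> degree r < degree Q2"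
      using c(1) by (simp_all add: e_def)
    have pc: "[:c:] ^ e = [:c ^ e:]" by (induction e) auto
    define k where "k = [:inverse (c ^ e):]"
    have k: "k * [:c:] ^ e = 1" using c(2) by (simp add: k_def pc one_pCons)
    have k0: "k \<noteq> 0" using c(2) by (simp add: k_def)
    define S where "S = smult k q"
    define R where "R = smult k r"
    have QS: "Q = S * Q2 + R"
    proof -
      have "Q = smult (k * [:c:] ^ e) Q" unfolding k by simp
      also have "\<dots> = smult k (Q2 * q + r)" unfolding smult_smult[symmetric] 1 ..
      finally show ?thesis by (simp add: S_def R_def smult_add_right mult.commute)
    qed
    have R: "degree R < degree Q2" using 2 n by (auto simp: R_def)
    have S: "degree S < degree Q"
    proof (cases "S = 0")
      case True then show ?thesis using False n by simp
    next
      case S0: False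
      have "degree (S * Q2) = degree S + degree Q2" using S0 Q20 by (rule degree_mult_eq)
      moreover have "S * Q2 = Q - R" using QS by simp
      moreover have "degree (Q - R) \<le> degree Q" using R False by (intro degree_diff_le) auto
      ultimately show ?thesis using n by simp
    qed
    obtain D r' where r': "\<And>i. degree (r' i) < degree Q2" "S = (\<Sum>i\<le>(D::nat). r' i * Q2 ^ i)" using less[OF S] by blast
    define r'' where "r'' = (\<lambda>i. case i of 0 \<Rightarrow> R | Suc j \<Rightarrow> r' j)"
    have "Q = (\<Sum>i\<le>Suc D. r'' i * Q2 ^ i)"
      unfolding sum.atMost_Suc_shift QS r'(2) by (simp add: r''_def sum_distrib_right sum_distrib_left algebra_simps)
    moreover have "\<forall>i. degree (r'' i) < degree Q2" using r'(1) R by (simp add: r''_def split: nat.split)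
    ultimately show ?thesis by blast
  qed
qed

text \<open>
  A germ \<open>\<eta>\<close> of a homeomorphism of the source, with inverse \<open>\<eta>'\<close>, that carries the fibres of \<open>G\<close> to those of
  \<open>F\<close>. Both \<open>\<A>\<close>-equivalence and topological triviality lead to this relation; it does not see the target
  coordinates.
\<close>

definition fibre_equivalence :: "('a::{metric_space,zero} \<Rightarrow> 'a) \<Rightarrow> ('a \<Rightarrow> 'a) \<Rightarrow> ('a \<Rightarrow> 'b) \<Rightarrow> ('a \<Rightarrow> 'b) \<Rightarrow> bool" where
  "fibre_equivalence \<eta> \<eta>' F G \<longleftrightarrow> \<eta> 0 = 0 \<and> \<eta>' 0 = 0 \<and>
     (\<forall>\<^sub>F z in nhds 0. isCont \<eta> z \<and> isCont \<eta>' z \<and> \<eta>' (\<eta> z) = z \<and> \<eta> (\<eta>' z) = z) \<and>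
     (\<exists>S. open S \<and> 0 \<in> S \<and> (\<forall>z\<in>S. \<forall>z'\<in>S. G z = G z' \<longleftrightarrow> F (\<eta> z) = F (\<eta> z')))"

lemma fibre_equivalence_refl: "fibre_equivalence (\<lambda>z. z) (\<lambda>z. z) F F"
  by (auto simp: fibre_equivalence_def intro!: exI[of _ UNIV])

lemma fibre_equivalence_local:
  assumes fe: "fibre_equivalence \<eta> \<eta>' F G" and O': "open O'" "0 \<in> O'"
  shows "\<exists>S T. open S \<and> 0 \<in> S \<and> S \<subseteq> O' \<and> open T \<and> 0 \<in> T \<and> T \<subseteq> O' \<and>
    (\<forall>z\<in>S. isCont \<eta> z \<and> \<eta>' (\<eta> z) = z) \<and> (\<forall>z\<in>T. isCont \<eta>' z \<and> \<eta> (\<eta>' z) = z \<and> \<eta>' z \<in> S) \<and>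
    (\<forall>z\<in>S. \<forall>z'\<in>S. G z = G z' \<longleftrightarrow> F (\<eta> z) = F (\<eta> z'))"
proof -
  have z: "\<eta> 0 = 0" "\<eta>' 0 = 0" using fe by (auto simp: fibre_equivalence_def)
  obtain N where N: "open N" "0 \<in> N" "\<And>z. z \<in> N \<Longrightarrow> isCont \<eta> z \<and> isCont \<eta>' z \<and> \<eta>' (\<eta> z) = z \<and> \<eta> (\<eta>' z) = z"
    using fe unfolding fibre_equivalence_def eventually_nhds by metis
  obtain S0 where S0: "open S0" "0 \<in> S0" "\<And>z z'. z \<in> S0 \<Longrightarrow> z' \<in> S0 \<Longrightarrow> G z = G z' \<longleftrightarrow> F (\<eta> z) = F (\<eta> z')"
    using fe unfolding fibre_equivalence_def by metis
  define S where "S = N \<inter> S0 \<inter> O'"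
  have S: "open S" "0 \<in> S" using N S0 O' by (auto simp: S_def)
  have "continuous_on N \<eta>'" using N(3) by (intro continuous_at_imp_continuous_on) auto
  then have oT: "open (\<eta>' -` S \<inter> N)" using continuous_on_open_vimage[OF N(1)] S(1) by blast
  define T where "T = \<eta>' -` S \<inter> N \<inter> O'"
  have "open T" "0 \<in> T" using oT O' S N(2) z by (auto simp: T_def)
  then show ?thesis using S N(3) S0(3) by (intro exI[of _ S] exI[of _ T]) (auto simp: S_def T_def)
qed

lemma self_intersecting_transfer:
  fixes F :: "complex \<times> complex \<Rightarrow> 'b"
  assumes fe: "fibre_equivalence \<eta> \<eta>' F G" and G: "open O'" "0 \<in> O'" "interior (self_intersecting G O') = {}"
  shows "\<exists>T. open T \<and> 0 \<in> T \<and> interior (self_intersecting F T) = {}"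
proof -
  from fibre_equivalence_local[OF fe G(1,2)] obtain S T where
    S: "open S" "0 \<in> S" "S \<subseteq> O'" and T: "open T" "0 \<in> T"
    and eS': "\<forall>z\<in>S. isCont \<eta> z \<and> \<eta>' (\<eta> z) = z"
    and eT': "\<forall>z\<in>T. isCont \<eta>' z \<and> \<eta> (\<eta>' z) = z \<and> \<eta>' z \<in> S"
    and FG': "\<forall>z\<in>S. \<forall>z'\<in>S. G z = G z' \<longleftrightarrow> F (\<eta> z) = F (\<eta> z')" by blast
  note eS = bspec[OF eS'] and eT = bspec[OF eT'] and FG = bspec[OF bspec[OF FG']]
  have "interior (self_intersecting F T) = {}"
  proof (rule ccontr)
    assume "interior (self_intersecting F T) \<noteq> {}"
    then obtain z0 where z0: "z0 \<in> interior (self_intersecting F T)" by blast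
    define M where "M = \<eta> -` interior (self_intersecting F T) \<inter> S"
    have "continuous_on S \<eta>" using eS by (intro continuous_at_imp_continuous_on) auto
    then have M: "open M" unfolding M_def using continuous_on_open_vimage[OF S(1)] open_interior by blast
    have "z0 \<in> T" using z0 interior_subset by (force simp: self_intersecting_def)
    then have "\<eta>' z0 \<in> M" using z0 eT by (auto simp: M_def)
    moreover have "M \<subseteq> self_intersecting G O'"
    proof
      fix a assume a: "a \<in> M"
      then have "\<eta> a \<in> self_intersecting F T" "a \<in> S" using interior_subset by (auto simp: M_def)
      then obtain w where w: "w \<in> T" "w \<noteq> \<eta> a" "F w = F (\<eta> a)" by (auto simp: self_intersecting_def)
      have "G (\<eta>' w) = G a" using FG[of "\<eta>' w" a] eT[OF w(1)] w(3) \<open>a \<in> S\<close> by simp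
      moreover have "\<eta>' w \<noteq> a" using w(2) eT[OF w(1)] by auto
      ultimately show "a \<in> self_intersecting G O'" using \<open>a \<in> S\<close> eT[OF w(1)] S(3) by (auto simp: self_intersecting_def)
    qed
    ultimately have "\<eta>' z0 \<in> interior (self_intersecting G O')" using M by (meson interiorI)
    then show False using G(3) by simp
  qed
  then show ?thesis using T by blast
qed

lemma injective_transfer:
  assumes fe: "fibre_equivalence \<eta> \<eta>' F G" and F: "open O'" "0 \<in> O'" "inj_on F O'"
  shows "\<exists>T. open T \<and> 0 \<in> T \<and> inj_on G T"
proof -
  from fibre_equivalence_local[OF fe F(1,2)] obtain S where
    S: "open S" "0 \<in> S" and eS: "\<And>z. z \<in> S \<Longrightarrow> isCont \<eta> z \<and> \<eta>' (\<eta> z) = z"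
    and FG: "\<And>z z'. z \<in> S \<Longrightarrow> z' \<in> S \<Longrightarrow> G z = G z' \<longleftrightarrow> F (\<eta> z) = F (\<eta> z')" by metis
  have "\<eta> 0 = 0" using fe by (auto simp: fibre_equivalence_def)
  have "continuous_on S \<eta>" using eS by (intro continuous_at_imp_continuous_on) auto
  then have "open (\<eta> -` O' \<inter> S)" using continuous_on_open_vimage[OF S(1)] F(1) by blast
  moreover have "inj_on G (\<eta> -` O' \<inter> S)"
  proof (rule inj_onI)
    fix z z' assume z: "z \<in> \<eta> -` O' \<inter> S" "z' \<in> \<eta> -` O' \<inter> S" "G z = G z'"
    then have "F (\<eta> z) = F (\<eta> z')" using FG by auto
    then have "\<eta> z = \<eta> z'" using F(3) z by (auto simp: inj_on_def)
    then show "z = z'" using eS z by (metis IntD2)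
  qed
  ultimately show ?thesis using F(2) S(2) \<open>\<eta> 0 = 0\<close> by (intro exI[of _ "\<eta> -` O' \<inter> S"]) auto
qed

section \<open>Finitely determined quasihomogeneous germs\<close>

definition slice :: "complex poly poly \<Rightarrow> complex \<Rightarrow> complex poly" where
  "slice Q u = (\<Sum>b\<le>degree Q. monom (poly (coeff Q b) u) b)"

lemma poly_slice: "poly (slice Q u) y = ev Q (u, y)"
  by (simp add: slice_def ev_expand poly_sum poly_monom)

lemma coeff_slice: "coeff (slice Q u) b = poly (coeff Q b) u"
  by (simp add: slice_def coeff_sum coeff_eq_0)

lemma degree_slice: "degree (slice Q u) \<le> degree Q"
  by (rule degree_le) (simp add: coeff_slice coeff_eq_0)

text \<open>
  Finite determinacy tested on polynomial perturbations. The inverse \<open>\<eta>'\<close> of the change of coordinates is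
  holomorphic because it will transport a holomorphic curve.
\<close>

definition finitely_determined2 :: "(complex \<times> complex \<Rightarrow> complex^3) \<Rightarrow> bool" where
  "finitely_determined2 F \<longleftrightarrow> (\<exists>k. \<forall>R. (\<forall>i. vanishes_to_order (Suc k) (R i)) \<longrightarrow>
     (\<exists>\<eta> \<eta>'. fibre_equivalence \<eta> \<eta>' F (\<lambda>z. \<chi> i. F z $ i + ev (R i) z) \<and>
       (\<forall>\<^sub>F z in nhds 0. holo2_at (\<lambda>z. fst (\<eta>' z)) z) \<and> (\<forall>\<^sub>F z in nhds 0. holo2_at (\<lambda>z. snd (\<eta>' z)) z)))"

lemma vanishes_to_order_0: "vanishes_to_order l 0"
  by (simp add: vanishes_to_order_def)

text \<open>
  The component \<open>i1\<close> contains the monomial \<open>x\<close>, which gives \<open>d i1 = w1\<close>; by homogeneity its other terms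
  are independent of \<open>x\<close>. The polynomials \<open>Fp\<close> are the components of \<open>F\<close>.
\<close>

locale quasihomogeneous_germ =
  fixes F :: "complex \<times> complex \<Rightarrow> complex^3" and Fp :: "3 \<Rightarrow> complex poly poly"
    and d :: "3 \<Rightarrow> nat" and w1 w2 :: nat and i1 i2 i3 :: 3 and \<alpha> :: complex
  assumes Fp: "F z $ i = ev (Fp i) z"
    and F0: "F 0 = 0"
    and w: "w1 > 0" "w2 > 0"
    and hom: "F (s ^ w1 * x, s ^ w2 * y) $ i = s ^ d i * F (x, y) $ i"
    and idx: "i1 \<noteq> i2" "i1 \<noteq> i3" "i2 \<noteq> i3" "i = i1 \<or> i = i2 \<or> i = i3"
    and d1: "d i1 = w1"
    and \<alpha>: "\<alpha> \<noteq> 0" and lin: "F (x, y) $ i1 = \<alpha> * x + F (0, y) $ i1"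
begin

text \<open>
  The inverse of the weight-preserving change of coordinates \<open>(x, y) \<mapsto> (u, y)\<close> with \<open>u = F (x, y) $ i1\<close>.
\<close>

definition straighten :: "complex \<times> complex \<Rightarrow> complex \<times> complex" where
  "straighten z = ((fst z - F (0, snd z) $ i1) / \<alpha>, snd z)"

lemma F_straighten [simp]: "F (straighten z) $ i1 = fst z"
  using \<alpha> lin[of "(fst z - F (0, snd z) $ i1) / \<alpha>" "snd z"] by (simp add: straighten_def)

lemma snd_straighten [simp]: "snd (straighten z) = snd z"
  by (simp add: straighten_def)

lemma straighten_inverse: "straighten (F z $ i1, snd z) = z"
  using \<alpha> lin[of "fst z" "snd z"] by (simp add: straighten_def)

lemma F00: "F (0, 0) $ i = 0"
  using F0 by (simp add: zero_prod_def)

lemma straighten_0 [simp]: "straighten (0, 0) = 0"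
  by (simp add: straighten_def F00 zero_prod_def)

lemma hom_straighten: "F (straighten (s ^ w1 * u, s ^ w2 * y)) $ i = s ^ d i * F (straighten (u, y)) $ i"
proof -
  have "F (0, s ^ w2 * y) $ i1 = s ^ w1 * F (0, y) $ i1" using hom[of s 0 y i1] d1 by simp
  then have st: "straighten (s ^ w1 * u, s ^ w2 * y) = (s ^ w1 * fst (straighten (u, y)), s ^ w2 * y)"
    by (simp add: straighten_def algebra_simps)
  show ?thesis unfolding st hom by (simp add: straighten_def)
qed

lemma straightened_polynomial: "\<exists>Q. \<forall>z. F (straighten z) $ i = ev Q z"
proof -
  have p: "polyfun2 (\<lambda>z. F z $ i)" for i unfolding Fp by (rule polyfun2_ev)
  have "polyfun2 (\<lambda>z. F (0, snd z) $ i1)"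
    using polyfun2_compose[OF p polyfun2_const polyfun2_snd] .
  then have "polyfun2 (\<lambda>z. (1/\<alpha>) * (fst z - F (0, snd z) $ i1))" by (intro polyfun2_intros)
  from polyfun2_compose[OF p this polyfun2_snd, of i] show ?thesis
    unfolding polyfun2_def straighten_def fun_eq_iff by simp
qed

text \<open>
  The components of \<open>F\<close> in the coordinates \<open>(u, y)\<close>.
\<close>

definition straight_poly :: "3 \<Rightarrow> complex poly poly" where
  "straight_poly i = (SOME Q. \<forall>z. F (straighten z) $ i = ev Q z)"

lemma ev_straight_poly: "F (straighten z) $ i = ev (straight_poly i) z"
  unfolding straight_poly_def using someI_ex[OF straightened_polynomial, of i] by blast

lemma straight_poly_weights: "coeff (coeff (straight_poly i) b) a \<noteq> 0 \<Longrightarrow> w1 * a + w2 * b = d i"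
  by (rule weighted_homogeneous_coeff[of "straight_poly i" w1 w2 "d i"]) (simp add: ev_straight_poly[symmetric] hom_straighten)

text \<open>
  The curve \<open>u = 0\<close> is \<open>y \<mapsto> straighten (0, y)\<close>; its points are equivalent to the one with \<open>y = 1\<close> under
  weighted scaling, so this value determines the restriction of the component \<open>i\<close> to the curve.
\<close>

definition axis_coeff :: "3 \<Rightarrow> complex" where
  "axis_coeff i = F (straighten (0, 1)) $ i"

lemma axis_value: "F (straighten (0, s ^ w2)) $ i = s ^ d i * axis_coeff i"
  using hom_straighten[of s 0 1 i] w by (simp add: axis_coeff_def power_0_left)

lemma complex_root: "\<exists>s. s ^ w2 = (y :: complex)"
proof -
  obtain s where "y = s ^ w2" by (rule exists_complex_root[of w2 y]) (use w in auto)
  then show ?thesis by auto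
qed

lemma axis_zero: "axis_coeff i = 0 \<Longrightarrow> F (straighten (0, y)) $ i = 0"
  using complex_root[of y] axis_value by (metis mult_zero_right)

lemma axis_power:
  assumes "axis_coeff i \<noteq> 0"
  shows "\<exists>n>0. d i = n * w2 \<and> (\<forall>y. F (straighten (0, y)) $ i = axis_coeff i * y ^ n)"
proof -
  have "ev (straight_poly i) (0, 1) \<noteq> 0" using assms by (simp add: axis_coeff_def ev_straight_poly)
  then obtain b where "poly (coeff (straight_poly i) b) 0 \<noteq> 0"
    by (simp add: ev_expand) (metis (no_types, lifting) sum.neutral)
  then have "coeff (coeff (straight_poly i) b) 0 \<noteq> 0" by (simp add: poly_0_coeff_0)
  then have b: "d i = b * w2" using straight_poly_weights[of i b 0] by (simp add: mult.commute)
  have v: "F (straighten (0, y)) $ i = axis_coeff i * y ^ b" for y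
  proof -
    obtain s where s: "s ^ w2 = y" using complex_root by blast
    have "s ^ d i = y ^ b" unfolding b s[symmetric] by (simp add: power_mult[symmetric] mult.commute)
    then show ?thesis using axis_value[of s i] by (simp add: s mult.commute)
  qed
  have "b > 0" using v[of 0] assms F0 by (cases b) auto
  then show ?thesis using b v by blast
qed

text \<open>
  A monomial \<open>u ^ a * y ^ b\<close> of weight \<open>n * w2\<close> has \<open>b < n\<close> unless \<open>a = 0\<close>.
\<close>

lemma straight_poly_monic:
  assumes "axis_coeff i \<noteq> 0" and d: "d i = n * w2"
  shows "degree (straight_poly i) = n" "coeff (straight_poly i) n = [:axis_coeff i:]"
proof -
  have "coeff (straight_poly i) b = 0" if "b > n" for b
  proof (rule poly_eqI, rule ccontr)
    fix a assume "coeff (coeff (straight_poly i) b) a \<noteq> coeff 0 a"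
    then have "w1 * a + w2 * b = n * w2" using straight_poly_weights[of i b a] d by simp
    then have "w2 * b \<le> w2 * n" by (metis le_add2 mult.commute)
    then show False using that w by simp
  qed
  then have le: "degree (straight_poly i) \<le> n" by (rule degree_le[rule_format])
  have a0: "coeff (coeff (straight_poly i) n) a = 0" if "a \<noteq> 0" for a
  proof (rule ccontr)
    assume "coeff (coeff (straight_poly i) n) a \<noteq> 0"
    then have "w1 * a + w2 * n = n * w2" using straight_poly_weights[of i n a] d by simp
    then show False using that w by (simp add: mult.commute)
  qed
  have b0: "coeff (coeff (straight_poly i) b) 0 = 0" if "b \<noteq> n" for b
  proof (rule ccontr)
    assume "coeff (coeff (straight_poly i) b) 0 \<noteq> 0"
    then have "w2 * b = n * w2" using straight_poly_weights[of i b 0] d by simp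
    then show False using that w by (simp add: mult.commute)
  qed
  have "axis_coeff i = (\<Sum>b\<le>n. poly (coeff (straight_poly i) b) 0)"
    using ev_expand'[OF le, of "(0, 1)"] by (simp add: axis_coeff_def ev_straight_poly)
  also have "\<dots> = (\<Sum>b\<le>n. if b = n then coeff (coeff (straight_poly i) n) 0 else 0)"
    by (rule sum.cong) (auto simp: poly_0_coeff_0 b0)
  finally have "coeff (coeff (straight_poly i) n) 0 = axis_coeff i" by simp
  then show c: "coeff (straight_poly i) n = [:axis_coeff i:]"
    by (intro poly_eqI) (use a0 in \<open>auto simp: coeff_pCons split: nat.split\<close>)
  then have "n \<le> degree (straight_poly i)" using assms(1) by (intro le_degree) auto
  then show "degree (straight_poly i) = n" using le by simp
qed

lemma F_eqI:
  assumes "F z $ i1 = F z' $ i1" "F z $ i2 = F z' $ i2" "F z $ i3 = F z' $ i3" shows "F z = F z'"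
  unfolding vec_eq_iff
proof
  fix i show "F z $ i = F z' $ i" using idx(4)[of i] assms by auto
qed

lemma finite_level:
  assumes "axis_coeff i \<noteq> 0"
  shows "finite {y. F (straighten (u, y)) $ i = v}"
proof -
  obtain n where n: "n > 0" "d i = n * w2" using axis_power[OF assms] by blast
  have "coeff (slice (straight_poly i) u - [:v:]) n = axis_coeff i"
    using n straight_poly_monic[OF assms n(2)] by (simp add: coeff_slice coeff_pCons split: nat.split)
  then have "slice (straight_poly i) u - [:v:] \<noteq> 0" using assms by auto
  from poly_roots_finite[OF this] show ?thesis by (simp add: poly_slice ev_straight_poly)
qed

lemma isCont_straighten: "isCont (\<lambda>y. straighten (u, y)) y"
proof -
  have "isCont b y \<Longrightarrow> isCont (\<lambda>y. ((u - b y) / \<alpha>, y)) y" for b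
    using \<alpha> by (intro continuous_intros) auto
  moreover have "isCont (\<lambda>y. F (0, y) $ i1) y"
    unfolding Fp ev_expand2 by (intro continuous_intros)
  ultimately show ?thesis unfolding straighten_def fst_conv snd_conv by blast
qed

lemma axis_near_0:
  assumes "open T" "0 \<in> T"
  shows "\<exists>r>0. \<forall>y. norm y < r \<longrightarrow> straighten (0, y) \<in> T"
proof -
  obtain e where e: "e > 0" "ball 0 e \<subseteq> T" using assms open_contains_ball by blast
  have "\<forall>\<^sub>F y in nhds 0. dist (straighten (0, y)) (straighten (0, 0)) < e"
    by (rule isCont_eventually_dist[OF isCont_straighten e(1)])
  then obtain r where "r > 0" "\<And>y. norm y < r \<Longrightarrow> norm (straighten (0, y)) < e"
    unfolding eventually_nhds_metric by (auto simp: dist_norm)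
  then show ?thesis using e(2) by (intro exI[of _ r]) auto
qed

text \<open>
  If both constants vanish, \<open>F\<close> is zero on the whole curve \<open>u = 0\<close>. Adding a high power of \<open>y\<close> to the
  component \<open>i2\<close> yields a germ whose only zero is 0, which is not equivalent to \<open>F\<close>.
\<close>

lemma axis_nonzero:
  assumes det: "finitely_determined2 F"
  shows "axis_coeff i2 \<noteq> 0 \<or> axis_coeff i3 \<noteq> 0"
proof (rule ccontr)
  assume "\<not> ?thesis"
  then have ac: "axis_coeff i2 = 0" "axis_coeff i3 = 0" by auto
  have F0y: "F (straighten (0, y)) = 0" for y
    using F_eqI[of "straighten (0, y)" 0] axis_zero[OF ac(1)] axis_zero[OF ac(2)] F0 by simp
  obtain k where k: "\<forall>R. (\<forall>i. vanishes_to_order (Suc k) (R i)) \<longrightarrow>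
     (\<exists>\<eta> \<eta>'. fibre_equivalence \<eta> \<eta>' F (\<lambda>z. \<chi> i. F z $ i + ev (R i) z) \<and>
       (\<forall>\<^sub>F z in nhds 0. holo2_at (\<lambda>z. fst (\<eta>' z)) z) \<and> (\<forall>\<^sub>F z in nhds 0. holo2_at (\<lambda>z. snd (\<eta>' z)) z))"
    using det unfolding finitely_determined2_def by (elim exE)
  define R where "R = (\<lambda>i. if i = i2 then [:0, 1:] ^ Suc k else (0 :: complex poly poly))"
  have "vanishes_to_order 1 ([:0, 1:] :: complex poly poly)" by (simp add: vanishes_to_order_def)
  from vanishes_to_order_power[OF this, of "Suc k"]
  have vR: "\<forall>i. vanishes_to_order (Suc k) (R i)" by (simp add: R_def vanishes_to_order_def)
  obtain \<eta> \<eta>' where fe: "fibre_equivalence \<eta> \<eta>' F (\<lambda>z. \<chi> i. F z $ i + ev (R i) z)"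
    using k[rule_format, of R] vR by blast
  define G where "G = (\<lambda>z. \<chi> i. F z $ i + ev (R i) z)"
  have e0: "\<eta> 0 = 0" using fe by (simp add: fibre_equivalence_def)
  from fibre_equivalence_local[OF fe[folded G_def] open_UNIV UNIV_I] obtain S T where
    S: "0 \<in> S" and T: "open T" "0 \<in> T"
    and eT': "\<forall>z\<in>T. isCont \<eta>' z \<and> \<eta> (\<eta>' z) = z \<and> \<eta>' z \<in> S"
    and FG': "\<forall>z\<in>S. \<forall>z'\<in>S. G z = G z' \<longleftrightarrow> F (\<eta> z) = F (\<eta> z')" by blast
  obtain r where r: "r > 0" "\<And>y. norm y < r \<Longrightarrow> straighten (0, y) \<in> T" using axis_near_0[OF T] by blast
  define y where "y = complex_of_real (r/2)"
  have y: "norm y < r" "y \<noteq> 0" using r(1) by (auto simp: y_def)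
  define a where "a = \<eta>' (straighten (0, y))"
  have a: "\<eta> a = straighten (0, y)" "a \<in> S" using eT' r(2)[OF y(1)] by (auto simp: a_def)
  then have "F (\<eta> a) = F (\<eta> 0)" using F0y F0 e0 by simp
  then have Ga: "G a = G 0" using FG' a(2) S by blast
  have G0: "G 0 = 0" by (simp add: G_def vec_eq_iff F0 R_def del: power_Suc)
  have Gi: "F a $ i + ev (R i) a = 0" for i
    using arg_cong[OF Ga[unfolded G0], of "\<lambda>v. v $ i"] by (simp add: G_def)
  have "F a $ i1 = 0" using Gi[of i1] idx by (simp add: R_def)
  then have as: "straighten (0, snd a) = a" using straighten_inverse[of a] by simp
  have "F a $ i2 + snd a ^ Suc k = 0" using Gi[of i2] by (simp add: R_def del: power_Suc)
  moreover have "F a = 0" using F0y[of "snd a"] unfolding as .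
  ultimately have "snd a = 0" by auto
  then have "a = 0" using as by simp
  then have "straighten (0, y) = 0" using a(1) e0 by simp
  then have "snd (straighten (0, y)) = 0" by simp
  then show False using y by simp
qed

text \<open>
  Let \<open>p\<close> be the component \<open>i2\<close> and add \<open>\<epsilon> * p ^ l * y\<close> to the component \<open>i3\<close>. Two different points with the
  same image determine \<open>\<epsilon>\<close> where \<open>p \<noteq> 0\<close>. A point has only finitely many possible partners, those with
  the same \<open>u\<close> and \<open>p\<close>, so it is a double point for finitely many \<open>\<epsilon>\<close>. If the double points had interior
  for every \<open>\<epsilon>\<close>, then one point of a countable dense set would be a double point for uncountably many \<open>\<epsilon>\<close>.
  Hence they have empty interior for some \<open>\<epsilon>\<close>, and \<open>F\<close> has the same fibres as this perturbation.
\<close>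

lemma generically_injective:
  assumes det: "finitely_determined2 F" and ac: "axis_coeff i2 \<noteq> 0"
  shows "\<exists>T. open T \<and> 0 \<in> T \<and> interior (self_intersecting F T) = {}"
proof -
  obtain k where k: "\<forall>R. (\<forall>i. vanishes_to_order (Suc k) (R i)) \<longrightarrow>
     (\<exists>\<eta> \<eta>'. fibre_equivalence \<eta> \<eta>' F (\<lambda>z. \<chi> i. F z $ i + ev (R i) z) \<and>
       (\<forall>\<^sub>F z in nhds 0. holo2_at (\<lambda>z. fst (\<eta>' z)) z) \<and> (\<forall>\<^sub>F z in nhds 0. holo2_at (\<lambda>z. snd (\<eta>' z)) z))"
    using det unfolding finitely_determined2_def by (elim exE)
  define R where "R = (\<lambda>\<epsilon> i. if i = i3 then Fp i2 ^ Suc k * ([:[:\<epsilon>:]:] * [:0, 1:]) else (0 :: complex poly poly))"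
  have "vanishes_to_order 1 (Fp i2)"
    unfolding vanishes_to_order_def using ev_zero[of "Fp i2"] F0 by (simp add: Fp[symmetric])
  note v = vanishes_to_order_mult1[OF vanishes_to_order_power[OF this, of "Suc k"]]
  have vR: "vanishes_to_order (Suc k) (R \<epsilon> i)" for \<epsilon> i
    by (cases "i = i3") (simp_all add: R_def vanishes_to_order_0 v del: power_Suc mult_pCons_left mult_pCons_right)
  define G where "G = (\<lambda>\<epsilon> z. \<chi> i. F z $ i + ev (R \<epsilon> i) z)"
  have G: "G \<epsilon> z $ i1 = F z $ i1" "G \<epsilon> z $ i2 = F z $ i2"
      "G \<epsilon> z $ i3 = F z $ i3 + F z $ i2 ^ Suc k * (\<epsilon> * snd z)" for \<epsilon> z
    using idx by (simp_all add: G_def R_def Fp del: power_Suc mult_pCons_left mult_pCons_right)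
  define D where "D = (\<lambda>\<epsilon>. {z. F z $ i2 \<noteq> 0 \<and> (\<exists>z'. z' \<noteq> z \<and> G \<epsilon> z' = G \<epsilon> z)})"
  have fin: "finite {\<epsilon>. z \<in> D \<epsilon>}" for z
  proof -
    define u where "u = F z $ i1"
    have "{\<epsilon>. z \<in> D \<epsilon>} \<subseteq> (\<lambda>y'. (F (straighten (u, y')) $ i3 - F z $ i3) / (F z $ i2 ^ Suc k * (snd z - y'))) `
        {y. F (straighten (u, y)) $ i2 = F z $ i2}"
    proof
      fix \<epsilon> assume "\<epsilon> \<in> {\<epsilon>. z \<in> D \<epsilon>}"
      then obtain z' where z': "F z $ i2 \<noteq> 0" "z' \<noteq> z" "G \<epsilon> z' = G \<epsilon> z" by (auto simp: D_def)
      have e: "F z' $ i1 = u" "F z' $ i2 = F z $ i2"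
        "F z' $ i3 + F z' $ i2 ^ Suc k * (\<epsilon> * snd z') = F z $ i3 + F z $ i2 ^ Suc k * (\<epsilon> * snd z)"
      proof -
        have gi: "G \<epsilon> z' $ i = G \<epsilon> z $ i" for i using z'(3) by simp
        show "F z' $ i1 = u" "F z' $ i2 = F z $ i2" using gi[of i1] gi[of i2] unfolding G u_def by auto
        show "F z' $ i3 + F z' $ i2 ^ Suc k * (\<epsilon> * snd z') = F z $ i3 + F z $ i2 ^ Suc k * (\<epsilon> * snd z)"
          using gi[of i3] unfolding G .
      qed
      have zs: "z' = straighten (u, snd z')" "z = straighten (u, snd z)"
        using straighten_inverse[of z'] straighten_inverse[of z] e(1) by (simp_all add: u_def)
      then have "snd z' \<noteq> snd z" using z'(2) by metis
      then have "\<epsilon> = (F z' $ i3 - F z $ i3) / (F z $ i2 ^ Suc k * (snd z - snd z'))"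
        using e z'(1) by (simp add: field_simps del: power_Suc)
      then show "\<epsilon> \<in> (\<lambda>y'. (F (straighten (u, y')) $ i3 - F z $ i3) / (F z $ i2 ^ Suc k * (snd z - y'))) `
        {y. F (straighten (u, y)) $ i2 = F z $ i2}"
        using e(2) zs(1) by (intro image_eqI[of _ _ "snd z'"]) auto
    qed
    then show ?thesis using finite_level[OF ac] by (meson finite_imageI finite_subset)
  qed
  obtain \<epsilon> where eps: "interior (D \<epsilon>) = {}"
  proof (rule ccontr)
    assume "\<not> thesis"
    then have ne: "interior (D \<epsilon>) \<noteq> {}" for \<epsilon> using that by blast
    obtain C :: "(complex \<times> complex) set" where C: "countable C" "\<And>X. open X \<Longrightarrow> X \<noteq> {} \<Longrightarrow> \<exists>c\<in>C. c \<in> X"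
      using countable_dense_exists by blast
    have "\<epsilon> \<in> (\<Union>c\<in>C. {\<epsilon>. c \<in> D \<epsilon>})" for \<epsilon>
      using C(2)[OF open_interior ne, of \<epsilon>] interior_subset by blast
    then have "UNIV = (\<Union>c\<in>C. {\<epsilon>. c \<in> D \<epsilon>})" by blast
    moreover have "countable (\<Union>c\<in>C. {\<epsilon>. c \<in> D \<epsilon>})"
      by (rule countable_UN[OF C(1)]) (rule countable_finite[OF fin])
    ultimately show False using uncountable_UNIV_complex by simp
  qed
  have cont2: "continuous_on UNIV (\<lambda>z. F z $ i2)"
    unfolding Fp by (intro continuous_at_imp_continuous_on ballI holo2_at_isCont polyfun2_holo polyfun2_ev)
  have "interior (self_intersecting (G \<epsilon>) UNIV) = {}"
  proof (rule ccontr)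
    assume "interior (self_intersecting (G \<epsilon>) UNIV) \<noteq> {}"
    then obtain z0 where z0: "z0 \<in> interior (self_intersecting (G \<epsilon>) UNIV)" by blast
    define N where "N = interior (self_intersecting (G \<epsilon>) UNIV)"
    define u where "u = F z0 $ i1"
    note isCont_straighten[of "snd z0" u]
    moreover have "straighten (u, snd z0) = z0" by (simp add: u_def straighten_inverse)
    moreover obtain e where e: "e > 0" "ball z0 e \<subseteq> N" using z0 open_interior unfolding N_def by (meson open_contains_ball)
    ultimately have "\<forall>\<^sub>F y in nhds (snd z0). dist (straighten (u, y)) z0 < e"
      using isCont_eventually_dist[of "snd z0" "\<lambda>y. straighten (u, y)" e] by simp
    then obtain r where r: "r > 0" "\<And>y. dist y (snd z0) < r \<Longrightarrow> dist (straighten (u, y)) z0 < e"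
      unfolding eventually_nhds_metric by blast
    have "infinite (ball (snd z0) r)" using r(1) finite_imp_not_open[of "ball (snd z0) r"] by auto
    then have "\<not> ball (snd z0) r \<subseteq> {y. F (straighten (u, y)) $ i2 = 0}"
      using finite_level[OF ac, of u 0] finite_subset by blast
    then obtain y where "y \<in> ball (snd z0) r" "F (straighten (u, y)) $ i2 \<noteq> 0" by blast
    then have y: "dist y (snd z0) < r" "F (straighten (u, y)) $ i2 \<noteq> 0" by (simp_all add: dist_commute)
    have "straighten (u, y) \<in> N" using r(2)[OF y(1)] e(2) by (auto simp: dist_commute)
    moreover have "open (N \<inter> (\<lambda>z. F z $ i2) -` (- {0}))"
      using open_vimage[OF _ cont2, of "- {0}"] by (auto simp: N_def)
    moreover have "N \<inter> (\<lambda>z. F z $ i2) -` (- {0}) \<subseteq> D \<epsilon>"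
      using interior_subset[of "self_intersecting (G \<epsilon>) UNIV"] by (auto simp: N_def D_def self_intersecting_def)
    ultimately have "straighten (u, y) \<in> interior (D \<epsilon>)" using y(2) by (intro interiorI) auto
    then show False using eps by simp
  qed
  moreover obtain \<eta> \<eta>' where "fibre_equivalence \<eta> \<eta>' F (G \<epsilon>)" using k[rule_format, of "R \<epsilon>"] vR unfolding G_def by blast
  ultimately show ?thesis using self_intersecting_transfer[of \<eta> \<eta>' F "G \<epsilon>" UNIV] by auto
qed

text \<open>
  On the curve \<open>u = 0\<close> the values \<open>y\<close> and \<open>- y\<close> of the parameter give the same image.
\<close>

lemma not_injective:
  assumes ac: "axis_coeff i2 \<noteq> 0" "axis_coeff i3 = 0" and n: "d i2 = 2 * w2" and T: "open T" "0 \<in> T"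
  shows "\<not> inj_on F T"
proof
  assume inj: "inj_on F T"
  obtain r where r: "r > 0" "\<And>y. norm y < r \<Longrightarrow> straighten (0, y) \<in> T" using axis_near_0[OF T] by blast
  define y where "y = complex_of_real (r/2)"
  have y: "norm y < r" "y \<noteq> 0" using r(1) by (auto simp: y_def)
  obtain n' where n': "d i2 = n' * w2" "\<And>y. F (straighten (0, y)) $ i2 = axis_coeff i2 * y ^ n'" using axis_power[OF ac(1)] by blast
  have "n' = 2" using n n'(1) w by simp
  then have "F (straighten (0, y)) = F (straighten (0, - y))"
    using n'(2) axis_zero[OF ac(2)] by (intro F_eqI) auto
  then have "straighten (0, y) = straighten (0, - y)" using inj r(2)[of y] r(2)[of "-y"] y by (auto simp: inj_on_def)
  then have "snd (straighten (0, y)) = snd (straighten (0, - y))" by simp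
  then show False using y by simp
qed

lemma roots_same_norm:
  fixes y y' :: complex
  assumes "y' ^ n = y ^ n" "n > 0" shows "norm y' = norm y"
proof -
  have "norm y' ^ n = norm y ^ n" using assms(1) by (metis norm_power)
  then show ?thesis using assms(2) by (simp add: power_eq_iff_eq_base)
qed

text \<open>
  The curve \<open>u = 0\<close> consists of \<open>n\<close>-fold points of \<open>F\<close>, whereas for \<open>n \<ge> 3\<close> the \<open>n\<close>-fold points of a general
  germ are isolated, being given by two equations in two variables. Let \<open>p\<close> be the component \<open>i2\<close>, and
  write the component \<open>i3\<close> as the sum of \<open>a j u p * y ^ j\<close> over \<open>j < n\<close>, using \<open>adic_expansion\<close>. Adding
  \<open>\<epsilon> * p ^ l * y + \<delta> * u ^ l * y\<^sup>2\<close> to it, \<open>n\<close> points with the same image are \<open>n\<close> roots of a polynomial in \<open>y\<close>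
  of degree less than \<open>n\<close>, so that \<open>a 1 u p + \<epsilon> * p ^ l = 0\<close> and \<open>a 2 u p + \<delta> * u ^ l = 0\<close>. As the perturbation
  is equivalent to \<open>F\<close>, it has a curve of \<open>n\<close>-fold points through 0. On this curve \<open>u\<close> is not constant, so
  over every small \<open>u \<noteq> 0\<close> both equations have a common solution \<open>p\<close>. For fixed \<open>u\<close>, different \<open>\<epsilon>\<close> have
  different solutions by the first equation, but the second one, which does not involve \<open>\<epsilon>\<close>, has at most
  \<open>D\<close> solutions \<open>p\<close>.
\<close>

lemma no_multiple_axis:
  assumes det: "finitely_determined2 F" and ac: "axis_coeff i2 \<noteq> 0" "axis_coeff i3 = 0"
    and n: "d i2 = n * w2"
  shows "n < 3"
proof (rule ccontr)
  assume "\<not> n < 3"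
  then have n3: "n \<ge> 3" by simp
  have ax2: "F (straighten (0, y)) $ i2 = axis_coeff i2 * y ^ n" for y
  proof -
    obtain n' where "d i2 = n' * w2" "\<forall>y. F (straighten (0, y)) $ i2 = axis_coeff i2 * y ^ n'"
      using axis_power[OF ac(1)] by blast
    moreover have "n' = n" using calculation(1) n w by simp
    ultimately show ?thesis by blast
  qed
  note ax3 = axis_zero[OF ac(2)]
  note dQ = straight_poly_monic[OF ac(1) n]
  have "degree (straight_poly i2) > 0" "lead_coeff (straight_poly i2) = [:axis_coeff i2:]" using dQ n3 by simp_all
  from adic_expansion[OF this ac(1), of "straight_poly i3"] obtain D :: nat and r where
    r: "\<And>i. degree (r i) < n" and Q3: "straight_poly i3 = (\<Sum>i\<le>D. r i * straight_poly i2 ^ i)" unfolding dQ by blast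
  define T where "T = (\<lambda>u P. \<Sum>i\<le>D. smult (P ^ i) (slice (r i) u))"
  define a where "a = (\<lambda>j u P. \<Sum>i\<le>D. P ^ i * poly (coeff (r i) j) u)"
  have cT: "coeff (T u P) j = a j u P" for u P j by (simp add: T_def a_def coeff_sum coeff_slice)
  have degT: "degree (T u P) < n" for u P
  proof -
    have "degree (smult (P ^ i) (slice (r i) u)) \<le> n - 1" for i
      using degree_smult_le[of "P ^ i" "slice (r i) u"] degree_slice[of "r i" u] r[of i] by linarith
    then have "degree (T u P) \<le> n - 1" unfolding T_def by (intro degree_sum_le) auto
    then show ?thesis using n3 by simp
  qed
  have pT: "F (straighten (u, y)) $ i3 = poly (T u (F (straighten (u, y)) $ i2)) y" for u y
    by (simp add: T_def poly_sum poly_slice ev_straight_poly Q3 mult.commute)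
  obtain k where k: "\<forall>R. (\<forall>i. vanishes_to_order (Suc k) (R i)) \<longrightarrow>
     (\<exists>\<eta> \<eta>'. fibre_equivalence \<eta> \<eta>' F (\<lambda>z. \<chi> i. F z $ i + ev (R i) z) \<and>
       (\<forall>\<^sub>F z in nhds 0. holo2_at (\<lambda>z. fst (\<eta>' z)) z) \<and> (\<forall>\<^sub>F z in nhds 0. holo2_at (\<lambda>z. snd (\<eta>' z)) z))"
    using det unfolding finitely_determined2_def by (elim exE)
  define l where "l = Suc k"
  have l: "l > 0" by (simp add: l_def)
  \<comment> \<open>\<open>\<delta>\<close> makes \<open>a 2 u 0 + \<delta> * u ^ l\<close> a nonzero polynomial \<open>s\<close> in \<open>u\<close>, so that \<open>p = 0\<close> is no solution\<close>
  obtain \<delta> where \<delta>: "coeff (r 0) 2 + monom \<delta> l \<noteq> 0"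
  proof (cases "coeff (r 0) 2 = 0")
    case True then show ?thesis using that[of 1] by simp
  next
    case False then show ?thesis using that[of 0] by simp
  qed
  define s where "s = coeff (r 0) 2 + monom \<delta> l"
  have "finite {u. poly s u = 0}" using \<delta> by (intro poly_roots_finite) (simp add: s_def)
  then obtain \<rho>0 where \<rho>0: "\<rho>0 > 0" "\<And>u. poly s u = 0 \<Longrightarrow> u \<noteq> 0 \<Longrightarrow> \<rho>0 \<le> norm u"
    using finite_set_avoid[of "{u. poly s u = 0}" 0] by auto
  have as0: "a 2 u 0 + \<delta> * u ^ l = poly s u" for u
  proof -
    have "a 2 u 0 = (\<Sum>i\<le>D. if i = 0 then poly (coeff (r 0) 2) u else 0)"
      unfolding a_def by (intro sum.cong) (auto simp: power_0_left)
    then show ?thesis by (simp add: s_def poly_monom)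
  qed
  \<comment> \<open>for a single \<open>\<epsilon>\<close>, both equations are solvable over every small \<open>u0 \<noteq> 0\<close>\<close>
  have single: "\<exists>\<rho>>0. \<forall>u0. 0 < norm u0 \<and> norm u0 < \<rho> \<longrightarrow> (\<exists>P. a 1 u0 P + \<epsilon> * P ^ l = 0 \<and> a 2 u0 P + \<delta> * u0 ^ l = 0)"
    if eps: "\<epsilon> \<noteq> 0" for \<epsilon>
  proof -
    define R where "R = (\<lambda>i. if i = i3 then Fp i2 ^ l * ([:[:\<epsilon>:]:] * [:0, 1:]) + Fp i1 ^ l * ([:[:\<delta>:]:] * [:0, 1:] ^ 2)
        else (0 :: complex poly poly))"
    have v1: "vanishes_to_order 1 (Fp i)" for i
      unfolding vanishes_to_order_def using ev_zero[of "Fp i"] F0 by (simp add: Fp[symmetric])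
    note v = vanishes_to_order_mult1[OF vanishes_to_order_power[OF v1, of "l"]]
    have vR: "vanishes_to_order (Suc k) (R i)" for i
      unfolding l_def[symmetric] R_def by (simp only: vanishes_to_order_0 v vanishes_to_order_add split: if_split) blast
    define G where "G = (\<lambda>z. \<chi> i. F z $ i + ev (R i) z)"
    have G: "G z $ i1 = F z $ i1" "G z $ i2 = F z $ i2"
        "G z $ i3 = F z $ i3 + F z $ i2 ^ l * (\<epsilon> * snd z) + F z $ i1 ^ l * (\<delta> * snd z ^ 2)" for z
      using idx by (simp_all add: G_def R_def Fp del: power_Suc mult_pCons_left mult_pCons_right)
    obtain \<eta> \<eta>' where fe: "fibre_equivalence \<eta> \<eta>' F G"
      and h1: "\<forall>\<^sub>F z in nhds 0. holo2_at (\<lambda>z. fst (\<eta>' z)) z" and h2: "\<forall>\<^sub>F z in nhds 0. holo2_at (\<lambda>z. snd (\<eta>' z)) z"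
      using k[rule_format, of R] vR unfolding G_def by blast
    have e0: "\<eta>' 0 = 0" using fe by (simp add: fibre_equivalence_def)
    obtain O' where O': "open O'" "0 \<in> O'" "\<And>z. z \<in> O' \<Longrightarrow> holo2_at (\<lambda>z. fst (\<eta>' z)) z \<and> holo2_at (\<lambda>z. snd (\<eta>' z)) z"
      using eventually_conj[OF h1 h2] unfolding eventually_nhds by blast
    from fibre_equivalence_local[OF fe O'(1,2)] obtain S T' where
      T': "open T'" "0 \<in> T'" "T' \<subseteq> O'"
      and eT: "\<forall>z\<in>T'. isCont \<eta>' z \<and> \<eta> (\<eta>' z) = z \<and> \<eta>' z \<in> S"
      and FG: "\<forall>z\<in>S. \<forall>z'\<in>S. G z = G z' \<longleftrightarrow> F (\<eta> z) = F (\<eta> z')" by blast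
    obtain r1 where r1: "r1 > 0" "\<And>y. norm y < r1 \<Longrightarrow> straighten (0, y) \<in> T'" using axis_near_0[OF T'(1,2)] by blast
    \<comment> \<open>the curve of \<open>n\<close>-fold points of \<open>G\<close>\<close>
    define \<gamma> where "\<gamma> = (\<lambda>y. \<eta>' (straighten (0, y)))"
    define U where "U = (\<lambda>y. F (\<gamma> y) $ i1)"
    have \<gamma>: "\<eta> (\<gamma> y) = straighten (0, y)" "\<gamma> y \<in> S" if "norm y < r1" for y
      using eT r1(2)[OF that] by (auto simp: \<gamma>_def)
    have \<gamma>0: "\<gamma> 0 = 0" using e0 by (simp add: \<gamma>_def)
    have U0: "U 0 = 0" by (simp add: U_def \<gamma>0 F0)
    have Uh: "U holomorphic_on ball 0 r1"
    proof -
      have F1y: "(\<lambda>y. F (0, y) $ i1) holomorphic_on A" for A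
        unfolding Fp ev_expand2 fst_conv snd_conv by (intro holomorphic_intros)
      have ax: "(\<lambda>y. fst (straighten (0, y))) holomorphic_on ball 0 r1"
        unfolding straighten_def fst_conv snd_conv using \<alpha> by (intro holomorphic_intros F1y) auto
      have st: "(fst (straighten (0, y)), y) = straighten (0, y)" for y by (simp add: prod_eq_iff)
      have g1: "(\<lambda>y. fst (\<gamma> y)) holomorphic_on ball 0 r1"
        using holo2_along_graph[OF ax, of "\<lambda>z. fst (\<eta>' z)"] O'(3) T'(3) r1(2) unfolding st \<gamma>_def by blast
      have g2: "(\<lambda>y. snd (\<gamma> y)) holomorphic_on ball 0 r1"
        using holo2_along_graph[OF ax, of "\<lambda>z. snd (\<eta>' z)"] O'(3) T'(3) r1(2) unfolding st \<gamma>_def by blast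
      have "U = (\<lambda>y. \<alpha> * fst (\<gamma> y) + ((\<lambda>y. F (0, y) $ i1) \<circ> (\<lambda>y. snd (\<gamma> y))) y)"
        unfolding U_def using lin by (metis (no_types, lifting) comp_apply prod.collapse)
      then show ?thesis
        using holomorphic_on_compose[OF g2 F1y] g1 by (simp only:) (intro holomorphic_intros)
    qed
    have locus: "(a 1 (U y) (F (\<gamma> y) $ i2) + \<epsilon> * (F (\<gamma> y) $ i2) ^ l = 0 \<and> a 2 (U y) (F (\<gamma> y) $ i2) + \<delta> * U y ^ l = 0) \<and> U y \<noteq> 0"
      if y: "norm y < r1" "y \<noteq> 0" for y
    proof -
      define Y where "Y = {y'. y' ^ n = y ^ n}"
      have cY: "card Y = n" "finite Y" unfolding Y_def using y n3 by (auto intro!: card_nth_roots finite_nth_roots)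
      have Yr: "norm y' < r1" if "y' \<in> Y" for y' using roots_same_norm[of y' n y] that y n3 by (simp add: Y_def)
      define u P v where "u = U y" "P = F (\<gamma> y) $ i2" "v = G (\<gamma> y) $ i3"
      note uPv = this
      have GY: "G (\<gamma> y') = G (\<gamma> y)" if "y' \<in> Y" for y'
      proof -
        have "F (straighten (0, y')) = F (straighten (0, y))"
          using that ax2 ax3 by (intro F_eqI) (simp_all add: Y_def)
        then show ?thesis using FG \<gamma>[OF Yr[OF that]] \<gamma>[OF y(1)] by metis
      qed
      have GYi: "F (\<gamma> y') $ i1 = u" "F (\<gamma> y') $ i2 = P"
        "F (\<gamma> y') $ i3 + P ^ l * (\<epsilon> * snd (\<gamma> y')) + u ^ l * (\<delta> * snd (\<gamma> y') ^ 2) = v" if "y' \<in> Y" for y'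
        using arg_cong[OF GY[OF that], of "\<lambda>w. w $ i1"] arg_cong[OF GY[OF that], of "\<lambda>w. w $ i2"]
          arg_cong[OF GY[OF that], of "\<lambda>w. w $ i3"] unfolding G uPv U_def by simp_all
      have st: "\<gamma> y' = straighten (u, snd (\<gamma> y'))" if "y' \<in> Y" for y'
        using straighten_inverse[of "\<gamma> y'"] GYi(1)[OF that] by simp
      have inj: "inj_on (\<lambda>y'. snd (\<gamma> y')) Y"
      proof (rule inj_onI)
        fix y1 y2 assume yy: "y1 \<in> Y" "y2 \<in> Y" "snd (\<gamma> y1) = snd (\<gamma> y2)"
        then have "\<gamma> y1 = \<gamma> y2" using st by metis
        then have "straighten (0, y1) = straighten (0, y2)" using \<gamma>(1) Yr yy by metis
        then have "snd (straighten (0, y1)) = snd (straighten (0, y2))" by simp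
        then show "y1 = y2" by simp
      qed
      define Y' where "Y' = (\<lambda>y'. snd (\<gamma> y')) ` Y"
      have cY': "card Y' = n" unfolding Y'_def using inj cY by (simp add: card_image)
      define Z where "Z = T u P + [:- v, P ^ l * \<epsilon>, u ^ l * \<delta>:]"
      have degZ: "degree Z < n" unfolding Z_def
        by (rule degree_add_less[OF degT]) (use n3 in \<open>auto intro: le_less_trans[OF degree_pCons_le]\<close>)
      have "Y' \<subseteq> {x. poly Z x = 0}"
      proof
        fix x assume "x \<in> Y'"
        then obtain y' where y': "y' \<in> Y" "x = snd (\<gamma> y')" by (auto simp: Y'_def)
        have "F (\<gamma> y') $ i3 = poly (T u P) x"
          using pT[of u x] GYi(2)[OF y'(1)] st[OF y'(1)] y'(2) by simp
        then show "x \<in> {x. poly Z x = 0}"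
          using GYi(3)[OF y'(1)] y'(2) by (simp add: Z_def algebra_simps power2_eq_square)
      qed
      then have Z0: "Z = 0"
        using card_poly_roots_bound[of Z] card_mono[OF poly_roots_finite[of Z], of Y'] degZ cY' by (metis leD le_trans)
      have 12: "a 1 u P + \<epsilon> * P ^ l = 0" "a 2 u P + \<delta> * u ^ l = 0"
        using arg_cong[OF Z0, of "\<lambda>p. coeff p 1"] arg_cong[OF Z0, of "\<lambda>p. coeff p 2"]
        by (simp_all add: Z_def cT mult.commute numeral_2_eq_2)
      \<comment> \<open>on \<open>u = 0\<close> the term \<open>\<epsilon> * P ^ l * y\<close> separates points with the same \<open>P \<noteq> 0\<close>\<close>
      have "u \<noteq> 0"
      proof
        assume u0: "u = 0"
        have P: "P = axis_coeff i2 * snd (\<gamma> y') ^ n" if "y' \<in> Y" for y'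
          using GYi(2)[OF that] st[OF that] ax2[of "snd (\<gamma> y')"] unfolding u0 by simp
        have Pv: "P ^ l * (\<epsilon> * snd (\<gamma> y')) = v" if "y' \<in> Y" for y'
        proof -
          have "F (\<gamma> y') $ i3 = 0" using st[OF that] ax3[of "snd (\<gamma> y')"] unfolding u0 by simp
          then show ?thesis using GYi(3)[OF that] u0 l by (simp add: power_0_left)
        qed
        have "\<exists>c. \<forall>y'\<in>Y. snd (\<gamma> y') = c"
        proof (cases "P = 0")
          case True then show ?thesis using P ac(1) n3 by (intro exI[of _ 0]) auto
        next
          case False then show ?thesis using Pv eps by (intro exI[of _ "v / (P ^ l * \<epsilon>)"]) (auto simp: field_simps)
        qed
        then obtain c where "Y' \<subseteq> {c}" by (auto simp: Y'_def)
        then have "card Y' \<le> 1" using card_mono[of "{c}" Y'] by simp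
        then show False using cY' n3 by simp
      qed
      then show ?thesis using 12 unfolding uPv by simp
    qed
    have "\<not> U constant_on ball 0 r1"
    proof
      assume "U constant_on ball 0 r1"
      then have "U (of_real (r1/2)) = U 0" unfolding constant_on_def using r1(1) by (metis abs_of_pos centre_in_ball dist_0_norm half_gt_zero mem_ball norm_of_real field_sum_of_halves less_add_same_cancel1)
      then show False using locus[of "of_real (r1/2)"] U0 r1(1) by simp
    qed
    then have "open (U ` ball 0 r1)" using open_mapping_thm[OF Uh open_ball connected_ball open_ball subset_refl] by blast
    moreover have "0 \<in> U ` ball 0 r1" using U0 r1(1) by (intro image_eqI[of _ _ 0]) auto
    ultimately obtain \<rho> where \<rho>: "\<rho> > 0" "ball 0 \<rho> \<subseteq> U ` ball 0 r1" using open_contains_ball by blast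
    have "\<exists>P. a 1 u0 P + \<epsilon> * P ^ l = 0 \<and> a 2 u0 P + \<delta> * u0 ^ l = 0" if u0: "0 < norm u0" "norm u0 < \<rho>" for u0
    proof -
      have "u0 \<in> ball 0 \<rho>" using u0 by simp
      then obtain y where y: "norm y < r1" "u0 = U y" using \<rho>(2) by auto
      then have "y \<noteq> 0" using U0 u0 by auto
      then show ?thesis using locus[OF y(1)] y(2) by blast
    qed
    then show ?thesis using \<rho>(1) by blast
  qed
  \<comment> \<open>the \<open>D + 1\<close> values \<open>\<epsilon> = 1, \<dots>, D + 1\<close> at a common \<open>u0\<close> give too many roots of the second equation\<close>
  have "\<forall>j\<in>{..D}. \<exists>\<rho>>0. \<forall>u0. 0 < norm u0 \<and> norm u0 < \<rho> \<longrightarrow> (\<exists>P. a 1 u0 P + of_nat (Suc j) * P ^ l = 0 \<and> a 2 u0 P + \<delta> * u0 ^ l = 0)"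
    using single by (metis of_nat_neq_0)
  then obtain \<rho> where \<rho>: "\<And>j. j \<le> D \<Longrightarrow> \<rho> j > 0 \<and> (\<forall>u0. 0 < norm u0 \<and> norm u0 < \<rho> j \<longrightarrow>
      (\<exists>P. a 1 u0 P + of_nat (Suc j) * P ^ l = 0 \<and> a 2 u0 P + \<delta> * u0 ^ l = 0))"
    by (metis atMost_iff)
  define m where "m = Min (insert \<rho>0 (\<rho> ` {..D}))"
  have m: "m > 0" "m \<le> \<rho>0" "\<And>j. j \<le> D \<Longrightarrow> m \<le> \<rho> j" 
  proof -
    show "m > 0" using \<rho> \<rho>0 by (auto simp: m_def)
    show "m \<le> \<rho>0" unfolding m_def by (rule Min_le) auto
    show "m \<le> \<rho> j" if "j \<le> D" for j unfolding m_def by (rule Min_le) (use that in auto)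
  qed
  define u0 where "u0 = complex_of_real (m/2)"
  have u0: "0 < norm u0" "norm u0 < m" using m(1) by (auto simp: u0_def)
  have su: "poly s u0 \<noteq> 0" using \<rho>0(2)[of u0] u0 m(2) by force
  have "\<forall>j\<in>{..D}. \<exists>P. a 1 u0 P + of_nat (Suc j) * P ^ l = 0 \<and> a 2 u0 P + \<delta> * u0 ^ l = 0"
    using \<rho> u0 m(3) by (meson atMost_iff less_le_trans)
  then obtain P where P: "\<And>j. j \<le> D \<Longrightarrow> a 1 u0 (P j) + of_nat (Suc j) * P j ^ l = 0 \<and> a 2 u0 (P j) + \<delta> * u0 ^ l = 0"
    by (metis atMost_iff)
  have P0: "P j \<noteq> 0" if "j \<le> D" for j using P[OF that] as0[of u0] su by auto
  have injP: "inj_on P {..D}"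
  proof (rule inj_onI)
    fix i j assume ij: "i \<in> {..D}" "j \<in> {..D}" "P i = P j"
    then have "of_nat (Suc i) * P i ^ l = of_nat (Suc j) * P i ^ l"
      using P[of i] P[of j] by (metis add_left_cancel atMost_iff)
    then have "of_nat (Suc i) = (of_nat (Suc j) :: complex)" using P0[of i] ij by simp
    then show "i = j" by (simp only: of_nat_eq_iff nat.inject)
  qed
  define Z where "Z = (\<Sum>i\<le>D. monom (poly (coeff (r i) 2) u0) i) + [:\<delta> * u0 ^ l:]"
  have pZ: "poly Z x = a 2 u0 x + \<delta> * u0 ^ l" for x
    by (simp add: Z_def a_def poly_sum poly_monom mult.commute)
  have "Z \<noteq> 0" using pZ[of 0] as0[of u0] su by auto
  have degZ: "degree Z \<le> D" unfolding Z_def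
    by (intro degree_add_le degree_sum_le) (auto intro: order_trans[OF degree_monom_le])
  have "P ` {..D} \<subseteq> {x. poly Z x = 0}" using P by (auto simp: pZ)
  then have "card (P ` {..D}) \<le> degree Z"
    using card_poly_roots_bound[OF \<open>Z \<noteq> 0\<close>] card_mono[OF poly_roots_finite[OF \<open>Z \<noteq> 0\<close>]] le_trans by blast
  then show False using injP degZ by (simp add: card_image)
qed

end

section \<open>Perturbations of non-decreasing weight\<close>

lemma power_sum_le:
  fixes p q :: real
  assumes "0 \<le> p" "0 \<le> q" shows "(p + q) ^ a \<le> 2 ^ a * (p ^ a + q ^ a)"
proof -
  have "(p + q) ^ a \<le> (2 * max p q) ^ a" using assms by (intro power_mono) auto
  also have "\<dots> = 2 ^ a * max p q ^ a" by (simp add: power_mult_distrib)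
  also have "max p q ^ a \<le> p ^ a + q ^ a" using assms by (auto simp: max_def)
  finally show ?thesis by simp
qed

text \<open>
  Here \<open>X\<close> is the size of \<open>x\<close>, \<open>l ^ w2\<close> that of \<open>y\<close> and \<open>v\<close> that of the first component. Expanding the power of
  \<open>v + l ^ w1\<close>, a positive power of \<open>v\<close> is at most \<open>v\<close> if \<open>v \<le> 1\<close>; for \<open>v \<ge> 1\<close> the left hand side is at most
  \<open>1 \<le> v\<close>.
\<close>

lemma weighted_monomial_bound:
  fixes X v l C :: real
  assumes "0 \<le> X" "X \<le> 1" "0 \<le> v" "0 \<le> l" "l \<le> 1" "C \<ge> 1" and X: "X \<le> C * (v + l ^ w1)"
    and a: "a \<le> K" and e: "e \<le> w1 * a + w2 * b"
  shows "X ^ a * (l ^ w2) ^ b \<le> (2 * C) ^ K * (v + l ^ e)"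
proof -
  have C1: "(2 * C) ^ j \<ge> 1" for j using assms by (intro one_le_power) auto
  have lb: "(l ^ w2) ^ b \<le> 1" "0 \<le> (l ^ w2) ^ b" using assms by (auto intro!: power_le_one)
  have le0: "0 \<le> l ^ e" using assms by simp
  have lea: "l ^ (w1 * a + w2 * b) \<le> l ^ e" using assms by (intro power_decreasing) auto
  show ?thesis
  proof (cases "a = 0")
    case True
    then have "X ^ a * (l ^ w2) ^ b \<le> l ^ e" using lea by (simp add: power_mult)
    also have "\<dots> \<le> 1 * (v + l ^ e)" using assms by simp
    also have "\<dots> \<le> (2 * C) ^ K * (v + l ^ e)" using C1 assms le0 by (intro mult_right_mono) auto
    finally show ?thesis .
  next
    case False
    show ?thesis
    proof (cases "v \<ge> 1")
      case True
      have "X ^ a * (l ^ w2) ^ b \<le> 1 * 1" using assms lb by (intro mult_mono power_le_one) auto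
      also have "\<dots> \<le> 1 * (v + l ^ e)" using True le0 by simp
      also have "\<dots> \<le> (2 * C) ^ K * (v + l ^ e)" using C1 assms le0 by (intro mult_right_mono) auto
      finally show ?thesis .
    next
      case v: False
      have "X ^ a \<le> (C * (v + l ^ w1)) ^ a" using assms by (intro power_mono) auto
      also have "\<dots> \<le> C ^ a * (2 ^ a * (v ^ a + (l ^ w1) ^ a))"
        unfolding power_mult_distrib using assms by (intro mult_left_mono power_sum_le) auto
      also have "\<dots> = (2 * C) ^ a * (v ^ a + l ^ (w1 * a))" by (simp add: power_mult_distrib power_mult)
      also have "\<dots> \<le> (2 * C) ^ K * (v ^ a + l ^ (w1 * a))"
        using assms by (intro mult_right_mono power_increasing) auto
      also have "v ^ a \<le> v ^ 1" using False v assms by (intro power_decreasing) auto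
      finally have "X ^ a \<le> (2 * C) ^ K * (v + l ^ (w1 * a))" using assms by (simp add: mult_left_mono)
      then have "X ^ a * (l ^ w2) ^ b \<le> (2 * C) ^ K * (v + l ^ (w1 * a)) * (l ^ w2) ^ b"
        using lb by (intro mult_right_mono) auto
      also have "\<dots> = (2 * C) ^ K * (v * (l ^ w2) ^ b + l ^ (w1 * a + w2 * b))"
      proof -
        have "(l ^ w2) ^ b = l ^ (w2 * b)" by (simp add: power_mult)
        then show ?thesis by (simp add: distrib_left distrib_right power_add mult.assoc)
      qed
      also have "\<dots> \<le> (2 * C) ^ K * (v * 1 + l ^ e)"
        using lb assms lea by (intro mult_left_mono add_mono) auto
      finally show ?thesis by simp
    qed
  qed
qed

lemma weighted_sum_le:
  assumes b: "\<And>a b. a \<le> K \<Longrightarrow> b \<le> K \<Longrightarrow> d \<le> w1 * a + w2 * b \<Longrightarrow> norm x ^ a * norm y ^ b \<le> B" and B: "B \<ge> 0"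
  shows "weighted_sum w1 w2 d K x y \<le> real (K + 1) ^ 2 * B"
proof -
  have "weighted_sum w1 w2 d K x y \<le> (\<Sum>b\<le>K. \<Sum>a\<le>K. B)"
    unfolding weighted_sum_def using b B by (intro sum_mono) auto
  also have "\<dots> = real (K + 1) ^ 2 * B" by (simp add: power2_eq_square)
  finally show ?thesis .
qed

lemma weighted_sum_nonneg: "0 \<le> weighted_sum w1 w2 d K x y"
  unfolding weighted_sum_def by (intro sum_nonneg) auto

context quasihomogeneous_germ
begin

text \<open>
  With the root of the modulus of \<open>y\<close> weights become exponents, also when \<open>w2\<close> does not divide them.
\<close>

definition y_size :: "complex \<Rightarrow> real" where
  "y_size y = root w2 (norm y)"

lemma y_size_power: "y_size y ^ w2 = norm y" "0 \<le> y_size y"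
  using w by (simp_all add: y_size_def)

lemma y_size_le_1: "norm y \<le> 1 \<Longrightarrow> y_size y \<le> 1"
  using w by (simp add: y_size_def)

lemma y_size_root: "s ^ w2 = y \<Longrightarrow> norm s = y_size y"
  using w by (auto simp: y_size_def norm_power real_root_power_cancel)

lemma axis_bound: "norm (F (0, y) $ i1) = norm (F (0, 1) $ i1) * y_size y ^ w1"
proof -
  obtain s where s: "s ^ w2 = y" using complex_root by blast
  have "F (0, y) $ i1 = s ^ w1 * F (0, 1) $ i1" using hom[of s 0 1 i1] d1 s by simp
  then show ?thesis using y_size_root[OF s] by (simp add: norm_mult norm_power)
qed

abbreviation weight_close :: "nat \<Rightarrow> real \<Rightarrow> (complex \<times> complex \<Rightarrow> complex^3) \<Rightarrow> bool" where
  "weight_close K \<theta> h \<equiv>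
    \<forall>i. \<forall>\<^sub>F z in nhds 0. norm (h z $ i - F z $ i) \<le> \<theta> * weighted_sum w1 w2 (d i) K (fst z) (snd z)"

text \<open>
  Let \<open>v\<close> be the modulus of the first component of \<open>h\<close> and \<open>l\<close> the weighted size of \<open>y\<close>. Solving the first
  component for \<open>x\<close> gives a bound of \<open>x\<close> by \<open>v + l ^ w1\<close>, so a monomial of weight at least \<open>e\<close> is bounded by
  \<open>v + l ^ e\<close>; this yields the upper bounds. For the lower bound, the component \<open>i2\<close> of \<open>F\<close> in the coordinates
  \<open>(u, y)\<close> is \<open>c * y ^ n\<close> plus monomials that contain \<open>u\<close>. Since \<open>u\<close> is bounded by \<open>v + \<theta> * l ^ w1\<close>, these
  monomials are bounded by \<open>v + \<theta> * norm y ^ n\<close>, and for small \<open>\<theta>\<close> the last term is absorbed.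
\<close>

lemma perturbation_estimates:
  assumes ac: "axis_coeff i2 \<noteq> 0" and n: "d i2 = n * w2" and K: "\<And>i. d i \<le> K"
  shows "\<exists>\<theta>>0. \<forall>h. weight_close K \<theta> h \<longrightarrow>
     (\<exists>k>0. \<exists>C\<ge>0.
       (\<forall>\<^sub>F z in nhds 0. snd z = 0 \<longrightarrow> k * norm (fst z) \<le> norm (h z $ i1)) \<and>
       (\<forall>\<^sub>F z in nhds 0. k * norm (snd z) ^ n \<le> norm (h z $ i2) + C * norm (h z $ i1)) \<and>
       (\<forall>i. d i2 \<le> d i \<longrightarrow> (\<forall>\<^sub>F z in nhds 0. norm (h z $ i) \<le> C * (norm (h z $ i1) + norm (snd z) ^ n))))"
proof -
  define N where "N = real (K + 1) ^ 2"
  define C1 where "C1 = norm (F (0, 1) $ i1)"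
  \<comment> \<open>the constants in the bounds \<open>C2 * (v + l ^ w1)\<close> for \<open>x\<close> and \<open>C3 * (v + \<theta> * l ^ w1)\<close> for \<open>u\<close>\<close>
  define C2 where "C2 = 1 + 2 / norm \<alpha> * (1 + C1 + norm \<alpha>)"
  define C3 where "C3 = 1 + N * (C2 + 1)"
  define S where "S = (\<lambda>i. \<Sum>b\<le>degree (Fp i). \<Sum>a\<le>degree (coeff (Fp i) b). norm (coeff (coeff (Fp i) b) a))"
  define SQ where "SQ = (\<Sum>b\<le>degree (straight_poly i2). \<Sum>a\<le>degree (coeff (straight_poly i2) b). norm (coeff (coeff (straight_poly i2) b) a))"
  define c where "c = norm (axis_coeff i2)"
  define M where "M = (2 * C2) ^ K"
  define M3 where "M3 = (2 * C3) ^ K"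
  \<comment> \<open>the second bound makes the first component solvable for \<open>x\<close>, the third one leaves \<open>c / 2 * y ^ n\<close>\<close>
  define \<theta> where "\<theta> = min (min 1 (norm \<alpha> / (2 * N))) (c / (2 * (SQ * M3 + N * M + 1)))"
  have N1: "N \<ge> 1" by (simp add: N_def one_le_power)
  have na: "norm \<alpha> > 0" using \<alpha> by simp
  have C10: "C1 \<ge> 0" by (simp add: C1_def)
  have C21: "C2 \<ge> 1" using na C10 by (simp add: C2_def)
  have C31: "C3 \<ge> 1" using N1 C21 by (simp add: C3_def)
  have S0: "S i \<ge> 0" for i unfolding S_def by (intro sum_nonneg) auto
  have SQ0: "SQ \<ge> 0" unfolding SQ_def by (intro sum_nonneg) auto
  have M0: "M \<ge> 1" "M3 \<ge> 1"
    unfolding M_def M3_def by (rule one_le_power, use C21 in simp, rule one_le_power, use C31 in simp)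
  have c0: "c > 0" using ac by (simp add: c_def)
  have den: "SQ * M3 + N * M + 1 > 0" using SQ0 M0 N1 by (intro add_nonneg_pos add_nonneg_nonneg mult_nonneg_nonneg) auto
  have th: "\<theta> > 0" using N1 na c0 den by (simp add: \<theta>_def)
  have th1: "\<theta> \<le> 1" by (simp add: \<theta>_def)
  have thN: "\<theta> * N \<le> norm \<alpha> / 2"
  proof -
    have "\<theta> \<le> norm \<alpha> / (2 * N)" unfolding \<theta>_def by (rule min.coboundedI1) (rule min.cobounded2)
    then show ?thesis using N1 by (simp add: field_simps)
  qed
  have thc: "\<theta> * (SQ * M3 + N * M) \<le> c / 2"
  proof -
    have "\<theta> \<le> c / (2 * (SQ * M3 + N * M + 1))" unfolding \<theta>_def by (rule min.cobounded2)
    then have "\<theta> * (2 * (SQ * M3 + N * M + 1)) \<le> c" using den by (simp add: pos_le_divide_eq)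
    then show ?thesis using th by (simp add: algebra_simps)
  qed
  show ?thesis
  proof (rule exI[of _ \<theta>], rule conjI[OF th], intro allI impI)
    fix h :: "complex \<times> complex \<Rightarrow> complex^3"
    assume hh: "\<forall>i. \<forall>\<^sub>F z in nhds 0. norm (h z $ i - F z $ i) \<le> \<theta> * weighted_sum w1 w2 (d i) K (fst z) (snd z)"
    have ev1: "\<forall>\<^sub>F z in nhds (0::complex\<times>complex). norm (fst z) \<le> 1 \<and> norm (snd z) \<le> 1"
      unfolding nhds0_box by (intro exI[of _ 1]) auto
    have "\<forall>\<^sub>F z in nhds 0. (\<forall>i. norm (h z $ i - F z $ i) \<le> \<theta> * weighted_sum w1 w2 (d i) K (fst z) (snd z)) \<and>
        norm (fst z) \<le> 1 \<and> norm (snd z) \<le> 1"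
      using hh ev1 by (simp add: eventually_all_finite eventually_conj_iff)
    then have near: "\<forall>\<^sub>F z in nhds 0. P z"
      if "\<And>z. (\<And>i. norm (h z $ i - F z $ i) \<le> \<theta> * weighted_sum w1 w2 (d i) K (fst z) (snd z)) \<Longrightarrow>
        norm (fst z) \<le> 1 \<Longrightarrow> norm (snd z) \<le> 1 \<Longrightarrow> P z" for P
      by eventually_elim (use that in blast)
    {
      fix z :: "complex \<times> complex"
      assume e: "\<And>i. norm (h z $ i - F z $ i) \<le> \<theta> * weighted_sum w1 w2 (d i) K (fst z) (snd z)"
        and x1: "norm (fst z) \<le> 1" and y1: "norm (snd z) \<le> 1"
      define X where "X = norm (fst z)"
      define l where "l = y_size (snd z)"
      define v where "v = norm (h z $ i1)"
      define u where "u = F z $ i1"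
      have l: "0 \<le> l" "l \<le> 1" "l ^ w2 = norm (snd z)" using y_size_power[of "snd z"] y_size_le_1[OF y1] by (auto simp: l_def)
      have X: "0 \<le> X" "X \<le> 1" using x1 by (auto simp: X_def)
      have v: "0 \<le> v" by (simp add: v_def)
      have l1: "0 \<le> l ^ w1" using l by simp
      have u1: "norm u \<le> norm \<alpha> * X + C1 * l ^ w1" "norm \<alpha> * X \<le> norm u + C1 * l ^ w1"
      proof -
        have u: "u = \<alpha> * fst z + F (0, snd z) $ i1" unfolding u_def using lin[of "fst z" "snd z"] by simp
        have b: "norm (F (0, snd z) $ i1) = C1 * l ^ w1" unfolding C1_def l_def by (rule axis_bound)
        show "norm u \<le> norm \<alpha> * X + C1 * l ^ w1" using norm_triangle_ineq[of "\<alpha> * fst z" "F (0, snd z) $ i1"]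
          unfolding b u by (simp add: norm_mult X_def)
        have "norm (\<alpha> * fst z) \<le> norm u + norm (F (0, snd z) $ i1)"
          using norm_triangle_ineq4[of u "F (0, snd z) $ i1"] by (simp add: u)
        then show "norm \<alpha> * X \<le> norm u + C1 * l ^ w1" unfolding b by (simp add: norm_mult X_def)
      qed
      have W1: "weighted_sum w1 w2 (d i1) K (fst z) (snd z) \<le> N * (X + l ^ w1)"
        unfolding N_def
      proof (rule weighted_sum_le)
        fix a b assume ab: "d i1 \<le> w1 * a + w2 * b"
        show "norm (fst z) ^ a * norm (snd z) ^ b \<le> X + l ^ w1"
        proof (cases "a = 0")
          case True
          then have "l ^ (w2 * b) \<le> l ^ w1" using ab d1 l by (intro power_decreasing) auto
          then show ?thesis using True X l by (simp add: power_mult)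
        next
          case False
          have "X ^ a * norm (snd z) ^ b \<le> X ^ 1 * 1"
            using X y1 False by (intro mult_mono power_decreasing power_le_one) auto
          then show ?thesis using l1 by (simp add: X_def)
        qed
      qed (use X l1 in simp)
      have uv: "norm u \<le> v + \<theta> * N * (X + l ^ w1)"
      proof -
        have "norm (h z $ i1 - u) \<le> \<theta> * (N * (X + l ^ w1))"
          using order_trans[OF e[of i1] mult_left_mono[OF W1]] th by (simp add: u_def)
        then show ?thesis using norm_triangle_ineq3[of "h z $ i1" u] by (simp add: v_def mult.assoc)
      qed
      have XC: "X \<le> C2 * (v + l ^ w1)"
      proof -
        have "\<theta> * N * (X + l ^ w1) \<le> norm \<alpha> / 2 * (X + l ^ w1)" using thN X l1 by (intro mult_right_mono) auto
        then have "norm \<alpha> / 2 * X \<le> v + (C1 + norm \<alpha> / 2) * l ^ w1" using uv u1(2) by (simp add: algebra_simps)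
        also have "\<dots> \<le> (1 + C1 + norm \<alpha>) * v + (1 + C1 + norm \<alpha>) * l ^ w1"
          using v l1 C10 na by (intro add_mono mult_right_mono) (auto simp: mult_le_cancel_right1)
        finally have "X \<le> 2 / norm \<alpha> * (1 + C1 + norm \<alpha>) * (v + l ^ w1)" using na by (simp add: field_simps)
        also have "\<dots> \<le> C2 * (v + l ^ w1)" using v l1 by (intro mult_right_mono) (auto simp: C2_def)
        finally show ?thesis .
      qed
      have mon: "X ^ a * norm (snd z) ^ b \<le> M * (v + l ^ e)" if "a \<le> K" "e \<le> w1 * a + w2 * b" for a b e
        unfolding M_def l(3)[symmetric] by (rule weighted_monomial_bound[OF X v l(1,2) C21 XC that])
      have Wi: "weighted_sum w1 w2 (d i) K (fst z) (snd z) \<le> N * (M * (v + l ^ d i))" for i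
        unfolding N_def by (rule weighted_sum_le) (use mon v l M0 in \<open>auto simp: X_def\<close>)
      have Fi: "norm (F z $ i) \<le> S i * (M * (v + l ^ d i))" for i
      proof -
        have "norm (F z $ i) \<le> (\<Sum>b\<le>degree (Fp i). \<Sum>a\<le>degree (coeff (Fp i) b). norm (coeff (coeff (Fp i) b) a) * (M * (v + l ^ d i)))"
          unfolding Fp ev_expand2
        proof (intro sum_norm_le)
          fix a b
          show "norm (coeff (coeff (Fp i) b) a * fst z ^ a * snd z ^ b) \<le> norm (coeff (coeff (Fp i) b) a) * (M * (v + l ^ d i))"
          proof (cases "coeff (coeff (Fp i) b) a = 0")
            case False
            have wt: "w1 * a + w2 * b = d i"
              by (rule weighted_homogeneous_coeff[OF _ False]) (simp add: Fp[symmetric] hom)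
            have "a \<le> w1 * a" using w by simp
            then have "a \<le> K" using wt K[of i] by linarith
            then show ?thesis using mon[of a "d i" b] wt
              by (simp add: norm_mult norm_power X_def mult.assoc mult_left_mono)
          qed simp
        qed
        then show ?thesis by (simp add: S_def sum_distrib_right)
      qed
      have hi: "norm (h z $ i) \<le> (S i + N) * M * (v + l ^ d i)" for i
      proof -
        have "norm (h z $ i) \<le> norm (F z $ i) + norm (h z $ i - F z $ i)" using norm_triangle_sub by blast
        also have "norm (h z $ i - F z $ i) \<le> 1 * (N * (M * (v + l ^ d i)))"
          by (rule order_trans[OF e mult_mono[OF th1 Wi]]) (auto intro: weighted_sum_nonneg)
        finally show ?thesis using Fi[of i] by (simp add: algebra_simps)
      qed
      have ln: "l ^ d i2 = norm (snd z) ^ n" unfolding n l(3)[symmetric] by (simp add: power_mult[symmetric] mult.commute)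
      have r1: "norm (fst z) \<le> C2 * norm (h z $ i1)" if "snd z = 0"
        using XC that w by (simp add: X_def v_def l_def y_size_def power_0_left)
      have r3: "norm (h z $ i) \<le> ((\<Sum>i\<in>UNIV. S i) + N) * M * (norm (h z $ i1) + norm (snd z) ^ n)" if "d i2 \<le> d i" for i
      proof -
        have "l ^ d i \<le> l ^ d i2" using that l by (intro power_decreasing) auto
        moreover have "S i \<le> (\<Sum>i\<in>UNIV. S i)" using S0 by (intro member_le_sum) auto
        ultimately have "(S i + N) * M * (v + l ^ d i) \<le> ((\<Sum>i\<in>UNIV. S i) + N) * M * (v + l ^ d i2)"
          using M0 N1 S0[of i] v l by (intro mult_mono) auto
        then show ?thesis using hi[of i] unfolding ln v_def by linarith
      qed
      \<comment> \<open>only for \<open>v < 1\<close> are the powers of \<open>v\<close> at most \<open>v\<close>, but for \<open>v \<ge> 1\<close> the bound holds since \<open>norm y \<le> 1\<close>\<close>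
      have r2: "c / 2 * norm (snd z) ^ n \<le> norm (h z $ i2) + (c + SQ * M3 + N * M) * norm (h z $ i1)"
      proof (cases "v \<ge> 1")
        case True
        have "c / 2 * norm (snd z) ^ n \<le> c / 2 * 1" using c0 y1 by (intro mult_left_mono power_le_one) auto
        also have "\<dots> \<le> c * v" using True c0 mult_left_mono[of 1 v c] by linarith
        also have "\<dots> \<le> (c + SQ * M3 + N * M) * v" using SQ0 M0 N1 v by (intro mult_right_mono) auto
        finally show ?thesis using norm_ge_zero[of "h z $ i2"] unfolding v_def by linarith
      next
        case False
        have um: "norm u \<le> C3 * v + \<theta> * C3 * l ^ w1"
        proof -
          have "\<theta> * N * (X + l ^ w1) \<le> \<theta> * N * (C2 * (v + l ^ w1) + l ^ w1)"
            using XC th N1 by (intro mult_left_mono) auto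
          then have "norm u \<le> v + \<theta> * (N * C2 * v) + \<theta> * (N * (C2 + 1) * l ^ w1)" using uv by (simp add: algebra_simps)
          also have "\<theta> * (N * C2 * v) \<le> 1 * (N * (C2 + 1) * v)"
            using th th1 N1 C21 v by (intro mult_mono mult_nonneg_nonneg) auto
          also have "\<theta> * (N * (C2 + 1) * l ^ w1) \<le> \<theta> * (C3 * l ^ w1)"
            using th l1 by (intro mult_left_mono mult_right_mono) (auto simp: C3_def)
          finally show ?thesis by (simp add: C3_def algebra_simps)
        qed
        have ua: "norm u ^ a * norm (snd z) ^ b \<le> M3 * (v + \<theta> * norm (snd z) ^ n)"
          if a: "a \<noteq> 0" "a \<le> K" and wt: "w1 * a + w2 * b = d i2" for a b
        proof -
          have "norm u ^ a \<le> (C3 * v + \<theta> * C3 * l ^ w1) ^ a" using um by (intro power_mono) auto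
          also have "\<dots> \<le> 2 ^ a * ((C3 * v) ^ a + (\<theta> * C3 * l ^ w1) ^ a)"
            using C31 v th l1 by (intro power_sum_le) auto
          also have "\<dots> = (2 * C3) ^ a * (v ^ a + \<theta> ^ a * l ^ (w1 * a))"
            unfolding power_mult[of l w1 a] power_mult_distrib distrib_left by (simp add: mult_ac)
          also have "\<dots> \<le> M3 * (v ^ 1 + \<theta> ^ 1 * l ^ (w1 * a))"
            unfolding M3_def using C31 a v th th1 l False
            by (intro mult_mono power_increasing add_mono power_decreasing mult_nonneg_nonneg add_nonneg_nonneg) auto
          finally have "norm u ^ a * norm (snd z) ^ b \<le> M3 * (v + \<theta> * l ^ (w1 * a)) * norm (snd z) ^ b"
            by (intro mult_right_mono) auto
          also have "\<dots> = M3 * (v * norm (snd z) ^ b + \<theta> * l ^ (w1 * a + w2 * b))"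
            unfolding l(3)[symmetric] power_add power_mult[of l w2 b] distrib_left distrib_right by (simp only: mult.assoc)
          also have "\<dots> \<le> M3 * (v * 1 + \<theta> * l ^ (w1 * a + w2 * b))"
            using M0 v y1 th by (intro mult_left_mono add_mono power_le_one order_refl) auto
          finally show ?thesis using ln wt by simp
        qed
        obtain n' where n': "d i2 = n' * w2" "\<forall>y. F (straighten (0, y)) $ i2 = axis_coeff i2 * y ^ n'" using axis_power[OF ac] by blast
        have "n' = n" using n n'(1) w by simp
        then have ax: "ev (straight_poly i2) (0, snd z) = axis_coeff i2 * snd z ^ n" using n'(2) by (simp add: ev_straight_poly[symmetric])
        have Fz: "F z $ i2 = ev (straight_poly i2) (u, snd z)" unfolding ev_straight_poly[symmetric] u_def straighten_inverse ..
        have "ev (straight_poly i2) (u, snd z) - ev (straight_poly i2) (0, snd z) =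
            (\<Sum>b\<le>degree (straight_poly i2). \<Sum>a\<le>degree (coeff (straight_poly i2) b). coeff (coeff (straight_poly i2) b) a * (u ^ a - 0 ^ a) * snd z ^ b)"
          by (simp add: ev_expand2 sum_subtractf algebra_simps)
        also have "norm \<dots> \<le> (\<Sum>b\<le>degree (straight_poly i2). \<Sum>a\<le>degree (coeff (straight_poly i2) b). norm (coeff (coeff (straight_poly i2) b) a) * (M3 * (v + \<theta> * norm (snd z) ^ n)))"
        proof (intro sum_norm_le)
          fix a b
          show "norm (coeff (coeff (straight_poly i2) b) a * (u ^ a - 0 ^ a) * snd z ^ b) \<le> norm (coeff (coeff (straight_poly i2) b) a) * (M3 * (v + \<theta> * norm (snd z) ^ n))"
          proof (cases "coeff (coeff (straight_poly i2) b) a = 0 \<or> a = 0")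
            case True
            then show ?thesis using M0 v th by (auto intro!: mult_nonneg_nonneg add_nonneg_nonneg)
          next
            case False
            then have wt: "w1 * a + w2 * b = d i2" using straight_poly_weights by blast
            have "a \<le> w1 * a" using w by simp
            then have "a \<le> K" using wt K[of i2] by linarith
            then show ?thesis using ua[of a b] wt False
              by (simp add: norm_mult norm_power power_0_left mult.assoc mult_left_mono)
          qed
        qed
        finally have diff: "norm (F z $ i2 - axis_coeff i2 * snd z ^ n) \<le> SQ * (M3 * (v + \<theta> * norm (snd z) ^ n))"
          unfolding Fz ax by (simp add: SQ_def sum_distrib_right)
        have "norm (axis_coeff i2 * snd z ^ n) \<le> norm (F z $ i2) + norm (F z $ i2 - axis_coeff i2 * snd z ^ n)"
          using norm_triangle_ineq4[of "F z $ i2" "F z $ i2 - axis_coeff i2 * snd z ^ n"] by simp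
        moreover have "norm (F z $ i2) \<le> norm (h z $ i2) + norm (h z $ i2 - F z $ i2)"
          using norm_triangle_ineq4[of "h z $ i2" "h z $ i2 - F z $ i2"] by simp
        moreover have "norm (h z $ i2 - F z $ i2) \<le> \<theta> * (N * (M * (v + norm (snd z) ^ n)))"
          using order_trans[OF e[of i2] mult_left_mono[OF Wi]] th unfolding ln by simp
        ultimately have "c * norm (snd z) ^ n \<le> norm (h z $ i2) + \<theta> * (N * (M * (v + norm (snd z) ^ n))) + SQ * (M3 * (v + \<theta> * norm (snd z) ^ n))"
          using diff by (simp add: c_def norm_mult norm_power)
        also have "\<dots> = norm (h z $ i2) + (\<theta> * (N * M) + SQ * M3) * v + \<theta> * (SQ * M3 + N * M) * norm (snd z) ^ n"
          by (simp add: algebra_simps)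
        also have "\<dots> \<le> norm (h z $ i2) + (c + SQ * M3 + N * M) * v + c / 2 * norm (snd z) ^ n"
        proof -
          have "\<theta> * (N * M) \<le> 1 * (N * M)" using th1 N1 M0 by (intro mult_right_mono) auto
          then have "\<theta> * (N * M) + SQ * M3 \<le> c + SQ * M3 + N * M" using c0 by linarith
          from mult_right_mono[OF this v] mult_right_mono[OF thc, of "norm (snd z) ^ n"] show ?thesis by simp
        qed
        finally show ?thesis unfolding v_def by (simp add: algebra_simps)
      qed
      note r1 r2 r3
    }
    note main = this
    define C where "C = max ((\<Sum>i\<in>UNIV. S i) + N) (c + SQ * M3 + N * M) * M"
    have Sn: "0 \<le> (\<Sum>i\<in>UNIV. S i) + N" using S0 N1 by (intro add_nonneg_nonneg sum_nonneg) auto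
    have C0: "C \<ge> 0" unfolding C_def using Sn M0 by (intro mult_nonneg_nonneg) auto
    have Ca: "((\<Sum>i\<in>UNIV. S i) + N) * M \<le> C" unfolding C_def using M0 by (intro mult_right_mono) auto
    have Cb: "c + SQ * M3 + N * M \<le> C"
    proof -
      have "max ((\<Sum>i\<in>UNIV. S i) + N) (c + SQ * M3 + N * M) * 1 \<le> C" unfolding C_def using Sn M0 by (intro mult_left_mono) auto
      then show ?thesis by simp
    qed
    define k where "k = min (1 / C2) (c / 2)"
    have k: "k > 0" using C21 c0 by (simp add: k_def)
    have k1: "k * C2 \<le> 1"
    proof -
      have "k \<le> 1 / C2" by (simp add: k_def)
      then show ?thesis using C21 by (simp add: pos_le_divide_eq)
    qed
    show "\<exists>k>0. \<exists>C\<ge>0.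
       (\<forall>\<^sub>F z in nhds 0. snd z = 0 \<longrightarrow> k * norm (fst z) \<le> norm (h z $ i1)) \<and>
       (\<forall>\<^sub>F z in nhds 0. k * norm (snd z) ^ n \<le> norm (h z $ i2) + C * norm (h z $ i1)) \<and>
       (\<forall>i. d i2 \<le> d i \<longrightarrow> (\<forall>\<^sub>F z in nhds 0. norm (h z $ i) \<le> C * (norm (h z $ i1) + norm (snd z) ^ n)))"
    proof (rule exI[of _ k], rule conjI[OF k], rule exI[of _ C], rule conjI[OF C0], intro conjI allI impI)
      show "\<forall>\<^sub>F z in nhds 0. snd z = 0 \<longrightarrow> k * norm (fst z) \<le> norm (h z $ i1)"
      proof (rule near, rule impI)
        fix z :: "complex \<times> complex"
        assume e: "\<And>i. norm (h z $ i - F z $ i) \<le> \<theta> * weighted_sum w1 w2 (d i) K (fst z) (snd z)"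
          and b: "norm (fst z) \<le> 1" "norm (snd z) \<le> 1" "snd z = 0"
        have "k * norm (fst z) \<le> k * (C2 * norm (h z $ i1))" using main(1)[OF e b] k by (intro mult_left_mono) auto
        also have "\<dots> \<le> 1 * norm (h z $ i1)" unfolding mult.assoc[symmetric] by (rule mult_right_mono[OF k1]) simp
        finally show "k * norm (fst z) \<le> norm (h z $ i1)" by simp
      qed
      show "\<forall>\<^sub>F z in nhds 0. k * norm (snd z) ^ n \<le> norm (h z $ i2) + C * norm (h z $ i1)"
      proof (rule near)
        fix z :: "complex \<times> complex"
        assume e: "\<And>i. norm (h z $ i - F z $ i) \<le> \<theta> * weighted_sum w1 w2 (d i) K (fst z) (snd z)"
          and b: "norm (fst z) \<le> 1" "norm (snd z) \<le> 1"
        have "k * norm (snd z) ^ n \<le> c / 2 * norm (snd z) ^ n" by (rule mult_right_mono) (auto simp: k_def)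
        moreover have "(c + SQ * M3 + N * M) * norm (h z $ i1) \<le> C * norm (h z $ i1)" using Cb by (rule mult_right_mono) simp
        ultimately show "k * norm (snd z) ^ n \<le> norm (h z $ i2) + C * norm (h z $ i1)"
          using main(2)[OF e b] by linarith
      qed
      fix i assume i: "d i2 \<le> d i"
      show "\<forall>\<^sub>F z in nhds 0. norm (h z $ i) \<le> C * (norm (h z $ i1) + norm (snd z) ^ n)"
      proof (rule near)
        fix z :: "complex \<times> complex"
        assume e: "\<And>i. norm (h z $ i - F z $ i) \<le> \<theta> * weighted_sum w1 w2 (d i) K (fst z) (snd z)"
          and b: "norm (fst z) \<le> 1" "norm (snd z) \<le> 1"
        show "norm (h z $ i) \<le> C * (norm (h z $ i1) + norm (snd z) ^ n)"
          by (rule order_trans[OF main(3)[OF e b i] mult_right_mono[OF Ca]]) simp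
      qed
    qed
  qed
qed

end

section \<open>Multiplicity along a family\<close>

lemma smooth_fst_bound:
  assumes hu: "\<forall>\<^sub>F z in nhds 0. holo2_at u z" and u0: "u 0 = 0"
    and k: "k > 0" and x1: "\<forall>\<^sub>F z in nhds 0. snd z = 0 \<longrightarrow> k * norm (fst z) \<le> norm (u z)"
  obtains a b C where "(u has_derivative (\<lambda>v. a * fst v + b * snd v)) (at 0)" "a \<noteq> 0" "C > 0"
    "\<forall>\<^sub>F z in nhds 0. norm (fst z) \<le> C * (norm (u z) + norm (snd z))"
proof -
  obtain a b where du: "(u has_derivative (\<lambda>v. a * fst v + b * snd v)) (at 0)"
    using eventually_nhds_x_imp_x[OF hu] unfolding holo2_at_def by blast
  have a: "a \<noteq> 0" by (rule fst_derivative_nonzero[OF hu u0 du k x1])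
  have na: "norm a > 0" using a by simp
  then obtain t where t: "t > 0" "\<And>x x' y y'. norm x < t \<Longrightarrow> norm x' < t \<Longrightarrow> norm y < t \<Longrightarrow> norm y' < t \<Longrightarrow>
    norm (u (x, y) - u (x', y') - a * (x - x') - b * (y - y')) \<le> norm a / 2 * (norm (x - x') + norm (y - y'))"
    using strict_derivative[OF hu du, of "norm a / 2"] by auto
  define C where "C = 2 / norm a * (1 + norm b + norm a)"
  have C: "C > 0" unfolding C_def using na by (intro mult_pos_pos divide_pos_pos add_pos_nonneg add_pos_pos add_nonneg_pos) auto
  have "norm x \<le> C * (norm (u (x, y)) + norm y)" if "norm x < t" "norm y < t" for x y
  proof -
    have "norm (u (x, y) - a * x - b * y) \<le> norm a / 2 * (norm x + norm y)"
      using t(2)[of x 0 y 0] that t(1) u0 by (simp add: zero_prod_def)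
    moreover have "norm (a * x) \<le> norm (u (x, y)) + norm (b * y) + norm (u (x, y) - a * x - b * y)"
      using norm_triangle_ineq4[of "u (x, y) - b * y" "u (x, y) - a * x - b * y"] norm_triangle_ineq4[of "u (x, y)" "b * y"] by simp
    ultimately have "norm a / 2 * norm x \<le> norm (u (x, y)) + (norm b + norm a / 2) * norm y"
      by (simp add: norm_mult algebra_simps)
    also have "\<dots> \<le> (1 + norm b + norm a) * norm (u (x, y)) + (1 + norm b + norm a) * norm y"
      by (intro add_mono mult_right_mono) (auto simp: mult_le_cancel_right1)
    finally show ?thesis using na by (simp add: C_def field_simps)
  qed
  then have "\<forall>\<^sub>F z in nhds 0. norm (fst z) \<le> C * (norm (u z) + norm (snd z))"
    unfolding nhds0_box using t(1) by (intro exI[of _ t]) auto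
  then show thesis using that du a C by blast
qed

lemma first_order_bound:
  assumes hu: "\<forall>\<^sub>F z in nhds 0. holo2_at u z" and u0: "u 0 = 0"
    and k: "k > 0" and x1: "\<forall>\<^sub>F z in nhds 0. snd z = 0 \<longrightarrow> k * norm (fst z) \<le> norm (u z)"
    and hq: "\<forall>\<^sub>F z in nhds 0. holo2_at q z" and q0: "q 0 = 0"
  shows "\<exists>C\<ge>0. \<forall>\<^sub>F z in nhds 0. norm (q z) \<le> C * (norm (u z) + norm (snd z) ^ 1)"
proof -
  obtain C where C: "C > 0" "\<forall>\<^sub>F z in nhds 0. norm (fst z) \<le> C * (norm (u z) + norm (snd z))"
    using smooth_fst_bound[OF hu u0 k x1] by metis
  obtain a b where dq: "(q has_derivative (\<lambda>v. a * fst v + b * snd v)) (at 0)"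
    using eventually_nhds_x_imp_x[OF hq] unfolding holo2_at_def by blast
  obtain t where t: "t > 0" "\<And>x x' y y'. norm x < t \<Longrightarrow> norm x' < t \<Longrightarrow> norm y < t \<Longrightarrow> norm y' < t \<Longrightarrow>
    norm (q (x, y) - q (x', y') - a * (x - x') - b * (y - y')) \<le> 1 * (norm (x - x') + norm (y - y'))"
    using strict_derivative[OF hq dq, of 1] by auto
  define M where "M = 1 + norm a + norm b"
  have M: "M \<ge> 0" by (simp add: M_def)
  have "\<forall>\<^sub>F z in nhds 0. norm (q z) \<le> M * (norm (fst z) + norm (snd z))"
    unfolding nhds0_box
  proof (intro exI[of _ t] conjI allI impI)
    fix x y :: complex assume "norm x < t" "norm y < t"
    then have "norm (q (x, y) - a * x - b * y) \<le> norm x + norm y" using t(2)[of x 0 y 0] t(1) q0 by (simp add: zero_prod_def)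
    moreover have "norm (q (x, y)) \<le> norm (q (x, y) - a * x - b * y) + norm (a * x) + norm (b * y)"
      using norm_triangle_ineq[of "q (x, y) - a * x - b * y" "a * x + b * y"] norm_triangle_ineq[of "a * x" "b * y"] by simp
    ultimately show "norm (q (x, y)) \<le> M * (norm (fst (x, y)) + norm (snd (x, y)))"
      by (simp add: M_def norm_mult algebra_simps) (smt (verit) mult_nonneg_nonneg norm_ge_zero)
  qed (rule t)
  with C(2) have "\<forall>\<^sub>F z in nhds 0. norm (q z) \<le> M * (C + 1) * (norm (u z) + norm (snd z) ^ 1)"
  proof eventually_elim
    case (elim z)
    have "norm (fst z) + norm (snd z) \<le> (C + 1) * (norm (u z) + norm (snd z))"
    proof -
      have "(C + 1) * (norm (u z) + norm (snd z)) = C * (norm (u z) + norm (snd z)) + (norm (u z) + norm (snd z))"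
        by (simp add: distrib_right)
      then show ?thesis using elim(1) norm_ge_zero[of "u z"] by linarith
    qed
    then have "M * (norm (fst z) + norm (snd z)) \<le> M * ((C + 1) * (norm (u z) + norm (snd z)))"
      using M by (rule mult_left_mono)
    then show ?case using elim(2) by (simp add: mult.assoc)
  qed
  then show ?thesis using M C(1) by (intro exI[of _ "M * (C + 1)"]) auto
qed

text \<open>
  If the linear part of the component \<open>i3\<close> were not a multiple of that of the component \<open>i1\<close>, then \<open>h\<close> would
  be an immersion and injective near 0. So a difference \<open>r\<close> of the component \<open>i3\<close> and a multiple of the
  component \<open>i1\<close> has no linear part, and \<open>x\<close> is bounded by the component \<open>i1\<close> and \<open>y\<close>.
\<close>

lemma second_order_bound:
  fixes h :: "complex \<times> complex \<Rightarrow> complex^3"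
  assumes holo: "\<And>i. \<forall>\<^sub>F z in nhds 0. holo2_at (\<lambda>z. h z $ i) z" and h0: "h 0 = 0"
    and k: "k > 0" and x1: "\<forall>\<^sub>F z in nhds 0. snd z = 0 \<longrightarrow> k * norm (fst z) \<le> norm (h z $ i1)"
    and ninj: "\<And>T. open T \<Longrightarrow> 0 \<in> T \<Longrightarrow> \<not> inj_on h T"
  shows "\<exists>C\<ge>0. \<forall>\<^sub>F z in nhds 0. norm (h z $ i3) \<le> C * (norm (h z $ i1) + norm (snd z) ^ 2)"
proof -
  define u where "u = (\<lambda>z. h z $ i1)"
  define q where "q = (\<lambda>z. h z $ i3)"
  have hu: "\<forall>\<^sub>F z in nhds 0. holo2_at u z" and hq: "\<forall>\<^sub>F z in nhds 0. holo2_at q z"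
    using holo by (simp_all add: u_def q_def)
  have u0: "u 0 = 0" "q 0 = 0" using h0 by (simp_all add: u_def q_def)
  obtain a b C where du: "(u has_derivative (\<lambda>v. a * fst v + b * snd v)) (at 0)" and a: "a \<noteq> 0" and C: "C > 0"
    "\<forall>\<^sub>F z in nhds 0. norm (fst z) \<le> C * (norm (u z) + norm (snd z))"
    by (rule smooth_fst_bound[OF hu u0(1) k]) (use x1 in \<open>simp_all add: u_def\<close>)
  obtain a3 b3 where dq: "(q has_derivative (\<lambda>v. a3 * fst v + b3 * snd v)) (at 0)"
    using eventually_nhds_x_imp_x[OF hq] unfolding holo2_at_def by blast
  define \<kappa> where "\<kappa> = a3 / a"
  define r where "r = (\<lambda>z. q z - \<kappa> * u z)"
  define b' where "b' = b3 - \<kappa> * b"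
  have hr: "\<forall>\<^sub>F z in nhds 0. holo2_at r z"
    using hq hu unfolding r_def by eventually_elim (intro holo2_at_intros)
  have dr: "(r has_derivative (\<lambda>v. 0 * fst v + b' * snd v)) (at 0)"
  proof -
    have "(r has_derivative (\<lambda>v. (a3 * fst v + b3 * snd v) - \<kappa> * (a * fst v + b * snd v))) (at 0)"
      unfolding r_def by (intro has_derivative_diff has_derivative_mult_right dq du)
    then show ?thesis using a by (simp add: \<kappa>_def b'_def algebra_simps)
  qed
  have b'0: "b' = 0"
  proof (rule ccontr)
    assume b': "b' \<noteq> 0"
    define A where "A = 1 + 1 / norm b' + (1 + norm b / norm b') / norm a"
    have A: "A \<ge> 1" unfolding A_def by simp
    define e where "e = 1 / (2 * A)"
    have e: "e > 0" using A by (simp add: e_def)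
    obtain t1 where t1: "t1 > 0" "\<And>x x' y y'. norm x < t1 \<Longrightarrow> norm x' < t1 \<Longrightarrow> norm y < t1 \<Longrightarrow> norm y' < t1 \<Longrightarrow>
      norm (u (x, y) - u (x', y') - a * (x - x') - b * (y - y')) \<le> e * (norm (x - x') + norm (y - y'))"
      using strict_derivative[OF hu du e] by auto
    obtain t2 where t2: "t2 > 0" "\<And>x x' y y'. norm x < t2 \<Longrightarrow> norm x' < t2 \<Longrightarrow> norm y < t2 \<Longrightarrow> norm y' < t2 \<Longrightarrow>
      norm (r (x, y) - r (x', y') - 0 * (x - x') - b' * (y - y')) \<le> e * (norm (x - x') + norm (y - y'))"
      using strict_derivative[OF hr dr e] by auto
    have "inj_on h (ball 0 (min t1 t2) \<times> ball 0 (min t1 t2))"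
    proof (rule inj_onI)
      fix z z' assume zz: "z \<in> ball 0 (min t1 t2) \<times> ball 0 (min t1 t2)" "z' \<in> ball 0 (min t1 t2) \<times> ball 0 (min t1 t2)" "h z = h z'"
      obtain x y x' y' where z: "z = (x, y)" "z' = (x', y')" by (cases z, cases z')
      define X Y where "X = norm (x - x')" "Y = norm (y - y')"
      note XY = this
      have eq: "u (x, y) = u (x', y')" "r (x, y) = r (x', y')" using zz(3) by (simp_all add: u_def r_def q_def z)
      have 1: "norm (a * (x - x') + b * (y - y')) \<le> e * (X + Y)"
      proof -
        have "norm (- (a * (x - x') + b * (y - y'))) \<le> e * (X + Y)" using t1(2)[of x x' y y'] zz(1,2) eq by (simp add: z XY)
        then show ?thesis by (simp only: norm_minus_cancel)
      qed
      have 2: "norm b' * Y \<le> e * (X + Y)" using t2(2)[of x x' y y'] zz(1,2) eq by (simp add: z XY norm_mult)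
      have nb: "norm b' > 0" "norm a > 0" using b' a by auto
      have Y: "Y \<le> e * (X + Y) / norm b'" using 2 nb by (simp add: pos_le_divide_eq mult.commute)
      have "norm a * X \<le> e * (X + Y) + norm b * Y"
        using norm_triangle_ineq4[of "a * (x - x') + b * (y - y')" "b * (y - y')"] 1 by (simp add: norm_mult XY)
      also have "norm b * Y \<le> norm b * (e * (X + Y) / norm b')" using Y by (intro mult_left_mono) auto
      finally have "norm a * X \<le> e * (X + Y) * (1 + norm b / norm b')" by (simp add: algebra_simps add_divide_distrib)
      then have "X \<le> e * (X + Y) * (1 + norm b / norm b') / norm a" using nb by (simp add: pos_le_divide_eq mult.commute)
      then have "X + Y \<le> e * (X + Y) * (A - 1)" using Y by (simp add: A_def algebra_simps add_divide_distrib)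
      also have "\<dots> \<le> e * (X + Y) * A" using e by (intro mult_left_mono) (auto simp: XY)
      also have "\<dots> = (X + Y) / 2" using A by (simp add: e_def)
      finally have "X + Y \<le> 0" by simp
      then have "X = 0" "Y = 0" using norm_ge_zero[of "x - x'"] norm_ge_zero[of "y - y'"] unfolding XY by linarith+
      then show "z = z'" by (simp add: XY z)
    qed
    moreover have "open (ball (0::complex) (min t1 t2) \<times> ball (0::complex) (min t1 t2))" by (intro open_Times open_ball)
    moreover have "(0::complex\<times>complex) \<in> ball 0 (min t1 t2) \<times> ball 0 (min t1 t2)" using t1(1) t2(1) by (simp add: zero_prod_def)
    ultimately show False using ninj[of "ball 0 (min t1 t2) \<times> ball 0 (min t1 t2)"] by simp
  qed
  obtain R M where R: "R > 0" "sep_holo r R M" using sep_holo_ev[OF hr] by blast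
  have dr0: "(r has_derivative (\<lambda>v. 0 * fst v + 0 * snd v)) (at (0, 0))" using dr b'0 by (simp add: zero_prod_def)
  have coeffs: "2 \<le> 1 * a + 1 * b" if nz: "power_coeff (\<lambda>x. power_coeff (\<lambda>y. r (x, y)) b) a \<noteq> 0" for a b :: nat
  proof (rule ccontr)
    assume "\<not> 2 \<le> 1 * a + 1 * b"
    then consider "a = 0" "b = 0" | "a = 1" "b = 0" | "a = 0" "b = 1" by linarith
    then show False
    proof cases
      case 1 then show ?thesis using nz u0 by (simp add: power_coeff_def r_def zero_prod_def)
    next
      case 2
      have "deriv (\<lambda>x. r (x, 0)) 0 = 0" using slice_fst[OF dr0] by (rule DERIV_imp_deriv)
      then show ?thesis using nz 2 by (simp add: power_coeff_def)
    next
      case 3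
      have "deriv (\<lambda>y. r (0, y)) 0 = 0" using slice_snd[OF dr0] by (rule DERIV_imp_deriv)
      then show ?thesis using nz 3 by (simp add: power_coeff_def)
    qed
  qed
  have M0: "M \<ge> 0" using R norm_ge_zero[of "r (0, 0)"] unfolding sep_holo_def
    by (metis norm_zero order_trans)
  define B where "B = 2 * (1 + 2/R)^(2*2) * M"
  have B: "B \<ge> 0" using M0 R by (simp add: B_def)
  have rb: "norm (r (x, y)) \<le> 9 * B * (norm x ^ 2 + norm y ^ 2)" if xy: "norm x < min 1 (R/4)" "norm y < min 1 (R/4)" for x y
  proof -
    have "norm (r (x, y)) \<le> B * weighted_sum 1 1 2 2 x y" unfolding B_def
      by (rule weighted_bound[OF R(2,1) coeffs]) (use xy in auto)
    also have "weighted_sum 1 1 2 2 x y \<le> real (2 + 1) ^ 2 * (norm x ^ 2 + norm y ^ 2)"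
    proof (rule weighted_sum_le)
      fix a b :: nat assume ab: "a \<le> 2" "b \<le> 2" "2 \<le> 1 * a + 1 * b"
      have x2: "norm x ^ a \<le> 1" "norm y ^ b \<le> 1" using xy by (auto intro!: power_le_one)
      show "norm x ^ a * norm y ^ b \<le> norm x ^ 2 + norm y ^ 2"
      proof (cases "a = 2 \<or> b = 2")
        case True
        then show ?thesis
        proof
          assume "a = 2"
          then have "norm x ^ a * norm y ^ b \<le> norm x ^ 2 * 1" using x2 by (intro mult_mono) auto
          then show ?thesis using zero_le_power2[of "norm y"] by linarith
        next
          assume "b = 2"
          then have "norm x ^ a * norm y ^ b \<le> 1 * norm y ^ 2" using x2 by (intro mult_mono) auto
          then show ?thesis using zero_le_power2[of "norm x"] by linarith
        qed
      next
        case False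
        then have "a = 1" "b = 1" using ab by linarith+
        moreover have "norm x * norm y \<le> 2 * norm x * norm y" by simp
        ultimately show ?thesis using order_trans[OF _ sum_squares_bound[of "norm x" "norm y"]] by simp
      qed
    qed simp
    finally show ?thesis using B by (simp add: mult_left_mono) (simp add: algebra_simps)
  qed
  have "\<forall>\<^sub>F z in nhds 0. norm (r z) \<le> 9 * B * (norm (fst z) ^ 2 + norm (snd z) ^ 2)"
    unfolding nhds0_box using R(1) rb by (intro exI[of _ "min 1 (R/4)"]) auto
  moreover have "\<forall>\<^sub>F z in nhds 0. dist (u z) (u 0) < 1"
    by (rule isCont_eventually_dist[OF holo2_at_isCont[OF eventually_nhds_x_imp_x[OF hu]]]) simp
  ultimately have "\<forall>\<^sub>F z in nhds 0. norm (q z) \<le> (norm \<kappa> + 9 * B * (2 ^ 2 * C ^ 2 + 1)) * (norm (u z) + norm (snd z) ^ 2)"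
    using C(2)
  proof eventually_elim
    case (elim z)
    define s where "s = norm (u z)"
    define y where "y = norm (snd z)"
    have s: "0 \<le> s" "s \<le> 1" "0 \<le> y" using elim(2) u0 by (auto simp: s_def y_def)
    have "norm (fst z) ^ 2 \<le> (C * (s + y)) ^ 2" using elim(3) by (intro power_mono) (auto simp: s_def y_def)
    also have "\<dots> \<le> C ^ 2 * (2 ^ 2 * (s ^ 2 + y ^ 2))"
      unfolding power_mult_distrib using s by (intro mult_left_mono power_sum_le) auto
    also have "\<dots> \<le> C ^ 2 * (2 ^ 2 * (s + y ^ 2))"
      using s power_decreasing[of 1 2 s] by (intro mult_left_mono add_mono) auto
    finally have "norm (fst z) ^ 2 + y ^ 2 \<le> (2 ^ 2 * C ^ 2 + 1) * (s + y ^ 2)" using s by (simp add: algebra_simps)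
    then have "norm (r z) \<le> 9 * B * ((2 ^ 2 * C ^ 2 + 1) * (s + y ^ 2))"
      using B by (intro order_trans[OF elim(1)[folded y_def] mult_left_mono]) auto
    moreover have "norm (q z) \<le> norm (r z) + norm \<kappa> * s"
      using norm_triangle_ineq[of "r z" "\<kappa> * u z"] by (simp add: r_def s_def norm_mult)
    moreover have "norm \<kappa> * s \<le> norm \<kappa> * (s + y ^ 2)" by (rule mult_left_mono) auto
    moreover have "(norm \<kappa> + 9 * B * (2 ^ 2 * C ^ 2 + 1)) * (s + y ^ 2)
        = norm \<kappa> * (s + y ^ 2) + 9 * B * ((2 ^ 2 * C ^ 2 + 1) * (s + y ^ 2))"
      by (simp add: algebra_simps)
    ultimately show ?case unfolding s_def[symmetric] y_def[symmetric] by linarith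
  qed
  then show ?thesis unfolding u_def q_def using B
    by (intro exI[of _ "norm \<kappa> + 9 * B * (2 ^ 2 * C ^ 2 + 1)"] conjI) auto
qed

context quasihomogeneous_germ
begin

lemma F_holo: "holo2_at (\<lambda>z. F z $ i) z"
  unfolding Fp by (intro polyfun2_holo polyfun2_ev)

text \<open>
  If \<open>d i2 \<le> d i3\<close>, the weights bound the component \<open>i3\<close> on the curve where the first component vanishes.
  Otherwise \<open>n < 3\<close>, and the required bound is of first order or follows from the failure of injectivity,
  which \<open>h\<close> shares with \<open>F\<close>. The number \<open>n\<close> depends on \<open>F\<close> only.
\<close>

lemma multiplicity_of_perturbation:
  assumes det: "finitely_determined2 F" and K: "\<And>i. d i \<le> K"
    and ac: "axis_coeff i2 \<noteq> 0" and order: "axis_coeff i3 = 0 \<or> d i2 \<le> d i3"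
  shows "\<exists>n. \<exists>\<theta>>0. \<forall>h. weight_close K \<theta> h \<longrightarrow>
     (\<forall>i. \<forall>\<^sub>F z in nhds 0. holo2_at (\<lambda>z. h z $ i) z) \<longrightarrow> h 0 = 0 \<longrightarrow>
     (\<exists>\<eta> \<eta>'. fibre_equivalence \<eta> \<eta>' h F) \<longrightarrow> (\<forall>\<^sub>F r in at_right 0. has_multiplicity (h ` ball 0 r) n)"
proof -
  obtain n where n: "n > 0" "d i2 = n * w2" using axis_power[OF ac] by blast
  obtain \<theta> where th: "\<theta> > 0" "\<And>h. weight_close K \<theta> h \<Longrightarrow>
     (\<exists>k>0. \<exists>C\<ge>0.
       (\<forall>\<^sub>F z in nhds 0. snd z = 0 \<longrightarrow> k * norm (fst z) \<le> norm (h z $ i1)) \<and>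
       (\<forall>\<^sub>F z in nhds 0. k * norm (snd z) ^ n \<le> norm (h z $ i2) + C * norm (h z $ i1)) \<and>
       (\<forall>i. d i2 \<le> d i \<longrightarrow> (\<forall>\<^sub>F z in nhds 0. norm (h z $ i) \<le> C * (norm (h z $ i1) + norm (snd z) ^ n))))"
    using perturbation_estimates[OF ac n(2) K] by blast
  obtain T0 where T0: "open T0" "0 \<in> T0" "interior (self_intersecting F T0) = {}"
    using generically_injective[OF det ac] by blast
  have "\<forall>\<^sub>F r in at_right 0. has_multiplicity (h ` ball 0 r) n"
    if e: "\<forall>i. \<forall>\<^sub>F z in nhds 0. norm (h z $ i - F z $ i) \<le> \<theta> * weighted_sum w1 w2 (d i) K (fst z) (snd z)"
      and holo: "\<forall>i. \<forall>\<^sub>F z in nhds 0. holo2_at (\<lambda>z. h z $ i) z" and h0: "h 0 = 0"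
      and fe: "fibre_equivalence \<eta> \<eta>' h F" for h :: "complex \<times> complex \<Rightarrow> complex^3" and \<eta> \<eta>'
  proof -
    obtain k C where k: "k > 0" and C: "C \<ge> 0"
      and x1: "\<forall>\<^sub>F z in nhds 0. snd z = 0 \<longrightarrow> k * norm (fst z) \<le> norm (h z $ i1)"
      and lo: "\<forall>\<^sub>F z in nhds 0. k * norm (snd z) ^ n \<le> norm (h z $ i2) + C * norm (h z $ i1)"
      and up: "\<And>i. d i2 \<le> d i \<Longrightarrow> \<forall>\<^sub>F z in nhds 0. norm (h z $ i) \<le> C * (norm (h z $ i1) + norm (snd z) ^ n)"
      using th(2)[OF e] by blast
    have hol: "\<forall>\<^sub>F z in nhds 0. holo2_at (\<lambda>z. h z $ i) z" for i using holo by blast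
    have hi0: "h 0 $ i = 0" for i using h0 by simp
    obtain T where T: "open T" "0 \<in> T" "interior (self_intersecting h T) = {}"
      using self_intersecting_transfer[OF fe T0] by blast
    have "\<exists>C3\<ge>0. \<forall>\<^sub>F z in nhds 0. norm (h z $ i3) \<le> C3 * (norm (h z $ i1) + norm (snd z) ^ n)"
    proof (cases "d i2 \<le> d i3")
      case True then show ?thesis using up C by blast
    next
      case False
      then have ac3: "axis_coeff i3 = 0" using order by blast
      have "n < 3" by (rule no_multiple_axis[OF det ac ac3 n(2)])
      then consider "n = 1" | "n = 2" using n(1) by linarith
      then show ?thesis
      proof cases
        case 1
        then show ?thesis using first_order_bound[OF hol hi0 k x1 hol hi0, of i3] by simp
      next
        case 2
        have "\<not> inj_on h S" if "open S" "0 \<in> S" for S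
          using injective_transfer[OF fe that] not_injective[OF ac ac3] n(2) 2 by blast
        then show ?thesis using second_order_bound[OF hol h0 k x1, of i3] 2 by simp
      qed
    qed
    then obtain C3 where C3: "C3 \<ge> 0" "\<forall>\<^sub>F z in nhds 0. norm (h z $ i3) \<le> C3 * (norm (h z $ i1) + norm (snd z) ^ n)" by blast
    define M where "M = C + C3"
    have M: "M \<ge> 0" "C \<le> M" "C3 \<le> M" using C C3 by (auto simp: M_def)
    show ?thesis
    proof (rule holo2_image_multiplicity[OF hol h0 idx k M(1) n(1) x1 _ _ _ T])
      show "\<forall>\<^sub>F z in nhds 0. k * norm (snd z) ^ n \<le> norm (h z $ i2) + M * norm (h z $ i1)"
        using lo by eventually_elim (smt (verit) M(2) mult_right_mono norm_ge_zero)
      have mono: "c * (norm (h z $ i1) + norm (snd z) ^ n) \<le> M * (norm (h z $ i1) + norm (snd z) ^ n)" if "c \<le> M" for c z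
        using that by (intro mult_right_mono) auto
      show "\<forall>\<^sub>F z in nhds 0. norm (h z $ i2) \<le> M * (norm (h z $ i1) + norm (snd z) ^ n)"
        using up[of i2, OF order_refl] by eventually_elim (use mono[OF M(2)] order_trans in blast)
      show "\<forall>\<^sub>F z in nhds 0. norm (h z $ i3) \<le> M * (norm (h z $ i1) + norm (snd z) ^ n)"
        using C3(2) by eventually_elim (use mono[OF M(3)] order_trans in blast)
    qed
  qed
  then show ?thesis using th(1) by (intro exI[of _ n] exI[of _ \<theta>]) blast
qed

end

lemma quasihomogeneous_germ_swap:
  assumes "quasihomogeneous_germ F Fp d w1 w2 i1 i2 i3 \<alpha>"
  shows "quasihomogeneous_germ F Fp d w1 w2 i1 i3 i2 \<alpha>"
proof -
  interpret quasihomogeneous_germ F Fp d w1 w2 i1 i2 i3 \<alpha> by fact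
  show ?thesis
    by unfold_locales ((rule Fp F0 w hom idx d1 \<alpha> lin idx(3)[symmetric]) | (use idx(4) in blast))+
qed

text \<open>
  Exchanging the components \<open>i2\<close> and \<open>i3\<close>, if necessary, makes the constant of \<open>i2\<close> nonzero and its degree
  least among the components with nonzero constant. For small \<open>t\<close> the member \<open>H t\<close> is as close to \<open>F\<close> as
  \<open>multiplicity_of_perturbation\<close> requires, and so is \<open>F\<close> itself.
\<close>

theorem (in quasihomogeneous_germ) family_equimultiple:
  fixes H :: "complex \<Rightarrow> complex \<times> complex \<Rightarrow> complex^3"
  assumes det: "finitely_determined2 F" and K: "\<And>i. d i \<le> K"
    and H: "\<And>\<theta>. \<theta> > 0 \<Longrightarrow> \<forall>\<^sub>F t in nhds 0. weight_close K \<theta> (H t)"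
    and holo: "\<forall>\<^sub>F t in nhds (0::complex). \<forall>i. \<forall>\<^sub>F z in nhds 0. holo2_at (\<lambda>z. H t z $ i) z"
    and H0: "\<forall>\<^sub>F t in nhds 0. H t 0 = 0"
    and fe: "\<forall>\<^sub>F t in nhds 0. \<exists>\<eta> \<eta>'. fibre_equivalence \<eta> \<eta>' (H t) F"
  shows "\<exists>n. (\<forall>\<^sub>F r in at_right 0. has_multiplicity (F ` ball 0 r) n) \<and>
     (\<forall>\<^sub>F t in nhds 0. \<forall>\<^sub>F r in at_right 0. has_multiplicity (H t ` ball 0 r) n)"
proof -
  interpret swapped: quasihomogeneous_germ F Fp d w1 w2 i1 i3 i2 \<alpha>
    by (rule quasihomogeneous_germ_swap) (rule quasihomogeneous_germ_axioms)
  have "\<exists>n. \<exists>\<theta>>0. \<forall>h. weight_close K \<theta> h \<longrightarrow>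
     (\<forall>i. \<forall>\<^sub>F z in nhds 0. holo2_at (\<lambda>z. h z $ i) z) \<longrightarrow> h 0 = 0 \<longrightarrow>
     (\<exists>\<eta> \<eta>'. fibre_equivalence \<eta> \<eta>' h F) \<longrightarrow> (\<forall>\<^sub>F r in at_right 0. has_multiplicity (h ` ball 0 r) n)"
  proof (cases "axis_coeff i2 \<noteq> 0 \<and> (axis_coeff i3 = 0 \<or> d i2 \<le> d i3)")
    case True
    then show ?thesis using multiplicity_of_perturbation[OF det K] by blast
  next
    case False
    then have "axis_coeff i3 \<noteq> 0" "axis_coeff i2 = 0 \<or> d i3 \<le> d i2" using axis_nonzero[OF det] by auto
    then show ?thesis using swapped.multiplicity_of_perturbation[OF det K] by blast
  qed
  then obtain n \<theta> where th: "\<theta> > 0" and main: "\<And>h. weight_close K \<theta> h \<Longrightarrow>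
     (\<forall>i. \<forall>\<^sub>F z in nhds 0. holo2_at (\<lambda>z. h z $ i) z) \<Longrightarrow> h 0 = 0 \<Longrightarrow>
     (\<exists>\<eta> \<eta>'. fibre_equivalence \<eta> \<eta>' h F) \<Longrightarrow> \<forall>\<^sub>F r in at_right 0. has_multiplicity (h ` ball 0 r) n"
    by blast
  have "\<forall>\<^sub>F r in at_right 0. has_multiplicity (F ` ball 0 r) n"
  proof (rule main)
    show "\<exists>\<eta> \<eta>'. fibre_equivalence \<eta> \<eta>' F F" using fibre_equivalence_refl by blast
  qed (use F_holo F0 th in \<open>auto intro!: always_eventually mult_nonneg_nonneg weighted_sum_nonneg\<close>)
  moreover have "\<forall>\<^sub>F t in nhds 0. \<forall>\<^sub>F r in at_right 0. has_multiplicity (H t ` ball 0 r) n"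
    using H[OF th] holo H0 fe by eventually_elim (rule main)
  ultimately show ?thesis by blast
qed

section \<open>Choice of source coordinates\<close>

text \<open>
  The coordinate with index \<open>e\<close> takes the role of \<open>x\<close>, the other one that of \<open>y\<close>.
\<close>

definition pair_vec :: "2 \<Rightarrow> complex \<times> complex \<Rightarrow> complex^2" where
  "pair_vec e z = (\<chi> j. if j = e then fst z else snd z)"

definition vec_pair :: "2 \<Rightarrow> complex^2 \<Rightarrow> complex \<times> complex" where
  "vec_pair e w = (w $ e, w $ (if e = 1 then 2 else 1))"

lemma vec_pair_pair_vec [simp]: "vec_pair e (pair_vec e z) = z"
  using exhaust_2[of e] by (auto simp: vec_pair_def pair_vec_def)

lemma pair_vec_vec_pair [simp]: "pair_vec e (vec_pair e w) = w"
  using exhaust_2[of e] by (auto simp: vec_pair_def pair_vec_def vec_eq_iff forall_2)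

lemma pair_vec_0 [simp]: "pair_vec e 0 = 0"
  by (simp add: pair_vec_def vec_eq_iff)

lemma vec_pair_0 [simp]: "vec_pair e 0 = 0"
  by (simp add: vec_pair_def zero_prod_def)

lemma pair_vec_1: "pair_vec 1 (x, y) = vector [x, y]" and pair_vec_2: "pair_vec 2 (x, y) = vector [y, x]"
  by (simp_all add: pair_vec_def vec_eq_iff forall_2)

lemma norm_pair_vec [simp]: "norm (pair_vec e z) = norm z"
proof -
  have "norm (pair_vec e z) = sqrt (norm (fst z) ^ 2 + norm (snd z) ^ 2)"
    using exhaust_2[of e] by (auto simp: pair_vec_def norm_vec_def L2_set_def sum_2 add.commute)
  then show ?thesis by (simp add: norm_prod_def)
qed

lemma linear_pair_vec: "linear (pair_vec e)"
  by (rule linearI) (simp_all add: pair_vec_def vec_eq_iff)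

lemma linear_vec_pair: "linear (vec_pair e)"
  by (rule linearI) (simp_all add: vec_pair_def)

lemma isCont_pair_vec: "isCont (pair_vec e) z" and isCont_vec_pair: "isCont (vec_pair e) w"
  using linear_pair_vec linear_vec_pair by (simp_all add: linear_conv_bounded_linear linear_continuous_at)

lemma image_pair_vec_ball: "pair_vec e ` ball 0 r = ball 0 r"
proof
  show "ball 0 r \<subseteq> pair_vec e ` ball 0 r"
  proof
    fix w :: "complex^2" assume w: "w \<in> ball 0 r"
    have "norm (vec_pair e w) = norm w" using norm_pair_vec[of e "vec_pair e w"] by simp
    then show "w \<in> pair_vec e ` ball 0 r" using w by (intro image_eqI[of _ _ "vec_pair e w"]) auto
  qed
qed auto

lemma eventually_pair_vec:
  "(\<forall>\<^sub>F w in nhds 0. P w) \<longleftrightarrow> (\<forall>\<^sub>F z in nhds 0. P (pair_vec e z))"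
proof -
  have "(\<forall>w. norm w < d \<longrightarrow> P w) \<longleftrightarrow> (\<forall>z. norm z < d \<longrightarrow> P (pair_vec e z))" for d
    by (metis norm_pair_vec pair_vec_vec_pair)
  then show ?thesis unfolding eventually_nhds_metric dist_norm diff_0_right by simp
qed

lemma holo2_at_pair_vec:
  fixes h :: "complex^2 \<Rightarrow> complex^'m"
  assumes "(h has_derivative (\<lambda>v. A *v v)) (at (pair_vec e z))"
  shows "holo2_at (\<lambda>z. h (pair_vec e z) $ i) z"
proof -
  have "(pair_vec e has_derivative pair_vec e) (at z)"
    by (rule bounded_linear_imp_has_derivative) (use linear_pair_vec in \<open>simp add: linear_conv_bounded_linear\<close>)
  from has_derivative_compose[OF this assms]
  have "((\<lambda>z. h (pair_vec e z)) has_derivative (\<lambda>v. A *v pair_vec e v)) (at z)" .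
  then have "((\<lambda>z. h (pair_vec e z) $ i) has_derivative (\<lambda>v. (A *v pair_vec e v) $ i)) (at z)"
    by (rule bounded_linear.has_derivative[OF bounded_linear_vec_nth])
  moreover have "(A *v pair_vec e v) $ i = A $ i $ e * fst v + A $ i $ (if e = 1 then 2 else 1) * snd v" for v
    using exhaust_2[of e] by (auto simp: matrix_vector_mult_def pair_vec_def sum_2)
  ultimately show ?thesis unfolding holo2_at_def by auto
qed

lemma holomorphic_germ_pair_vec:
  fixes h :: "complex^2 \<Rightarrow> complex^'m"
  assumes "holomorphic_germ h"
  shows "\<forall>\<^sub>F z in nhds 0. holo2_at (\<lambda>z. h (pair_vec e z) $ i) z"
  using assms unfolding holomorphic_germ_def eventually_pair_vec[of _ e]
  by eventually_elim (auto intro: holo2_at_pair_vec)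

lemma holomorphic_germ_isCont:
  fixes h :: "complex^'n \<Rightarrow> complex^'m"
  assumes "holomorphic_germ h" shows "\<forall>\<^sub>F z in nhds 0. isCont h z"
  using assms unfolding holomorphic_germ_def by eventually_elim (auto intro: has_derivative_continuous)

lemma has_derivative_vecI:
  fixes f :: "'a::real_normed_vector \<Rightarrow> complex^'m"
  assumes "\<And>i. ((\<lambda>x. f x $ i) has_derivative (\<lambda>v. f' v $ i)) (at x)"
  shows "(f has_derivative f') (at x)"
proof -
  have bl: "bounded_linear (\<lambda>v. f' v $ i)" for i using assms[of i] by (rule has_derivative_bounded_linear)
  have lin: "linear f'"
  proof (rule linearI)
    show "f' (a + b) = f' a + f' b" for a b
      unfolding vec_eq_iff using linear_add[OF bounded_linear.linear[OF bl], of a b] by simp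
    show "f' (r *\<^sub>R a) = r *\<^sub>R f' a" for r a
      unfolding vec_eq_iff using linear_scale[OF bounded_linear.linear[OF bl], of r a] by simp
  qed
  have "bounded_linear f'"
  proof -
    have "\<exists>K. \<forall>v. norm (f' v $ i) \<le> norm v * K" for i using bounded_linear.bounded[OF bl] .
    then obtain K where K: "\<And>i v. norm (f' v $ i) \<le> norm v * K i" by metis
    have "norm (f' v) \<le> norm v * (\<Sum>i\<in>UNIV. K i)" for v
    proof -
      have "norm (f' v) \<le> (\<Sum>i\<in>UNIV. norm (f' v $ i))" unfolding norm_vec_def by (rule L2_set_le_sum) auto
      also have "\<dots> \<le> (\<Sum>i\<in>UNIV. norm v * K i)" by (rule sum_mono) (rule K)
      finally show ?thesis by (simp add: sum_distrib_left)
    qed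
    then show ?thesis using lin by (intro bounded_linear_intro[of f' "\<Sum>i\<in>UNIV. K i"]) (auto simp: linear_add linear_scale)
  qed
  then show ?thesis unfolding has_derivative_at_within
  proof (intro conjI)
    show "((\<lambda>y. (f y - f x - f' (y - x)) /\<^sub>R norm (y - x)) \<longlongrightarrow> 0) (at x)"
    proof (rule vec_tendstoI)
      fix i
      have "((\<lambda>y. (f y $ i - f x $ i - f' (y - x) $ i) /\<^sub>R norm (y - x)) \<longlongrightarrow> 0) (at x)"
        using assms[of i] unfolding has_derivative_at_within by blast
      then show "((\<lambda>y. ((f y - f x - f' (y - x)) /\<^sub>R norm (y - x)) $ i) \<longlongrightarrow> 0 $ i) (at x)" by simp
    qed
  qed
qed

lemma polynomial_pair_vec:
  fixes f :: "complex^2 \<Rightarrow> complex^3"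
  assumes "polynomial_map f" shows "\<exists>P. \<forall>z. f (pair_vec e z) $ i = ev P z"
proof -
  obtain N c where f: "\<And>z i. f z $ i = (\<Sum>a\<le>(N::nat). \<Sum>b\<le>N. c i a b * (z $ 1) ^ a * (z $ 2) ^ b)"
    using assms unfolding polynomial_map_def by blast
  have "polyfun2 (\<lambda>z. pair_vec e z $ j)" for j
    by (cases "j = e") (simp_all add: pair_vec_def polyfun2_fst polyfun2_snd)
  then have "polyfun2 (\<lambda>z. f (pair_vec e z) $ i)" unfolding f by (intro polyfun2_intros)
  then show ?thesis unfolding polyfun2_def fun_eq_iff .
qed

lemma higher_deriv_poly: "(deriv ^^ b) (poly p) = poly ((pderiv ^^ b) p)" for p :: "complex poly"
proof (induction b)
  case (Suc b)
  have "deriv (poly q) = poly (pderiv q)" for q :: "complex poly"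
    by (rule ext) (rule DERIV_imp_deriv[OF poly_DERIV])
  then show ?case using Suc by simp
qed simp

lemma higher_deriv_poly_0: "(deriv ^^ b) (poly p) 0 = fact b * coeff p b" for p :: "complex poly"
  by (simp add: higher_deriv_poly poly_0_coeff_0 coeff_higher_pderiv pochhammer_fact)

lemma taylor_coeff_ev: "taylor_coeff (\<lambda>w. ev P (w $ 1, w $ 2)) a b = coeff (coeff P b) a"
proof -
  have "(\<lambda>y. ev P (x, y)) = poly (slice P x)" for x by (rule ext) (simp add: poly_slice)
  then have "(\<lambda>x. (deriv ^^ b) (\<lambda>y. ev P (x, y)) 0) = poly (smult (fact b) (coeff P b))"
    by (simp add: higher_deriv_poly_0 coeff_slice fun_eq_iff)
  then show ?thesis by (simp add: taylor_coeff_def higher_deriv_poly_0)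
qed

lemma holomorphic_germ_ev:
  fixes P :: "3 \<Rightarrow> complex poly poly"
  shows "holomorphic_germ (\<lambda>w::complex^2. \<chi> i. ev (P i) (w $ 1, w $ 2))"
  unfolding holomorphic_germ_def
proof (intro always_eventually allI)
  fix w :: "complex^2"
  have "\<exists>c. (ev (P i) has_derivative (\<lambda>v. fst c * fst v + snd c * snd v)) (at (w $ 1, w $ 2))" for i
  proof -
    obtain a b where "(ev (P i) has_derivative (\<lambda>v. a * fst v + b * snd v)) (at (w $ 1, w $ 2))"
      using polyfun2_holo[OF polyfun2_ev, of "P i"] unfolding holo2_at_def by blast
    then show ?thesis by (intro exI[of _ "(a, b)"]) simp
  qed
  then have "\<forall>i. \<exists>c. (ev (P i) has_derivative (\<lambda>v. fst c * fst v + snd c * snd v)) (at (w $ 1, w $ 2))" by blast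
  from choice[OF this] obtain c where
    ab: "\<And>i. (ev (P i) has_derivative (\<lambda>v. fst (c i) * fst v + snd (c i) * snd v)) (at (w $ 1, w $ 2))" by blast
  define A :: "complex^2^3" where "A = (\<chi> i. \<chi> j. if j = 1 then fst (c i) else snd (c i))"
  have "((\<lambda>w::complex^2. (w $ 1, w $ 2)) has_derivative (\<lambda>v. (v $ 1, v $ 2))) (at w)"
    by (intro has_derivative_Pair bounded_linear_imp_has_derivative bounded_linear_vec_nth)
  from has_derivative_compose[OF this ab]
  have "((\<lambda>w::complex^2. ev (P i) (w $ 1, w $ 2)) has_derivative (\<lambda>v. fst (c i) * v $ 1 + snd (c i) * v $ 2)) (at w)" for i by simp
  then have "((\<lambda>w. \<chi> i. ev (P i) (w $ 1, w $ 2)) has_derivative (\<lambda>v. A *v v)) (at w)"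
    by (intro has_derivative_vecI) (simp add: A_def matrix_vector_mult_def sum_2)
  then show "\<exists>A. ((\<lambda>w. \<chi> i. ev (P i) (w $ 1, w $ 2)) has_derivative (\<lambda>v. A *v v)) (at w)" by blast
qed

text \<open>
  For \<open>e = 2\<close> the coefficients are transposed.
\<close>

lemma polynomial_in_standard_coordinates:
  assumes "vanishes_to_order l R"
  shows "\<exists>R'. vanishes_to_order l R' \<and> (\<forall>w. ev R' (w $ 1, w $ 2) = ev R (vec_pair e w))"
proof (cases "e = 1")
  case True
  then show ?thesis using assms by (intro exI[of _ R]) (simp add: vec_pair_def)
next
  case False
  then have e: "e = 2" using exhaust_2[of e] by auto
  define R' where "R' = (\<Sum>b\<le>degree R. \<Sum>a\<le>degree (coeff R b). monom (monom (coeff (coeff R b) a) b) a)"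
  have "vanishes_to_order l R'"
    unfolding vanishes_to_order_def
  proof (intro allI impI)
    fix i j assume ij: "i + j < l"
    have zero: "coeff (coeff (monom (monom (coeff (coeff R b) a) b) a) j) i = 0" for a b
      using assms ij unfolding vanishes_to_order_def by (cases "a = j \<and> b = i") auto
    then show "coeff (coeff R' j) i = 0" by (simp only: R'_def coeff_sum zero sum.neutral_const)
  qed
  moreover have "ev (monom (monom c b) a) z = c * fst z ^ b * snd z ^ a" for c a b z
  proof -
    have "[:y:] ^ a = [:y ^ a:]" for y :: complex by (induction a) auto
    then show ?thesis by (simp add: ev_def poly_monom)
  qed
  then have "ev R' (w $ 1, w $ 2) = ev R (vec_pair e w)" for w :: "complex^2"
    by (simp add: R'_def ev_expand2[of R] vec_pair_def e mult.commute mult.left_commute)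
  ultimately show ?thesis by blast
qed

text \<open>
  The change of target coordinates is injective near 0 and does not affect the fibres.
\<close>

lemma A_equivalent_fibres:
  assumes "A_equivalent f g" and f: "isCont f 0" "f 0 = 0"
  shows "\<exists>\<eta> \<eta>'. fibre_equivalence \<eta> \<eta>' f g \<and> holomorphic_germ \<eta>'"
proof -
  obtain \<eta> \<xi> where eta: "biholomorphic_germ \<eta>" and xi: "biholomorphic_germ \<xi>"
    and g: "\<forall>\<^sub>F z in nhds 0. g z = \<xi> (f (\<eta> z))" using assms(1) unfolding A_equivalent_def by blast
  obtain \<eta>' where eta': "holomorphic_germ \<eta>" "\<eta> 0 = 0" "holomorphic_germ \<eta>'" "\<eta>' 0 = 0"
    "\<forall>\<^sub>F z in nhds 0. \<eta>' (\<eta> z) = z" "\<forall>\<^sub>F z in nhds 0. \<eta> (\<eta>' z) = z"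
    using eta unfolding biholomorphic_germ_def by blast
  obtain \<xi>' where xi': "\<forall>\<^sub>F z in nhds 0. \<xi>' (\<xi> z) = z" using xi unfolding biholomorphic_germ_def by blast
  have "isCont \<eta> 0" using eventually_nhds_x_imp_x[OF holomorphic_germ_isCont[OF eta'(1)]] .
  then have "isCont (\<lambda>z. f (\<eta> z)) 0" by (rule isCont_o2) (simp add: f(1) eta'(2))
  then have "filterlim (\<lambda>z. f (\<eta> z)) (nhds 0) (nhds 0)"
    using tendsto_at_iff_tendsto_nhds[of "\<lambda>z. f (\<eta> z)" 0] f(2) eta'(2) by (simp add: isCont_def)
  then have "\<forall>\<^sub>F z in nhds 0. \<xi>' (\<xi> (f (\<eta> z))) = f (\<eta> z)" using xi' by (rule eventually_compose_filterlim[rotated])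
  with g have "\<forall>\<^sub>F z in nhds 0. g z = \<xi> (f (\<eta> z)) \<and> \<xi>' (\<xi> (f (\<eta> z))) = f (\<eta> z)" by (rule eventually_conj)
  then obtain S where S: "open S" "0 \<in> S" "\<forall>z\<in>S. g z = \<xi> (f (\<eta> z)) \<and> \<xi>' (\<xi> (f (\<eta> z))) = f (\<eta> z)"
    unfolding eventually_nhds by blast
  have "fibre_equivalence \<eta> \<eta>' f g"
    unfolding fibre_equivalence_def
  proof (intro conjI eta' exI[of _ S] S ballI)
    show "\<forall>\<^sub>F z in nhds 0. isCont \<eta> z \<and> isCont \<eta>' z \<and> \<eta>' (\<eta> z) = z \<and> \<eta> (\<eta>' z) = z"
      by (intro eventually_conj holomorphic_germ_isCont eta')
    fix z z' assume "z \<in> S" "z' \<in> S"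
    then show "(g z = g z') = (f (\<eta> z) = f (\<eta> z'))" using S(3) by metis
  qed
  then show ?thesis using eta'(3) by blast
qed

lemma fibre_equivalence_pair_vec:
  fixes f g :: "complex^2 \<Rightarrow> 'a"
  assumes "fibre_equivalence \<eta> \<eta>' f g"
  shows "fibre_equivalence (\<lambda>z. vec_pair e (\<eta> (pair_vec e z))) (\<lambda>z. vec_pair e (\<eta>' (pair_vec e z)))
    (\<lambda>z. f (pair_vec e z)) (\<lambda>z. g (pair_vec e z))"
proof -
  have z: "\<eta> 0 = 0" "\<eta>' 0 = 0" using assms by (auto simp: fibre_equivalence_def)
  obtain S where S: "open S" "0 \<in> S" "\<forall>z\<in>S. \<forall>z'\<in>S. g z = g z' \<longleftrightarrow> f (\<eta> z) = f (\<eta> z')"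
    using assms unfolding fibre_equivalence_def by blast
  have c: "\<forall>\<^sub>F z in nhds 0. isCont \<eta> z \<and> isCont \<eta>' z \<and> \<eta>' (\<eta> z) = z \<and> \<eta> (\<eta>' z) = z"
    using assms unfolding fibre_equivalence_def by blast
  show ?thesis
    unfolding fibre_equivalence_def
  proof (intro conjI exI[of _ "pair_vec e -` S"] ballI)
    have comp: "isCont (\<lambda>z. vec_pair e (k (pair_vec e z))) z" if "isCont k (pair_vec e z)" for k z
      by (intro isCont_o2[OF isCont_o2[OF isCont_pair_vec that] isCont_vec_pair])
    show "\<forall>\<^sub>F z in nhds 0. isCont (\<lambda>z. vec_pair e (\<eta> (pair_vec e z))) z \<and>
        isCont (\<lambda>z. vec_pair e (\<eta>' (pair_vec e z))) z \<and>
        vec_pair e (\<eta>' (pair_vec e (vec_pair e (\<eta> (pair_vec e z))))) = z \<and>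
        vec_pair e (\<eta> (pair_vec e (vec_pair e (\<eta>' (pair_vec e z))))) = z"
      using c unfolding eventually_pair_vec[of _ e] by eventually_elim (simp add: comp)
    show "open (pair_vec e -` S)"
      by (rule open_vimage[OF S(1)]) (intro continuous_at_imp_continuous_on ballI isCont_pair_vec)
  qed (use S z in auto)
qed

text \<open>
  Terms of degree greater than \<open>k\<close> do not change the \<open>k\<close>-jet.
\<close>

lemma finitely_determined2_pair_vec:
  assumes fd: "finitely_determined f" and poly: "polynomial_map f" and f0: "f 0 = 0"
  shows "finitely_determined2 (\<lambda>z. f (pair_vec e z))"
proof -
  obtain k where k: "\<And>g. holomorphic_germ g \<Longrightarrow> g 0 = 0 \<Longrightarrow> same_jet k f g \<Longrightarrow> A_equivalent f g"
    using fd unfolding finitely_determined_def by blast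
  obtain P where P: "\<And>z i. f (pair_vec 1 z) $ i = ev (P i) z" using polynomial_pair_vec[OF poly, of 1] by metis
  have fP: "f w = (\<chi> i. ev (P i) (w $ 1, w $ 2))" for w
  proof -
    have "pair_vec 1 (w $ 1, w $ 2) = w" using pair_vec_vec_pair[of 1 w] by (simp add: vec_pair_def)
    then have "f w $ i = ev (P i) (w $ 1, w $ 2)" for i using P[of "(w $ 1, w $ 2)" i] by simp
    then show ?thesis by (simp add: vec_eq_iff)
  qed
  have fPi: "(\<lambda>w. f w $ i) = (\<lambda>w. ev (P i) (w $ 1, w $ 2))" for i by (simp add: fP)
  have fcont: "isCont f 0"
    using eventually_nhds_x_imp_x[OF holomorphic_germ_isCont[OF holomorphic_germ_ev[of P]]] by (simp add: fP[abs_def])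
  show ?thesis unfolding finitely_determined2_def
  proof (rule exI[of _ k], intro allI impI)
    fix R :: "3 \<Rightarrow> complex poly poly" assume R: "\<forall>i. vanishes_to_order (Suc k) (R i)"
    have "\<forall>i. \<exists>R'. vanishes_to_order (Suc k) R' \<and> (\<forall>w. ev R' (w $ 1, w $ 2) = ev (R i) (vec_pair e w))"
      using polynomial_in_standard_coordinates R by blast
    then obtain R' where R': "\<And>i. vanishes_to_order (Suc k) (R' i)" "\<And>i w. ev (R' i) (w $ 1, w $ 2) = ev (R i) (vec_pair e w)"
      by metis
    define g where "g = (\<lambda>w::complex^2. \<chi> i. ev (P i + R' i) (w $ 1, w $ 2))"
    have gh: "holomorphic_germ g" unfolding g_def by (rule holomorphic_germ_ev)
    have "ev (R i) 0 = 0" for i using R by (simp add: ev_zero vanishes_to_order_def)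
    moreover have "ev (P i) (0, 0) = 0" for i using f0 fP[of 0] by (simp add: vec_eq_iff)
    ultimately have g0: "g 0 = 0" using R'(2)[of _ 0] by (simp add: g_def vec_eq_iff)
    have jet: "same_jet k f g"
      unfolding same_jet_def
    proof (intro allI impI)
      fix i a b assume "a + b \<le> k"
      then have "coeff (coeff (R' i) b) a = 0" using R'(1)[of i] by (simp add: vanishes_to_order_def)
      then show "taylor_coeff (\<lambda>z. f z $ i) a b = taylor_coeff (\<lambda>z. g z $ i) a b"
        unfolding fPi g_def vec_lambda_beta taylor_coeff_ev by simp
    qed
    obtain \<eta> \<eta>' where fe: "fibre_equivalence \<eta> \<eta>' f g" and h': "holomorphic_germ \<eta>'"
      using A_equivalent_fibres[OF k[OF gh g0 jet] fcont f0] by blast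
    have "g (pair_vec e z) = (\<chi> i. f (pair_vec e z) $ i + ev (R i) z)" for z
      by (simp add: g_def vec_eq_iff R'(2) fP)
    then have "fibre_equivalence (\<lambda>z. vec_pair e (\<eta> (pair_vec e z))) (\<lambda>z. vec_pair e (\<eta>' (pair_vec e z)))
      (\<lambda>z. f (pair_vec e z)) (\<lambda>z. \<chi> i. f (pair_vec e z) $ i + ev (R i) z)"
      using fibre_equivalence_pair_vec[OF fe, of e] by simp
    moreover have "\<forall>\<^sub>F z in nhds 0. holo2_at (\<lambda>z. fst (vec_pair e (\<eta>' (pair_vec e z)))) z"
      "\<forall>\<^sub>F z in nhds 0. holo2_at (\<lambda>z. snd (vec_pair e (\<eta>' (pair_vec e z)))) z"
      unfolding vec_pair_def fst_conv snd_conv by (rule holomorphic_germ_pair_vec[OF h'])+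
    ultimately show "\<exists>\<eta> \<eta>'. fibre_equivalence \<eta> \<eta>' (\<lambda>z. f (pair_vec e z)) (\<lambda>z. \<chi> i. f (pair_vec e z) $ i + ev (R i) z) \<and>
       (\<forall>\<^sub>F z in nhds 0. holo2_at (\<lambda>z. fst (\<eta>' z)) z) \<and> (\<forall>\<^sub>F z in nhds 0. holo2_at (\<lambda>z. snd (\<eta>' z)) z)" by blast
  qed
qed

section \<open>The hypotheses on the unfolding\<close>

lemma homeomorphism_open_image:
  assumes h: "homeomorphism U V \<phi> \<phi>'" and V: "open V" and B: "open B" "B \<subseteq> U"
  shows "open (\<phi> ` B)"
proof -
  have "\<phi> ` B = \<phi>' -` B \<inter> V"
    using h B(2) unfolding homeomorphism_def by (auto simp: image_iff)
  moreover have "continuous_on V \<phi>'" using h by (simp add: homeomorphism_def)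
  ultimately show ?thesis using continuous_on_open_vimage[OF V] B(1) by metis
qed

text \<open>
  At fixed \<open>t\<close> the homeomorphism of the source restricts to \<open>\<phi> t\<close>, and the injectivity of \<open>\<Psi>'\<close> shows that
  it carries the fibres of \<open>f\<close> to those of \<open>ft t\<close>.
\<close>

lemma topologically_trivial_fibres:
  fixes f :: "complex^2 \<Rightarrow> complex^3" and ft :: "complex \<Rightarrow> complex^2 \<Rightarrow> complex^3"
  assumes tt: "topologically_trivial f ft"
    and cont: "isCont (\<lambda>(z, t). ft t z) 0" and ft0: "ft 0 0 = 0"
  shows "\<forall>\<^sub>F t in nhds 0. \<exists>\<eta> \<eta>'. fibre_equivalence \<eta> \<eta>' (ft t) f"
proof -
  obtain \<phi> \<psi> \<Phi>' \<Psi>' where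
    h1: "homeomorphism_germ (level_map \<phi>) \<Phi>'" and p1: "\<forall>\<^sub>F t in nhds 0. \<phi> t 0 = 0" and
    h2: "homeomorphism_germ (level_map \<psi>) \<Psi>'" and
    eq: "\<forall>\<^sub>F p in nhds 0. \<Psi>' (level_map ft (level_map \<phi> p)) = level_map (\<lambda>t. f) p"
    using tt unfolding topologically_trivial_def by (elim exE conjE) (rule that)
  define \<Phi> where "\<Phi> = level_map \<phi>"
  obtain U V where UV: "open U" "0 \<in> U" "open V" "homeomorphism U V \<Phi> \<Phi>'" and \<Phi>0: "\<Phi> 0 = 0"
    using h1 unfolding homeomorphism_germ_def \<Phi>_def by auto
  obtain U2 V2 where UV2: "open V2" "0 \<in> V2" "homeomorphism U2 V2 (level_map \<psi>) \<Psi>'"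
    using h2 unfolding homeomorphism_germ_def by auto
  have inj2: "p = q" if "p \<in> V2" "q \<in> V2" "\<Psi>' p = \<Psi>' q" for p q
    using UV2(3) that unfolding homeomorphism_def by metis
  have inj1: "\<Phi>' (\<Phi> p) = p" if "p \<in> U" for p using UV(4) that unfolding homeomorphism_def by blast
  have c1: "isCont \<Phi> 0" using UV by (meson continuous_on_eq_continuous_at homeomorphism_def)
  have cF: "isCont (level_map ft) 0"
  proof -
    have "isCont (\<lambda>p::(complex^2)\<times>complex. (case p of (z, t) \<Rightarrow> ft t z, snd p)) 0"
      by (intro continuous_intros cont)
    then show ?thesis by (simp add: level_map_def case_prod_beta')
  qed
  have F0: "level_map ft 0 = 0" using ft0 by (simp add: level_map_def zero_prod_def)
  have "isCont (\<lambda>p. level_map ft (\<Phi> p)) 0" by (rule isCont_o2[OF c1]) (simp add: \<Phi>0 cF)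
  then have "((\<lambda>p. level_map ft (\<Phi> p)) \<longlongrightarrow> 0) (nhds 0)"
    using tendsto_at_iff_tendsto_nhds[of "\<lambda>p. level_map ft (\<Phi> p)" 0] \<Phi>0 F0 by (simp add: isCont_def)
  then have "\<forall>\<^sub>F p in nhds 0. level_map ft (\<Phi> p) \<in> V2" using UV2(1,2) by (rule topological_tendstoD)
  moreover have "\<forall>\<^sub>F p in nhds 0. p \<in> U" using UV by (simp add: eventually_nhds_in_open)
  ultimately have "\<forall>\<^sub>F p in nhds 0. level_map ft (\<Phi> p) \<in> V2 \<and> p \<in> U \<and> \<Psi>' (level_map ft (\<Phi> p)) = level_map (\<lambda>t. f) p"
    using eq unfolding \<Phi>_def by eventually_elim blast
  then obtain N where N: "open N" "0 \<in> N" "\<And>p. p \<in> N \<Longrightarrow> level_map ft (\<Phi> p) \<in> V2 \<and> p \<in> U \<and> \<Psi>' (level_map ft (\<Phi> p)) = level_map (\<lambda>t. f) p"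
    unfolding eventually_nhds by blast
  obtain A C where AC: "open A" "open C" "0 \<in> A \<times> C" "A \<times> C \<subseteq> N" using open_prod_elim[OF N(1,2)] by blast
  then have A0: "0 \<in> A" "0 \<in> C" by (auto simp: zero_prod_def)
  have "\<forall>\<^sub>F t in nhds 0. t \<in> C" using AC(2) A0 by (simp add: eventually_nhds_in_open)
  with p1 show ?thesis
  proof eventually_elim
    case (elim t)
    have Pt: "\<Phi> (z, t) = (\<phi> t z, t)" for z by (simp add: \<Phi>_def level_map_def)
    have in_N: "(z, t) \<in> N" if "z \<in> A" for z using AC(4) that elim by blast
    define \<eta>' where "\<eta>' = (\<lambda>w. fst (\<Phi>' (w, t)))"
    have inv1: "\<eta>' (\<phi> t z) = z" if "z \<in> A" for z
      using inj1[of "(z, t)"] N(3)[OF in_N[OF that]] by (simp add: \<eta>'_def Pt[symmetric])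
    have oI: "open (\<Phi> ` (A \<times> C))"
      by (rule homeomorphism_open_image[OF UV(4,3)]) (use AC N(3) in \<open>auto intro: open_Times\<close>)
    define B where "B = {w. (w, t) \<in> \<Phi> ` (A \<times> C)}"
    have oB: "open B" unfolding B_def
      using open_vimage[OF oI, of "\<lambda>w. (w, t)"] by (simp add: vimage_def continuous_intros)
    have Bim: "w \<in> B \<longleftrightarrow> w \<in> \<phi> t ` A" for w
      using elim(2) by (auto simp: B_def \<Phi>_def level_map_def)
    have cphi: "isCont (\<phi> t) z" if "z \<in> A" for z
    proof -
      have "(z, t) \<in> U" using N(3)[OF in_N[OF that]] by blast
      then have "isCont \<Phi> (z, t)" using UV by (meson continuous_on_eq_continuous_at homeomorphism_def)
      then have "isCont (\<lambda>z. \<Phi> (z, t)) z" by (intro isCont_o2[of z "\<lambda>z. (z, t)" \<Phi>] continuous_intros) auto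
      then have "isCont (\<lambda>z. fst (\<Phi> (z, t))) z" by (intro continuous_intros)
      then show ?thesis by (simp add: Pt)
    qed
    have ceta: "isCont \<eta>' w" if "w \<in> B" for w
    proof -
      have "(w, t) \<in> \<Phi> ` U" using that AC(4) N(3) by (auto simp: B_def)
      then have "(w, t) \<in> V" using UV(4) by (auto simp: homeomorphism_def)
      then have "isCont \<Phi>' (w, t)" using UV by (meson continuous_on_eq_continuous_at homeomorphism_def)
      then have "isCont (\<lambda>w. \<Phi>' (w, t)) w" by (intro isCont_o2[of w "\<lambda>w. (w, t)" \<Phi>'] continuous_intros) auto
      then show ?thesis unfolding \<eta>'_def by (intro continuous_intros)
    qed
    have B0: "0 \<in> B" using Bim A0 elim by (metis image_eqI)
    have inv2: "\<phi> t (\<eta>' w) = w" if "w \<in> B" for w using that Bim inv1 by auto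
    have "\<forall>\<^sub>F z in nhds 0. z \<in> A \<and> z \<in> B" using AC A0 oB B0 by (simp add: eventually_conj_iff eventually_nhds_in_open)
    then have ev: "\<forall>\<^sub>F z in nhds 0. isCont (\<phi> t) z \<and> isCont \<eta>' z \<and> \<eta>' (\<phi> t z) = z \<and> \<phi> t (\<eta>' z) = z"
      by eventually_elim (use cphi ceta inv1 inv2 in blast)
    have fib: "(f z = f z') = (ft t (\<phi> t z) = ft t (\<phi> t z'))" if "z \<in> A" "z' \<in> A" for z z'
    proof -
      have a: "level_map ft (\<Phi> (z, t)) = (ft t (\<phi> t z), t)" for z by (simp add: Pt) (simp add: level_map_def)
      have b: "level_map (\<lambda>t. f) (z, t) = (f z, t)" for z by (simp add: level_map_def)
      note n1 = N(3)[OF in_N[OF that(1)], unfolded a b] and n2 = N(3)[OF in_N[OF that(2)], unfolded a b]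
      show ?thesis using n1 n2 inj2 by (metis prod.inject)
    qed
    have "fibre_equivalence (\<phi> t) \<eta>' (ft t) f"
      unfolding fibre_equivalence_def
    proof (intro conjI ev exI[of _ A] AC A0 ballI)
      show "\<phi> t 0 = 0" by (rule elim)
      show "\<eta>' 0 = 0" using inv1[OF A0(1)] elim by simp
    qed (rule fib)
    then show ?case by blast
  qed
qed

lemma unfolding_near_0:
  fixes f :: "complex^2 \<Rightarrow> complex^3" and ft :: "complex \<Rightarrow> complex^2 \<Rightarrow> complex^3"
  assumes "unfolding_of f ft"
  shows "\<exists>R>0. \<exists>M. \<forall>t z. norm t < R \<longrightarrow> norm z < R \<longrightarrow>
     (\<exists>A. (ft t has_derivative (\<lambda>v. A *v v)) (at z)) \<and>
     (\<forall>i. \<exists>D. ((\<lambda>t. ft t z $ i) has_field_derivative D) (at t)) \<and>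
     norm (ft t z) \<le> M \<and> ft 0 z = f z"
proof -
  define g where "g = (\<lambda>(z, t). ft t z)"
  have e1: "\<forall>\<^sub>F p in nhds 0. \<exists>A b. (g has_derivative (\<lambda>(v, s). A *v v + s *s b)) (at p)"
    and e2: "\<forall>\<^sub>F z in nhds 0. ft 0 z = f z" using assms unfolding unfolding_of_def g_def by auto
  have "isCont g 0" using eventually_nhds_x_imp_x[OF e1] has_derivative_continuous by blast
  then have "\<forall>\<^sub>F p in nhds 0. dist (g p) (g 0) < 1" by (rule isCont_eventually_dist) simp
  with e1 have "\<forall>\<^sub>F p in nhds 0. (\<exists>A b. (g has_derivative (\<lambda>(v, s). A *v v + s *s b)) (at p)) \<and> dist (g p) (g 0) < 1"
    by (rule eventually_conj)
  then obtain d1 where d1: "d1 > 0" "\<And>p. dist p 0 < d1 \<Longrightarrow>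
      (\<exists>A b. (g has_derivative (\<lambda>(v, s). A *v v + s *s b)) (at p)) \<and> dist (g p) (g 0) < 1"
    unfolding eventually_nhds_metric by blast
  obtain d2 where d2: "d2 > 0" "\<And>z. dist z 0 < d2 \<Longrightarrow> ft 0 z = f z" using e2 unfolding eventually_nhds_metric by blast
  define R where "R = min (d1/2) d2"
  have "(\<exists>A. (ft t has_derivative (\<lambda>v. A *v v)) (at z)) \<and>
     (\<forall>i. \<exists>D. ((\<lambda>t. ft t z $ i) has_field_derivative D) (at t)) \<and>
     norm (ft t z) \<le> norm (g 0) + 1 \<and> ft 0 z = f z" if "norm t < R" "norm z < R" for t z
  proof -
    have near: "dist (z, t) 0 < d1" using norm_Pair_le[of z t] that by (simp add: R_def)
    obtain A b where D: "(g has_derivative (\<lambda>(v, s). A *v v + s *s b)) (at (z, t))" using d1(2)[OF near] by blast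
    have "((\<lambda>z. (z, t)) has_derivative (\<lambda>v. (v, 0))) (at z)" by (auto intro!: derivative_eq_intros)
    from has_derivative_compose[OF this D] have 1: "(ft t has_derivative (\<lambda>v. A *v v)) (at z)" by (simp add: g_def)
    have "((\<lambda>t. (z, t)) has_derivative (\<lambda>s. (0, s))) (at t)" by (auto intro!: derivative_eq_intros)
    from has_derivative_compose[OF this D] have "((\<lambda>t. ft t z) has_derivative (\<lambda>s. s *s b)) (at t)" by (simp add: g_def)
    from bounded_linear.has_derivative[OF bounded_linear_vec_nth this]
    have 2: "((\<lambda>t. ft t z $ i) has_field_derivative b $ i) (at t)" for i
      unfolding has_field_derivative_def by (simp add: mult_commute_abs)
    have "norm (g (z, t)) \<le> norm (g 0) + dist (g (z, t)) (g 0)" by (simp add: dist_norm norm_triangle_sub)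
    then have 3: "norm (ft t z) \<le> norm (g 0) + 1" using d1(2)[OF near] by (simp add: g_def)
    show ?thesis using 1 2 3 d2(2)[of z] that by (auto simp: R_def)
  qed
  moreover have "R > 0" using d1(1) d2(1) by (simp add: R_def)
  ultimately show ?thesis by blast
qed

lemma taylor_coeff_power_coeff:
  assumes "sep_holo (\<lambda>z. h (pair_vec 1 z)) R M" and "R > 0"
  shows "power_coeff (\<lambda>x. power_coeff (\<lambda>y. h (pair_vec 1 (x, y))) b) a = taylor_coeff h a b"
proof -
  define D where "D = (\<lambda>x. (deriv ^^ b) (\<lambda>y. h (pair_vec 1 (x, y))) 0)"
  have t: "(\<lambda>x. power_coeff (\<lambda>y. h (pair_vec 1 (x, y))) b) = (\<lambda>x. (1 / fact b) * D x)" by (simp add: power_coeff_def D_def)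
  have "(\<lambda>x. (1 / fact b) * D x) holomorphic_on ball 0 R"
    unfolding t[symmetric] by (rule power_coeff_snd_holomorphic[OF assms])
  from holomorphic_on_mult[OF holomorphic_on_const[of "fact b"] this]
  have h: "(\<lambda>x. fact b * ((1 / fact b) * D x)) holomorphic_on ball 0 R" .
  have eq: "(\<lambda>x. fact b * ((1 / fact b) * D x)) = D" by (simp add: fun_eq_iff)
  have "D holomorphic_on ball 0 R" using h unfolding eq .
  then have "(deriv ^^ a) (\<lambda>x. (1 / fact b) * D x) 0 = (1 / fact b) * (deriv ^^ a) D 0"
    by (rule higher_deriv_cmult) (use assms in auto)
  then show ?thesis unfolding t by (simp add: power_coeff_def taylor_coeff_def D_def pair_vec_1 mult.commute)
qed

lemma weighted_sum_swap: "weighted_sum w1 w2 d K x y = weighted_sum w2 w1 d K y x"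
  unfolding weighted_sum_def by (subst sum.swap, intro sum.cong refl) (simp add: add.commute mult.commute)

text \<open>
  The difference of \<open>ft t\<close> and \<open>f\<close> vanishes at \<open>t = 0\<close>, hence is of the size of \<open>t\<close>. Only finitely many
  exponents have weight less than \<open>d i\<close>, so for small \<open>t\<close> all their coefficients vanish at once and
  \<open>weighted_bound\<close> applies with \<open>M\<close> of the size of \<open>t\<close>.
\<close>

lemma non_decreasing_weights_estimate:
  fixes f :: "complex^2 \<Rightarrow> complex^3" and ft :: "complex \<Rightarrow> complex^2 \<Rightarrow> complex^3"
  assumes un: "unfolding_of f ft" and nd: "non_decreasing_weights f d w1 w2 ft"
    and w: "w1 > 0" "w2 > 0" and K: "\<And>i. d i \<le> K" and th: "\<theta> > 0"
  shows "\<forall>\<^sub>F t in nhds 0. \<forall>i. \<forall>\<^sub>F z in nhds 0.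
    norm (ft t (pair_vec 1 z) $ i - f (pair_vec 1 z) $ i) \<le> \<theta> * weighted_sum w1 w2 (d i) K (fst z) (snd z)"
proof -
  obtain R0 M0 where R0: "R0 > 0" and near: "\<And>t z. norm t < R0 \<Longrightarrow> norm z < R0 \<Longrightarrow>
     (\<exists>A. (ft t has_derivative (\<lambda>v. A *v v)) (at z)) \<and>
     (\<forall>i. \<exists>D. ((\<lambda>t. ft t z $ i) has_field_derivative D) (at t)) \<and>
     norm (ft t z) \<le> M0 \<and> ft 0 z = f z"
    using unfolding_near_0[OF un] by blast
  define R where "R = R0 / 2"
  have R: "R > 0" "R < R0" using R0 by (auto simp: R_def)
  have nz: "norm (pair_vec 1 (x, y)) < R0" if "norm x < R" "norm y < R" for x y
    using norm_Pair_le[of x y] that by (simp add: R_def)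
  have M0: "M0 \<ge> 0" using near[of 0 0] R0 norm_ge_zero order_trans by (metis norm_zero)
  define E where "E = (\<lambda>t i w. (ft t w - f w) $ i)"
  define M1 where "M1 = 2 * M0 * (2 / R)"
  have M1: "M1 \<ge> 0" using M0 R by (simp add: M1_def)
  have Eb: "norm (E t i (pair_vec 1 (x, y))) \<le> M1 * norm t"
    if t: "norm t \<le> R / 4" and xy: "norm x < R" "norm y < R" for t i x y
  proof -
    let ?z = "pair_vec 1 (x, y)"
    have "norm (ft t ?z $ i - (\<Sum>b<1. power_coeff (\<lambda>t. ft t ?z $ i) b * t ^ b)) \<le> 2 * M0 * (2 / R) ^ 1 * norm t ^ 1"
    proof (rule taylor_remainder[where R = R])
      show "(\<lambda>t. ft t ?z $ i) holomorphic_on ball 0 R"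
        unfolding holomorphic_on_open[OF open_ball] using near nz[OF xy] R by auto
      show "norm (ft t ?z $ i) \<le> M0" if "norm t < R" for t
        using near[of t ?z] nz[OF xy] that R by (intro order_trans[OF Finite_Cartesian_Product.norm_nth_le]) auto
    qed (use R t in auto)
    moreover have "ft 0 ?z = f ?z" using near[of 0 ?z] nz[OF xy] R0 by simp
    ultimately show ?thesis by (simp add: power_coeff_def E_def M1_def)
  qed
  have Es: "sep_holo (\<lambda>z. E t i (pair_vec 1 z)) R (M1 * norm t)" if t: "norm t \<le> R / 4" for t i
  proof -
    have h: "holo2_at (\<lambda>z. E t i (pair_vec 1 z)) (x, y)" if xy: "norm x < R" "norm y < R" for x y
    proof -
      obtain A where A: "(ft t has_derivative (\<lambda>v. A *v v)) (at (pair_vec 1 (x, y)))"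
        using near[of t "pair_vec 1 (x, y)"] nz[OF xy] t R by auto
      obtain A0 where A0: "(ft 0 has_derivative (\<lambda>v. A0 *v v)) (at (pair_vec 1 (x, y)))"
        using near[of 0 "pair_vec 1 (x, y)"] nz[OF xy] R0 by auto
      have "holo2_at (\<lambda>z. ft t (pair_vec 1 z) $ i - ft 0 (pair_vec 1 z) $ i) (x, y)"
        by (rule holo2_at_diff[OF holo2_at_pair_vec[OF A] holo2_at_pair_vec[OF A0]])
      moreover have "\<forall>\<^sub>F z in nhds (x, y). ft t (pair_vec 1 z) $ i - ft 0 (pair_vec 1 z) $ i = E t i (pair_vec 1 z)"
      proof -
        have "open (ball (0::complex) R \<times> ball (0::complex) R)" by (intro open_Times open_ball)
        then have "\<forall>\<^sub>F z in nhds (x, y). z \<in> ball 0 R \<times> ball 0 R" using xy by (intro eventually_nhds_in_open) auto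
        then show ?thesis
        proof eventually_elim
          case (elim z)
          then have "norm (pair_vec 1 z) < R0" using nz[of "fst z" "snd z"] by (auto simp: mem_Times_iff)
          then show ?case using near[of 0 "pair_vec 1 z"] R0 by (simp add: E_def)
        qed
      qed
      ultimately show ?thesis by (rule holo2_at_cong)
    qed
    show ?thesis unfolding sep_holo_def using holo2_slice[OF h] Eb[OF t] by blast
  qed
  define C where "C = 2 * (1 + 2/R)^(2*K) * M1"
  have C: "C \<ge> 0" using M1 R by (simp add: C_def)
  have "\<forall>\<^sub>F t in nhds 0. \<forall>i. \<forall>a\<in>{..K}. \<forall>b\<in>{..K}. w1 * a + w2 * b < d i \<longrightarrow> taylor_coeff (\<lambda>z. (ft t z - f z) $ i) a b = 0"
  proof (intro eventually_all_finite eventually_ball_finite finite_atMost ballI)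
    fix i a b
    show "\<forall>\<^sub>F t in nhds 0. w1 * a + w2 * b < d i \<longrightarrow> taylor_coeff (\<lambda>z. (ft t z - f z) $ i) a b = 0"
    proof (cases "w1 * a + w2 * b < d i")
      case True
      then have "\<forall>\<^sub>F t in nhds 0. taylor_coeff (\<lambda>z. (ft t z - f z) $ i) a b = 0"
        using nd unfolding non_decreasing_weights_def by (meson not_le)
      then show ?thesis by eventually_elim simp
    qed simp
  qed
  moreover have "\<forall>\<^sub>F t::complex in nhds 0. norm t \<le> R / 4 \<and> C * norm t \<le> \<theta>"
    unfolding eventually_nhds_metric
  proof (intro exI[of _ "min (R/4) (\<theta> / (C + 1))"] conjI allI impI)
    fix t :: complex assume t: "dist t 0 < min (R / 4) (\<theta> / (C + 1))"
    then show "norm t \<le> R / 4" by simp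
    have "norm t * (C + 1) < \<theta>" using t C by (simp add: pos_less_divide_eq)
    then have "norm t + C * norm t < \<theta>" by (simp add: algebra_simps)
    then show "C * norm t \<le> \<theta>" using norm_ge_zero[of t] by linarith
  qed (use R th C in auto)
  ultimately show ?thesis
  proof eventually_elim
    case (elim t)
    note t = conjunct1[OF elim(2)]
    show ?case
    proof
      fix i
      have coeff: "d i \<le> w1 * a + w2 * b" if nz: "power_coeff (\<lambda>x. power_coeff (\<lambda>y. E t i (pair_vec 1 (x, y))) b) a \<noteq> 0" for a b
      proof (rule ccontr)
        assume "\<not> d i \<le> w1 * a + w2 * b"
        then have lt: "w1 * a + w2 * b < d i" by simp
        have "a \<le> w1 * a" "b \<le> w2 * b" using w by simp_all
        then have "a \<le> K" "b \<le> K" using lt K[of i] by linarith+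
        then have "taylor_coeff (\<lambda>z. (ft t z - f z) $ i) a b = 0" using elim(1) lt by blast
        then show False using nz taylor_coeff_power_coeff[OF Es[OF t] R(1), of i b a] by (simp add: E_def)
      qed
      have "norm (E t i (pair_vec 1 (x, y))) \<le> \<theta> * weighted_sum w1 w2 (d i) K x y" if "norm x < R/4" "norm y < R/4" for x y
      proof -
        have "norm (E t i (pair_vec 1 (x, y))) \<le> 2 * (1 + 2/R)^(2*K) * (M1 * norm t) * weighted_sum w1 w2 (d i) K x y"
          by (rule weighted_bound[OF Es[OF t] R(1) coeff w K]) (use that in auto)
        also have "\<dots> = (C * norm t) * weighted_sum w1 w2 (d i) K x y" by (simp add: C_def mult.assoc)
        also have "\<dots> \<le> \<theta> * weighted_sum w1 w2 (d i) K x y"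
          using elim(2) by (intro mult_right_mono weighted_sum_nonneg) auto
        finally show ?thesis .
      qed
      then show "\<forall>\<^sub>F z in nhds 0. norm (ft t (pair_vec 1 z) $ i - f (pair_vec 1 z) $ i) \<le> \<theta> * weighted_sum w1 w2 (d i) K (fst z) (snd z)"
        unfolding nhds0_box using R(1) by (intro exI[of _ "R/4"]) (auto simp: E_def)
    qed
  qed
qed

lemma pair_vec_swap: "pair_vec 2 z = pair_vec 1 (prod.swap z)"
  by (cases z) (simp add: pair_vec_1 pair_vec_2)

lemma non_decreasing_weights_estimate_swapped:
  fixes f :: "complex^2 \<Rightarrow> complex^3" and ft :: "complex \<Rightarrow> complex^2 \<Rightarrow> complex^3"
  assumes un: "unfolding_of f ft" and nd: "non_decreasing_weights f d w1 w2 ft"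
    and w: "w1 > 0" "w2 > 0" and K: "\<And>i. d i \<le> K" and th: "\<theta> > 0"
  shows "\<forall>\<^sub>F t in nhds 0. \<forall>i. \<forall>\<^sub>F z in nhds 0.
    norm (ft t (pair_vec 2 z) $ i - f (pair_vec 2 z) $ i) \<le> \<theta> * weighted_sum w2 w1 (d i) K (fst z) (snd z)"
  using non_decreasing_weights_estimate[OF assms]
proof eventually_elim
  case (elim t)
  show ?case
  proof
    fix i
    obtain \<tau> where "\<tau> > 0" "\<And>x y. norm x < \<tau> \<Longrightarrow> norm y < \<tau> \<Longrightarrow>
      norm (ft t (pair_vec 1 (x, y)) $ i - f (pair_vec 1 (x, y)) $ i) \<le> \<theta> * weighted_sum w1 w2 (d i) K x y"
      using elim[rule_format, of i] unfolding nhds0_box by auto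
    then show "\<forall>\<^sub>F z in nhds 0. norm (ft t (pair_vec 2 z) $ i - f (pair_vec 2 z) $ i) \<le> \<theta> * weighted_sum w2 w1 (d i) K (fst z) (snd z)"
      unfolding nhds0_box by (intro exI[of _ \<tau>]) (auto simp: pair_vec_swap weighted_sum_swap[of w2 w1])
  qed
qed

lemma other_indices: "\<exists>i2 i3. i1 \<noteq> i2 \<and> i1 \<noteq> i3 \<and> i2 \<noteq> i3 \<and> (\<forall>i::3. i = i1 \<or> i = i2 \<or> i = i3)"
proof -
  have "(1::3) \<noteq> 2" "(1::3) \<noteq> 3" "(2::3) \<noteq> 3" by simp_all
  then show ?thesis using exhaust_3[of i1] exhaust_3 by metis
qed

lemma corank_one_entry:
  fixes f :: "complex^2 \<Rightarrow> complex^3"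
  assumes "corank_one f"
  shows "\<exists>A i j. (f has_derivative (\<lambda>v. A *v v)) (at 0) \<and> A $ i $ j \<noteq> 0"
proof -
  obtain A where A: "(f has_derivative (\<lambda>v. A *v v)) (at 0)" "rank A = 1" using assms unfolding corank_one_def by blast
  have "A \<noteq> 0"
  proof
    assume "A = 0"
    then have "rows A = {0}" by (auto simp: rows_def row_def vec_eq_iff)
    then have "rank A = vec.dim (vec.span ({0} :: (complex^2) set))" by (simp add: row_rank_def_gen)
    also have "vec.span ({0} :: (complex^2) set) = vec.span {}" by simp
    finally show False using A(2) by (simp add: vec.dim_span)
  qed
  then obtain i j where "A $ i $ j \<noteq> 0" by (auto simp: vec_eq_iff)
  then show ?thesis using A(1) by blast
qed

text \<open>
  The only monomial of weight \<open>w1\<close> that contains \<open>x\<close> is \<open>x\<close> itself.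
\<close>

lemma weighted_linear_part:
  assumes wt: "\<And>a b. coeff (coeff P b) a \<noteq> 0 \<Longrightarrow> w1 * a + w2 * b = w1"
    and w: "w1 > 0" "w2 > 0" and \<alpha>: "coeff (coeff P 0) 1 = \<alpha>" "\<alpha> \<noteq> 0"
  shows "ev P (x, y) = \<alpha> * x + ev P (0, y)"
proof -
  have "ev P (x, y) - ev P (0, y) = (\<Sum>b\<le>degree P. \<Sum>a\<le>degree (coeff P b). coeff (coeff P b) a * (x ^ a - 0 ^ a) * y ^ b)"
    by (simp add: ev_expand2 sum_subtractf algebra_simps)
  also have "\<dots> = (\<Sum>b\<le>degree P. if b = 0 then \<alpha> * x else 0)"
  proof (rule sum.cong[OF refl])
    fix b
    have "coeff (coeff P b) a * (x ^ a - 0 ^ a) * y ^ b = (if a = 1 then (if b = 0 then \<alpha> * x else 0) else 0)" for a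
    proof (cases "coeff (coeff P b) a = 0 \<or> a = 0")
      case True
      then show ?thesis using \<alpha> by auto
    next
      case False
      then have e: "w1 * a + w2 * b = w1" using wt by blast
      have "w1 * 1 \<le> w1 * a" using False by (intro mult_le_mono2) auto
      then have "w2 * b = 0" using e by linarith
      then have "b = 0" using w by simp
      moreover from this have "a = 1" using e w by simp
      ultimately show ?thesis using \<alpha> by simp
    qed
    then have "(\<Sum>a\<le>degree (coeff P b). coeff (coeff P b) a * (x ^ a - 0 ^ a) * y ^ b)
       = (\<Sum>a\<le>degree (coeff P b). if a = 1 then (if b = 0 then \<alpha> * x else 0) else 0)" by (intro sum.cong) auto
    also have "\<dots> = (if b = 0 then \<alpha> * x else 0)"
    proof (cases "b = 0")
      case True
      have "1 \<le> degree (coeff P 0)" using \<alpha> by (intro le_degree) auto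
      then show ?thesis using True by simp
    qed simp
    finally show "(\<Sum>a\<le>degree (coeff P b). coeff (coeff P b) a * (x ^ a - 0 ^ a) * y ^ b) = (if b = 0 then \<alpha> * x else 0)" .
  qed
  also have "\<dots> = \<alpha> * x" by simp
  finally show ?thesis by (simp add: algebra_simps)
qed

text \<open>
  A nonzero entry in column \<open>e\<close> of the differential selects \<open>e\<close> as the coordinate to be eliminated.
\<close>

lemma quasihomogeneous_germ_pair_vec:
  fixes f :: "complex^2 \<Rightarrow> complex^3" and A :: "complex^2^3"
  assumes qh: "quasihomogeneous f d w1 w2" and A: "(f has_derivative (\<lambda>v. A *v v)) (at 0)" "A $ i1 $ e \<noteq> 0"
    and idx: "i1 \<noteq> i2" "i1 \<noteq> i3" "i2 \<noteq> i3" "\<And>i. i = i1 \<or> i = i2 \<or> i = i3"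
    and v: "v1 = (if e = 1 then w1 else w2)" "v2 = (if e = 1 then w2 else w1)"
  shows "\<exists>P \<alpha>. quasihomogeneous_germ (\<lambda>z. f (pair_vec e z)) P d v1 v2 i1 i2 i3 \<alpha>"
proof -
  have poly: "polynomial_map f" and f0: "f 0 = 0" and w: "w1 > 0" "w2 > 0"
    and hom: "\<And>k x y i. f (vector [k ^ w1 * x, k ^ w2 * y]) $ i = k ^ d i * f (vector [x, y]) $ i"
    using qh unfolding quasihomogeneous_def by auto
  obtain P where P: "\<And>z i. f (pair_vec e z) $ i = ev (P i) z" using polynomial_pair_vec[OF poly] by metis
  have vpos: "v1 > 0" "v2 > 0" using v w by auto
  have hom': "f (pair_vec e (s ^ v1 * x, s ^ v2 * y)) $ i = s ^ d i * f (pair_vec e (x, y)) $ i" for s x y i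
    using exhaust_2[of e] hom[of s x y i] hom[of s y x i] v by (auto simp: pair_vec_1 pair_vec_2)
  have wt: "v1 * a + v2 * b = d i" if "coeff (coeff (P i) b) a \<noteq> 0" for i a b
    by (rule weighted_homogeneous_coeff[OF _ that]) (simp add: P[symmetric] hom')
  define \<alpha> where "\<alpha> = A $ i1 $ e"
  have coeff1: "coeff (coeff (P i1) 0) 1 = \<alpha>"
  proof -
    have "((\<lambda>x::complex. pair_vec e (x, 0)) has_derivative (\<lambda>v. pair_vec e (v, 0))) (at 0)"
    proof (rule bounded_linear_imp_has_derivative)
      have "linear (\<lambda>x::complex. pair_vec e (x, 0))"
        by (rule linearI) (simp_all add: pair_vec_def vec_eq_iff)
      then show "bounded_linear (\<lambda>x::complex. pair_vec e (x, 0))" by (simp add: linear_conv_bounded_linear)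
    qed
    moreover have "(f has_derivative (\<lambda>v. A *v v)) (at (pair_vec e (0, 0)))"
      using A(1) by (simp add: zero_prod_def[symmetric])
    ultimately have "((\<lambda>x. f (pair_vec e (x, 0))) has_derivative (\<lambda>v. A *v pair_vec e (v, 0))) (at 0)"
      by (rule has_derivative_compose)
    from bounded_linear.has_derivative[OF bounded_linear_vec_nth this, of i1]
    have "((\<lambda>x. f (pair_vec e (x, 0)) $ i1) has_derivative (\<lambda>v. \<alpha> * v)) (at 0)"
      using exhaust_2[of e] by (auto simp: \<alpha>_def matrix_vector_mult_def sum_2 pair_vec_def)
    moreover have "f (pair_vec e (x, 0)) $ i1 = poly (coeff (P i1) 0) x" for x
    proof -
      have "f (pair_vec e (x, 0)) $ i1 = poly (slice (P i1) x) 0" by (simp add: P poly_slice)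
      then show ?thesis by (simp add: poly_0_coeff_0 coeff_slice)
    qed
    ultimately have "(poly (coeff (P i1) 0) has_field_derivative \<alpha>) (at 0)"
      by (simp add: has_field_derivative_def)
    then have "\<alpha> = poly (pderiv (coeff (P i1) 0)) 0" using poly_DERIV DERIV_unique by blast
    then show ?thesis by (simp add: poly_0_coeff_0 coeff_pderiv)
  qed
  have \<alpha>: "\<alpha> \<noteq> 0" using A(2) by (simp add: \<alpha>_def)
  have d1: "d i1 = v1" using wt[of i1 0 1] coeff1 \<alpha> by simp
  have lin: "f (pair_vec e (x, y)) $ i1 = \<alpha> * x + f (pair_vec e (0, y)) $ i1" for x y
    unfolding P by (rule weighted_linear_part[OF _ vpos coeff1 \<alpha>]) (use wt d1 in metis)
  have F0: "f (pair_vec e 0) = 0" using f0 by simp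
  have "quasihomogeneous_germ (\<lambda>z. f (pair_vec e z)) P d v1 v2 i1 i2 i3 \<alpha>"
    by unfold_locales ((rule P F0 vpos hom' idx(1,2,3) d1 \<alpha> lin) | (use idx(4) in blast))+
  then show ?thesis by blast
qed

theorem theorem1p3:
  fixes f :: "complex^2 \<Rightarrow> complex^3"
    and ft :: "complex \<Rightarrow> complex^2 \<Rightarrow> complex^3"
    and d :: "3 \<Rightarrow> nat" and w1 w2 :: nat
  assumes "quasihomogeneous f d w1 w2"
    and "finitely_determined f"
    and "corank_one f"
    and "unfolding_of f ft"
    and "topologically_trivial f ft"
    and "non_decreasing_weights f d w1 w2 ft"
  shows "equimultiple f ft"
proof -
  have poly: "polynomial_map f" and f0: "f 0 = 0" and wpos: "w1 > 0" "w2 > 0"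
    using assms(1) unfolding quasihomogeneous_def by auto
  obtain A :: "complex^2^3" and i1 e where A: "(f has_derivative (\<lambda>v. A *v v)) (at 0)" "A $ i1 $ e \<noteq> 0"
    using corank_one_entry[OF assms(3)] by blast
  obtain i2 i3 where idx: "i1 \<noteq> i2" "i1 \<noteq> i3" "i2 \<noteq> i3" "\<And>i. i = i1 \<or> i = i2 \<or> i = i3"
    using other_indices[of i1] by blast
  define v1 where "v1 = (if e = 1 then w1 else w2)"
  define v2 where "v2 = (if e = 1 then w2 else w1)"
  obtain P \<alpha> where "quasihomogeneous_germ (\<lambda>z. f (pair_vec e z)) P d v1 v2 i1 i2 i3 \<alpha>"
    using quasihomogeneous_germ_pair_vec[OF assms(1) A idx v1_def v2_def] by blast
  then interpret quasihomogeneous_germ "\<lambda>z. f (pair_vec e z)" P d v1 v2 i1 i2 i3 \<alpha> .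
  define K where "K = (\<Sum>i\<in>UNIV. d i)"
  have K: "d i \<le> K" for i unfolding K_def by (rule member_le_sum) auto
  obtain R M where R: "R > 0" and near: "\<And>t z. norm t < R \<Longrightarrow> norm z < R \<Longrightarrow>
     (\<exists>A. (ft t has_derivative (\<lambda>v. A *v v)) (at z)) \<and>
     (\<forall>i. \<exists>D. ((\<lambda>t. ft t z $ i) has_field_derivative D) (at t)) \<and>
     norm (ft t z) \<le> M \<and> ft 0 z = f z"
    using unfolding_near_0[OF assms(4)] by blast
  have smallt: "\<forall>\<^sub>F t::complex in nhds 0. norm t < R"
    unfolding eventually_nhds_metric using R by (intro exI[of _ R]) auto
  have germ: "holomorphic_germ (ft t)" if "norm t < R" for t
    unfolding holomorphic_germ_def eventually_nhds_metric using near[OF that] R by (intro exI[of _ R]) auto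
  have cont: "isCont (\<lambda>(z, t). ft t z) 0"
  proof -
    have "\<forall>\<^sub>F p in nhds 0. \<exists>A b. ((\<lambda>(z, t). ft t z) has_derivative (\<lambda>(v, s). A *v v + s *s b)) (at p)"
      using assms(4) unfolding unfolding_of_def by blast
    from eventually_nhds_x_imp_x[OF this] show ?thesis by (elim exE) (rule has_derivative_continuous)
  qed
  have ft00: "ft 0 0 = 0" using near[of 0 0] R f0 by simp
  have fe: "\<forall>\<^sub>F t in nhds 0. \<exists>\<eta> \<eta>'. fibre_equivalence \<eta> \<eta>' (\<lambda>z. ft t (pair_vec e z)) (\<lambda>z. f (pair_vec e z))"
    using topologically_trivial_fibres[OF assms(5) cont ft00]
    by eventually_elim (blast intro: fibre_equivalence_pair_vec)
  have est: "\<forall>\<^sub>F t in nhds 0. \<forall>i. \<forall>\<^sub>F z in nhds 0.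
      norm (ft t (pair_vec e z) $ i - f (pair_vec e z) $ i) \<le> \<theta> * weighted_sum v1 v2 (d i) K (fst z) (snd z)" if "\<theta> > 0" for \<theta>
  proof (cases "e = 1")
    case True
    then show ?thesis using non_decreasing_weights_estimate[OF assms(4,6) wpos K that] by (simp add: v1_def v2_def)
  next
    case False
    then have "e = 2" using exhaust_2[of e] by auto
    then show ?thesis using non_decreasing_weights_estimate_swapped[OF assms(4,6) wpos K that] by (simp add: v1_def v2_def)
  qed
  have hol: "\<forall>\<^sub>F t in nhds 0. \<forall>i. \<forall>\<^sub>F z in nhds 0. holo2_at (\<lambda>z. ft t (pair_vec e z) $ i) z"
    using smallt by eventually_elim (blast intro: holomorphic_germ_pair_vec germ)
  have H0: "\<forall>\<^sub>F t in nhds 0. ft t (pair_vec e 0) = 0" using assms(4) unfolding unfolding_of_def by simp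
  have fd: "finitely_determined2 (\<lambda>z. f (pair_vec e z))"
    by (rule finitely_determined2_pair_vec[OF assms(2) poly f0])
  obtain n where n: "\<forall>\<^sub>F r in at_right 0. has_multiplicity ((\<lambda>z. f (pair_vec e z)) ` ball 0 r) n"
      "\<forall>\<^sub>F t in nhds 0. \<forall>\<^sub>F r in at_right 0. has_multiplicity ((\<lambda>z. ft t (pair_vec e z)) ` ball 0 r) n"
    using family_equimultiple[OF fd K est hol H0 fe] by blast
  have "(\<lambda>z. g (pair_vec e z)) ` ball 0 r = g ` ball 0 r" for g :: "complex^2 \<Rightarrow> complex^3" and r
    using image_pair_vec_ball[of e r] by (metis image_image)
  then show ?thesis using n unfolding equimultiple_def image_has_multiplicity_def by auto
qed

end
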